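(* Let $\gamma>0$, $\kappa>0$ and $g_{11},g_{22},g_{12}\in\mathbb{R}$. For any $(u_0,v_0)\in H^1(\mathbb{R})\times H^1(\mathbb{R})$, there exists a unique global solution $(u(t),v(t))\in C(\mathbb{R},H^1(\mathbb{R})\times H^1(\mathbb{R}))$ of the system $$ \begin{aligned} i u_t &= -u_{xx} + \kappa v + i\gamma u - (g_{11}|u|^2 + g_{12}|v|^2)u,\\ i v_t &= -v_{xx} + \kappa u - i\gamma v - (g_{12}|u|^2 + g_{22}|v|^2)v, \end{aligned} $$ such that $(u(0),v(0))=(u_0,v_0)$.
   Context: Here $u=u(x,t)$ and $v=v(x,t)$ are complex-valued functions of $x\in\mathbb{R}$ and $t\in\mathbb{R}$, and $H^1(\mathbb{R})$ is the $L^2$-based Sobolev space of complex-valued functions. The system is called the generalized Manakov system. A solution in $C(\mathbb{R},H^1(\mathbb{R})\times H^1(\mathbb{R}))$ is understood in the usual sense for semilinear Schrödinger equations: it satisfies the Duhamel integral form of the system (equivalently, the equations hold in $H^{-1}(\mathbb{R})$ for every $t$). *)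

theory Defs
  imports "HOL-Analysis.Analysis"
begin

text \<open>Elements of \<open>L\<^sup>2\<close> and \<open>H\<^sup>1\<close> are represented by (Borel) functions on the real line; two
  representatives denote the same element iff they agree almost everywhere.\<close>

definition L2 :: "(real \<Rightarrow> complex) set" where
  "L2 = {f. f \<in> borel_measurable lborel \<and> integrable lborel (\<lambda>x. (cmod (f x))\<^sup>2)}"

definition L2_norm :: "(real \<Rightarrow> complex) \<Rightarrow> real" where
  "L2_norm f = sqrt (\<integral>x. (cmod (f x))\<^sup>2 \<partial>lborel)"

text \<open>Real-valued functions in \<open>C\<^sub>c\<^sup>\<infinity>\<close>. Testing complex-valued functions against real test
  functions is the same as testing against complex ones, by complex linearity.\<close>

definition test_function :: "(real \<Rightarrow> real) \<Rightarrow> bool" where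
  "test_function \<phi> \<longleftrightarrow>
     (\<forall>n. (deriv ^^ n) \<phi> differentiable_on UNIV) \<and> compact (closure {x. \<phi> x \<noteq> 0})"

definition has_weak_deriv :: "(real \<Rightarrow> complex) \<Rightarrow> (real \<Rightarrow> complex) \<Rightarrow> bool" where
  "has_weak_deriv f g \<longleftrightarrow>
     (\<forall>\<phi>. test_function \<phi> \<longrightarrow>
        (\<integral>x. deriv \<phi> x *\<^sub>R f x \<partial>lborel) = - (\<integral>x. \<phi> x *\<^sub>R g x \<partial>lborel))"

definition H1 :: "(real \<Rightarrow> complex) set" where
  "H1 = {f \<in> L2. \<exists>g\<in>L2. has_weak_deriv f g}"

text \<open>A representative of the weak derivative, which is unique up to null sets.\<close>

definition weak_deriv :: "(real \<Rightarrow> complex) \<Rightarrow> real \<Rightarrow> complex" where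
  "weak_deriv f = (SOME g. g \<in> L2 \<and> has_weak_deriv f g)"

definition H1_norm :: "(real \<Rightarrow> complex) \<Rightarrow> real" where
  "H1_norm f = sqrt ((L2_norm f)\<^sup>2 + (L2_norm (weak_deriv f))\<^sup>2)"

text \<open>\<open>H\<^sup>-\<^sup>1\<close> is the dual of \<open>H\<^sup>1\<close>. Functionals are functions on all of \<open>real \<Rightarrow> complex\<close>,
  but only their values on \<open>H1\<close> are meaningful.\<close>

definition Hm1 :: "((real \<Rightarrow> complex) \<Rightarrow> complex) set" where
  "Hm1 = {F. (\<forall>\<phi>\<in>H1. \<forall>\<psi>\<in>H1. \<forall>a b. F (\<lambda>x. a * \<phi> x + b * \<psi> x) = a * F \<phi> + b * F \<psi>) \<and>
             (\<exists>C. \<forall>\<phi>\<in>H1. cmod (F \<phi>) \<le> C * H1_norm \<phi>)}"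

definition Hm1_norm :: "((real \<Rightarrow> complex) \<Rightarrow> complex) \<Rightarrow> real" where
  "Hm1_norm F = (SUP \<phi>\<in>{\<phi> \<in> H1. H1_norm \<phi> \<le> 1}. cmod (F \<phi>))"

text \<open>The inclusion of \<open>L\<^sup>2\<close> in \<open>H\<^sup>-\<^sup>1\<close>, with the complex-bilinear pairing used for
  distributions (no complex conjugation).\<close>

definition L2_to_Hm1 :: "(real \<Rightarrow> complex) \<Rightarrow> (real \<Rightarrow> complex) \<Rightarrow> complex" where
  "L2_to_Hm1 f \<phi> = (\<integral>x. f x * \<phi> x \<partial>lborel)"

text \<open>The second derivative \<open>\<partial>\<^sub>x\<^sub>x : H\<^sup>1 \<rightarrow> H\<^sup>-\<^sup>1\<close>.\<close>

definition dxx :: "(real \<Rightarrow> complex) \<Rightarrow> (real \<Rightarrow> complex) \<Rightarrow> complex" where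
  "dxx f \<phi> = - (\<integral>x. weak_deriv f x * weak_deriv \<phi> x \<partial>lborel)"

definition continuous_in_H1 :: "(real \<Rightarrow> real \<Rightarrow> complex) \<Rightarrow> bool" where
  "continuous_in_H1 u \<longleftrightarrow>
     (\<forall>t. u t \<in> H1) \<and> (\<forall>t. ((\<lambda>s. H1_norm (\<lambda>x. u s x - u t x)) \<longlongrightarrow> 0) (at t))"

text \<open>Time derivative at \<open>t\<close> as the limit of difference quotients in the norm of \<open>H\<^sup>-\<^sup>1\<close>.\<close>

definition has_Hm1_time_deriv ::
  "(real \<Rightarrow> real \<Rightarrow> complex) \<Rightarrow> ((real \<Rightarrow> complex) \<Rightarrow> complex) \<Rightarrow> real \<Rightarrow> bool" where
  "has_Hm1_time_deriv u D t \<longleftrightarrow> D \<in> Hm1 \<and>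
     ((\<lambda>s. Hm1_norm (\<lambda>\<phi>. (L2_to_Hm1 (u s) \<phi> - L2_to_Hm1 (u t) \<phi>) / of_real (s - t) - D \<phi>))
        \<longlongrightarrow> 0) (at t)"

text \<open>Global solutions in \<open>C(\<real>, H\<^sup>1 \<times> H\<^sup>1)\<close>; here \<open>u t x\<close> stands for \<open>u(x,t)\<close>. For every \<open>t\<close> the
  equations hold in \<open>H\<^sup>-\<^sup>1\<close>, i.e. as an equality of functionals on \<open>H\<^sup>1\<close>.\<close>

definition manakov_solution ::
  "real \<Rightarrow> real \<Rightarrow> real \<Rightarrow> real \<Rightarrow> real \<Rightarrow>
   (real \<Rightarrow> real \<Rightarrow> complex) \<Rightarrow> (real \<Rightarrow> real \<Rightarrow> complex) \<Rightarrow> bool" where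
  "manakov_solution \<gamma> \<kappa> g11 g22 g12 u v \<longleftrightarrow>
     continuous_in_H1 u \<and> continuous_in_H1 v \<and>
     (\<forall>t. \<exists>ut vt. has_Hm1_time_deriv u ut t \<and> has_Hm1_time_deriv v vt t \<and>
        (\<forall>\<phi>\<in>H1.
           \<i> * ut \<phi> = - dxx (u t) \<phi>
             + L2_to_Hm1 (\<lambda>x. of_real \<kappa> * v t x + \<i> * of_real \<gamma> * u t x
                 - of_real (g11 * (cmod (u t x))\<^sup>2 + g12 * (cmod (v t x))\<^sup>2) * u t x) \<phi> \<and>
           \<i> * vt \<phi> = - dxx (v t) \<phi>
             + L2_to_Hm1 (\<lambda>x. of_real \<kappa> * u t x - \<i> * of_real \<gamma> * v t x
                 - of_real (g12 * (cmod (u t x))\<^sup>2 + g22 * (cmod (v t x))\<^sup>2) * v t x) \<phi>))"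

definition has_initial_data ::
  "(real \<Rightarrow> real \<Rightarrow> complex) \<Rightarrow> (real \<Rightarrow> real \<Rightarrow> complex) \<Rightarrow>
   (real \<Rightarrow> complex) \<Rightarrow> (real \<Rightarrow> complex) \<Rightarrow> bool" where
  "has_initial_data u v u0 v0 \<longleftrightarrow> (AE x in lborel. u 0 x = u0 x \<and> v 0 x = v0 x)"

end

theory Submission
  imports Defs
begin

text \<open>
  Write \<open>U = (u, v)\<close> and let \<open>V = H\<^sup>1 \<times> H\<^sup>1\<close>, a real Hilbert space whose elements are taken as
  pairs of continuous functions. Let \<open>T\<close> (the constant \<open>massop\<close> below) be the operator on \<open>V\<close> with
  \<open>\<langle>T U, W\<rangle>\<^sub>V = (U, W)\<close>, the inner product of \<open>L\<^sup>2 \<times> L\<^sup>2\<close>; that is, \<open>T = (1 - \<partial>\<^sub>x\<^sub>x)\<^sup>-\<^sup>1\<close>. Let \<open>G\<close>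
  (the constant \<open>rot\<close>) be multiplication by \<open>-\<i>\<close>. The system reads \<open>U\<^sub>t = G T\<^sup>-\<^sup>1 U + F(U)\<close>, where \<open>F\<close>
  (the constant \<open>forcing\<close>) contains everything that maps \<open>H\<^sup>1\<close> to itself. Applying \<open>T\<close> turns it into
  \<open>(T U)' = G U + T F(U)\<close>, an equation between continuous functions with values in \<open>V\<close>; since
  \<open>T U\<close> represents the functional \<open>(U, \<cdot>)\<close> in \<open>V\<close>, this is precisely the equation in \<open>H\<^sup>-\<^sup>1\<close>.

  \<^bold>\<open>Lipschitz right-hand sides.\<close> The operator \<open>T\<close> is bounded, symmetric, positive and injective, and
  \<open>G\<close> is a skew isometry commuting with it; from these properties the equation is solved for every
  globally Lipschitz \<open>F\<close>. One replaces \<open>T\<^sup>-\<^sup>1\<close> by the bounded operator \<open>(T + \<epsilon>)\<^sup>-\<^sup>1\<close> and solves an ordinary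
  differential equation. Its linear part is skew, so distances between solutions grow at most like
  \<open>exp (L \<bar>t\<bar>)\<close>; applied to time translates this bounds the speed uniformly in \<open>\<epsilon>\<close> for data in the range
  of \<open>T\<close>, and the speed bound makes the approximations Cauchy as \<open>\<epsilon> \<rightarrow> 0\<close> (the argument of Yosida,
  Komura and Brezis for monotone operators). The range of \<open>T\<close> is dense, so all data are reached. The
  error in the energy balance is of order \<open>\<epsilon>\<close>, so the limit satisfies the exact energy balance
  although it need not be differentiable in \<open>V\<close>. This is the locale \<open>skew_flow\<close>.

  \<^bold>\<open>Global bounds.\<close> In one dimension \<open>H\<^sup>1\<close> is an algebra, so the cubic \<open>F\<close> is Lipschitz on bounded
  sets, and composing it with the radial retraction onto a ball makes it globally Lipschitz. The cubic
  terms and the coupling \<open>\<kappa>\<close> preserve the mass, and gain and loss change it at a rate of at most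
  \<open>2 \<gamma>\<close> times the mass. With the mass bounded on compact time intervals, the inequality
  \<open>\<bar>u\<bar>\<^sup>2 \<le> 3 \<parallel>u\<parallel> \<parallel>u\<parallel>\<^bsub>H\<^sup>1\<^esub>\<close> makes the quartic part of the energy of lower order, whatever the signs of
  the coefficients; the energy then controls the \<open>H\<^sup>1\<close> norm and grows at most exponentially
  (\<open>energy_bounds\<close>, \<open>a_priori_bound\<close>). Hence the solution of the retracted equation with a large radius
  never feels the retraction on a given time interval (\<open>Vsol_exists\<close>).

  \<^bold>\<open>Uniqueness.\<close> A solution in the sense of \<open>H\<^sup>-\<^sup>1\<close> satisfies \<open>(T U)' = G U + T F(U)\<close>, first tested
  against each element of \<open>V\<close> and then, the right-hand side being continuous, strongly. For the
  difference \<open>Z\<close> of two solutions the derivative of \<open>\<langle>T Z, Z\<rangle> = \<parallel>Z\<parallel>\<^sup>2\<close> (norm of \<open>L\<^sup>2\<close>) is at most a constant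
  times itself, because \<open>F\<close> is also Lipschitz for the \<open>L\<^sup>2\<close> norm on \<open>H\<^sup>1\<close>-bounded sets
  (\<open>Vsol_unique\<close>). The same lemma glues the solutions on growing intervals.

  \<^bold>\<open>The space \<open>H\<^sup>1\<close>.\<close> Weak derivatives are handled through primitives: a function with a weak
  derivative \<open>g\<close> agrees almost everywhere with an integral of \<open>g\<close> (\<open>has_weak_deriv_ac_primitive\<close>).
  This gives continuous representatives, the product rule and the supremum bound.
\<close>

section \<open>Gronwall estimates and differential equations in Banach spaces\<close>

lemma gronwall_forward:
  fixes \<phi> \<phi>' :: "real \<Rightarrow> real"
  assumes der: "\<And>t. 0 \<le> t \<Longrightarrow> t < \<tau> \<Longrightarrow> (\<phi> has_real_derivative \<phi>' t) (at t)"
    and le: "\<And>t. 0 \<le> t \<Longrightarrow> t < \<tau> \<Longrightarrow> \<phi>' t \<le> K * \<phi> t + c"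
    and K: "K > 0" and t: "0 \<le> t" "t < \<tau>"
  shows "\<phi> t \<le> (\<phi> 0 + c / K) * exp (K * t) - c / K"
proof -
  define \<psi> where "\<psi> s = (\<phi> s + c / K) * exp (- K * s)" for s
  have "\<psi> t \<le> \<psi> 0"
  proof (rule DERIV_nonpos_imp_nonincreasing[OF t(1)])
    fix s assume s: "0 \<le> s" "s \<le> t"
    have d: "(\<psi> has_real_derivative (\<phi>' s * exp (- K * s) + (\<phi> s + c / K) * (- K * exp (- K * s)))) (at s)"
      unfolding \<psi>_def
      by (auto intro!: derivative_eq_intros der[of s] s order.strict_trans1[OF s(2) t(2)])
    have "\<phi>' s * exp (- K * s) + (\<phi> s + c / K) * (- K * exp (- K * s))
        = (\<phi>' s - (K * \<phi> s + c)) * exp (- K * s)"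
      using K by (simp add: field_simps)
    also have "\<dots> \<le> 0"
      using le[of s] s t by (intro mult_nonpos_nonneg) auto
    finally show "\<exists>y. (\<psi> has_real_derivative y) (at s) \<and> y \<le> 0"
      using d by blast
  qed
  then have "(\<phi> t + c / K) * exp (- K * t) \<le> \<phi> 0 + c / K"
    by (simp add: \<psi>_def)
  then have "(\<phi> t + c / K) * exp (- K * t) * exp (K * t) \<le> (\<phi> 0 + c / K) * exp (K * t)"
    by (intro mult_right_mono) auto
  then show ?thesis
    by (simp add: mult.assoc flip: exp_add)
qed

text \<open>Both time directions at once: the bound on \<open>\<bar>\<phi>'\<bar>\<close> is invariant under \<open>t \<mapsto> -t\<close>.\<close>
lemma gronwall:
  fixes \<phi> \<phi>' :: "real \<Rightarrow> real"
  assumes der: "\<And>t. \<bar>t\<bar> < \<tau> \<Longrightarrow> (\<phi> has_real_derivative \<phi>' t) (at t)"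
    and le: "\<And>t. \<bar>t\<bar> < \<tau> \<Longrightarrow> \<bar>\<phi>' t\<bar> \<le> K * \<phi> t + c"
    and K: "K > 0" and t: "\<bar>t\<bar> < \<tau>"
  shows "\<phi> t \<le> (\<phi> 0 + c / K) * exp (K * \<bar>t\<bar>) - c / K"
proof (cases "0 \<le> t")
  case True
  then show ?thesis
    using t K gronwall_forward[of \<tau> \<phi> \<phi>' K c t] der le by (force simp: abs_le_iff)
next
  case False
  have "((\<lambda>s. \<phi> (- s)) has_real_derivative - \<phi>' (- s)) (at s)" if "0 \<le> s" "s < \<tau>" for s
    using DERIV_chain2[OF der[of "- s"] DERIV_minus[OF DERIV_ident]] that by auto
  moreover have "- \<phi>' (- s) \<le> K * \<phi> (- s) + c" if "0 \<le> s" "s < \<tau>" for s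
    using le[of "- s"] that by auto
  ultimately show ?thesis
    using gronwall_forward[of \<tau> "\<lambda>s. \<phi> (- s)" "\<lambda>s. - \<phi>' (- s)" K c "- t"] False K t
    by auto
qed

text \<open>Comparison of \<open>f\<close> with \<open>c / K * exp (K t)\<close>, whose derivative is the assumed bound.\<close>
lemma norm_growth_forward:
  fixes f :: "real \<Rightarrow> 'a::real_normed_vector"
  assumes der: "\<And>t. (f has_vector_derivative f' t) (at t)"
    and le: "\<And>t. 0 \<le> t \<Longrightarrow> norm (f' t) \<le> c * exp (K * t)" and K: "K > 0" and t: "0 \<le> t"
  shows "norm (f t - f 0) \<le> c / K * exp (K * t) - c / K"
proof (cases "t = 0")
  case False
  have "norm (f t - f 0) \<le> c / K * exp (K * t) - c / K * exp (K * 0)"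
  proof (rule differentiable_bound_general)
    show "0 < t" using t False by simp
    show "continuous_on {0..t} f"
      using der by (meson continuous_at_imp_continuous_on has_vector_derivative_continuous)
    show "((\<lambda>t. c / K * exp (K * t)) has_vector_derivative c * exp (K * s)) (at s)" for s
      unfolding has_real_derivative_iff_has_vector_derivative[symmetric]
      using K by (auto intro!: derivative_eq_intros)
    show "continuous_on {0..t} (\<lambda>t. c / K * exp (K * t))" by (intro continuous_intros)
  qed (use der le in auto)
  then show ?thesis by simp
qed simp

lemma norm_growth:
  fixes f :: "real \<Rightarrow> 'a::real_normed_vector"
  assumes der: "\<And>t. (f has_vector_derivative f' t) (at t)"
    and le: "\<And>t. norm (f' t) \<le> c * exp (K * \<bar>t\<bar>)" and K: "K > 0"
  shows "norm (f t - f 0) \<le> c / K * exp (K * \<bar>t\<bar>) - c / K"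
proof (cases "0 \<le> t")
  case True
  have "norm (f' t) \<le> c * exp (K * t)" if "0 \<le> t" for t using le[of t] that by simp
  then show ?thesis
    using norm_growth_forward[of f f' c K t] True K der by auto
next
  case False
  have 1: "((\<lambda>s. f (- s)) has_vector_derivative - f' (- s)) (at s)" for s
    using vector_diff_chain_at[OF has_vector_derivative_minus[OF has_vector_derivative_id] der[of "- s"]]
    by (simp add: o_def)
  have 2: "norm (- f' (- s)) \<le> c * exp (K * s)" if "0 \<le> s" for s
    using le[of "- s"] that by auto
  show ?thesis
    using norm_growth_forward[of "\<lambda>s. f (- s)" "\<lambda>s. - f' (- s)", OF 1 2 K, of "- t"] False by auto
qed

lemma continuous_has_antiderivative:
  fixes g :: "real \<Rightarrow> 'a::banach"
  assumes g: "continuous_on UNIV g"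
  shows "\<exists>f. f 0 = 0 \<and> (\<forall>t. (f has_vector_derivative g t) (at t))"
proof -
  define f where "f t = integral {0..t} g - integral {t..0} g" for t
  have "(f has_vector_derivative g t) (at t)" for t
  proof -
    define a where "a = \<bar>t\<bar> + 1"
    have a: "- a < t" "t < a" "- a < 0" "0 < a" by (auto simp: a_def)
    have int: "g integrable_on {x..y}" for x y
      by (intro integrable_continuous_real continuous_on_subset[OF g]) auto
    have eq: "f s = integral {- a..s} g - integral {- a..0} g" if "s \<in> {- a..a}" for s
    proof (cases "0 \<le> s")
      case True
      then have "integral {s..0} g = 0" by (cases "s = 0") auto
      then show ?thesis
        using Henstock_Kurzweil_Integration.integral_combine[of "- a" 0 s g] True a int by (auto simp: f_def algebra_simps)
    next
      case False
      then have "integral {0..s} g = 0" by auto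
      then show ?thesis
        using Henstock_Kurzweil_Integration.integral_combine[of "- a" s 0 g] False that int by (auto simp: f_def algebra_simps)
    qed
    have "((\<lambda>s. integral {- a..s} g - integral {- a..0} g) has_vector_derivative g t) (at t within {- a..a})"
      using integral_has_vector_derivative[of "- a" a g t] a
      by (auto intro!: derivative_eq_intros continuous_on_subset[OF g])
    then have "(f has_vector_derivative g t) (at t within {- a..a})"
      using a by (auto intro: has_vector_derivative_transform eq)
    then show ?thesis
      using a by (simp add: at_within_Icc_at)
  qed
  moreover have "f 0 = 0" by (simp add: f_def)
  ultimately show ?thesis by blast
qed

text \<open>Picard iteration converges on all of \<open>\<real>\<close> at once in the norm \<open>sup \<parallel>u(t)\<parallel> exp (-2 L \<bar>t\<bar>)\<close>: integrating
  \<open>L exp (2 L \<bar>s\<bar>)\<close> gains the factor \<open>1/2\<close>. The unknown is therefore written as \<open>w y\<close> with a bounded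
  continuous \<open>y\<close> and the weight \<open>w(t) = exp (2 L \<bar>t\<bar>)\<close>.\<close>
lemma global_Lipschitz_ODE:
  fixes F :: "'a::banach \<Rightarrow> 'a"
  assumes lip: "\<And>x y. norm (F x - F y) \<le> L * norm (x - y)" and L: "L > 0"
  shows "\<exists>u. u 0 = u0 \<and> (\<forall>t::real. (u has_vector_derivative F (u t)) (at t))"
proof -
  define lam where "lam = 2 * L"
  have lam: "lam > 0" using L by (simp add: lam_def)
  define w :: "real \<Rightarrow> real" where "w t = exp (lam * \<bar>t\<bar>)" for t
  have w: "w t \<ge> 1" "w t > 0" for t using lam by (auto simp: w_def)
  have wcont: "continuous_on UNIV w" unfolding w_def by (intro continuous_intros)
  have Fcont: "continuous_on UNIV F"
    by (rule lipschitz_on_continuous_on[OF lipschitz_onI[of UNIV F L]])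
      (use L lip in \<open>auto simp: dist_norm\<close>)
  define P where "P g = (SOME f. f 0 = 0 \<and> (\<forall>t. (f has_vector_derivative g t) (at t)))" for g :: "real \<Rightarrow> 'a"
  have P: "P g 0 = 0" "(P g has_vector_derivative g t) (at t)" if "continuous_on UNIV g" for g t
    using someI_ex[OF continuous_has_antiderivative[OF that]] by (auto simp: P_def)
  define h where "h y s = F (w s *\<^sub>R apply_bcontfun y s)" for y s
  have hcont: "continuous_on UNIV (h y)" for y
    unfolding h_def by (intro continuous_intros continuous_on_compose2[OF Fcont] wcont) auto
  have Pcont: "continuous_on UNIV (P (h y))" for y
    using P(2)[OF hcont] by (meson continuous_at_imp_continuous_on has_vector_derivative_continuous)
  define \<Phi> where "\<Phi> y t = (1 / w t) *\<^sub>R (u0 + P (h y) t)" for y t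
  have nb: "norm (apply_bcontfun y s) \<le> norm y" for y :: "real \<Rightarrow>\<^sub>C 'a" and s
    by (rule norm_bounded)
  have hb: "norm (h y s) \<le> (norm (F 0) + L * norm y) * w s" for y s
  proof -
    have "norm (h y s) \<le> norm (F 0) + norm (h y s - F 0)" by norm
    also have "norm (h y s - F 0) \<le> L * norm (w s *\<^sub>R apply_bcontfun y s - 0)"
      unfolding h_def by (rule lip)
    also have "\<dots> \<le> L * (w s * norm y)"
      using nb[of y s] w[of s] L by (simp add: mult_left_mono)
    finally have "norm (h y s) \<le> norm (F 0) * 1 + L * norm y * w s" by (simp add: mult_ac)
    also have "\<dots> \<le> norm (F 0) * w s + L * norm y * w s"
      using mult_left_mono[OF w(1)[of s] norm_ge_zero[of "F 0"]] by simp
    finally show ?thesis by (simp add: algebra_simps)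
  qed
  have Pb: "norm (P (h y) t) \<le> (norm (F 0) + L * norm y) / lam * w t" for y t
  proof -
    have "norm (P (h y) t - P (h y) 0) \<le> (norm (F 0) + L * norm y) / lam * exp (lam * \<bar>t\<bar>) - (norm (F 0) + L * norm y) / lam"
      by (rule norm_growth[OF P(2)[OF hcont] hb[unfolded w_def] lam])
    moreover have "(norm (F 0) + L * norm y) / lam \<ge> 0" using L lam by auto
    ultimately show ?thesis using P(1)[OF hcont, of y] by (simp add: w_def)
  qed
  have mem: "\<Phi> y \<in> bcontfun" for y
  proof -
    have "continuous_on UNIV (\<Phi> y)"
      unfolding \<Phi>_def using w by (intro continuous_intros Pcont wcont) (auto simp: less_le)
    moreover have "norm (\<Phi> y t) \<le> norm u0 + (norm (F 0) + L * norm y) / lam" for t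
    proof -
      have "norm (\<Phi> y t) \<le> (1 / w t) * (norm u0 + norm (P (h y) t))"
        unfolding \<Phi>_def using w[of t] norm_triangle_ineq[of u0 "P (h y) t"]
        by (simp add: divide_right_mono)
      also have "\<dots> \<le> (1 / w t) * (norm u0 * w t + (norm (F 0) + L * norm y) / lam * w t)"
        using w[of t] Pb[of y t] mult_left_mono[OF w(1)[of t] norm_ge_zero[of u0]] by (intro mult_left_mono add_mono) auto
      also have "\<dots> = norm u0 + (norm (F 0) + L * norm y) / lam"
        using w[of t] by (simp add: field_simps)
      finally show ?thesis .
    qed
    ultimately show ?thesis by (auto simp: bcontfun_def bounded_iff)
  qed
  define \<Theta> where "\<Theta> y = Bcontfun (\<Phi> y)" for y
  have app: "apply_bcontfun (\<Theta> y) = \<Phi> y" for y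
    unfolding \<Theta>_def by (rule Bcontfun_inverse[OF mem])
  have contr: "dist (\<Theta> y) (\<Theta> z) \<le> 1 / 2 * dist y z" for y z
  proof (rule dist_bound)
    fix t
    have "norm (h y s - h z s) \<le> L * norm (y - z) * w s" for s
    proof -
      have "norm (h y s - h z s) \<le> L * norm (w s *\<^sub>R apply_bcontfun y s - w s *\<^sub>R apply_bcontfun z s)"
        unfolding h_def by (rule lip)
      also have "\<dots> = L * (w s * norm (apply_bcontfun (y - z) s))"
        using w[of s] by (simp flip: scaleR_diff_right)
      also have "\<dots> \<le> L * (w s * norm (y - z))"
        using nb[of "y - z" s] w[of s] L by (intro mult_left_mono) auto
      finally show ?thesis by (simp add: mult_ac)
    qed
    then have "norm ((P (h y) t - P (h z) t) - (P (h y) 0 - P (h z) 0))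
        \<le> L * norm (y - z) / lam * exp (lam * \<bar>t\<bar>) - L * norm (y - z) / lam"
      by (intro norm_growth[where f' = "\<lambda>s. h y s - h z s"] lam)
        (auto intro!: derivative_intros P hcont simp: w_def)
    then have "norm (P (h y) t - P (h z) t) \<le> L * norm (y - z) / lam * w t"
      using P(1)[OF hcont, of y] P(1)[OF hcont, of z] L lam by (simp add: w_def) (smt (verit) divide_nonneg_pos mult_nonneg_nonneg norm_ge_zero)
    moreover have "norm (\<Phi> y t - \<Phi> z t) = norm (P (h y) t - P (h z) t) / w t"
    proof -
      have "\<Phi> y t - \<Phi> z t = (1 / w t) *\<^sub>R (P (h y) t - P (h z) t)"
        by (simp add: \<Phi>_def scaleR_diff_right scaleR_add_right)
      then show ?thesis using w[of t] by simp
    qed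
    ultimately show "dist (apply_bcontfun (\<Theta> y) t) (apply_bcontfun (\<Theta> z) t) \<le> 1 / 2 * dist y z"
      using w(2)[of t] L by (simp add: app dist_norm lam_def pos_divide_le_eq mult.commute)
  qed
  obtain y where y: "\<Theta> y = y"
    using banach_fix_type[of "1/2" \<Theta>] contr by auto
  define u where "u t = w t *\<^sub>R apply_bcontfun y t" for t
  have u: "u t = u0 + P (h y) t" for t
    using app[of y] w[of t] by (simp add: u_def y \<Phi>_def)
  have "(u has_vector_derivative F (u t)) (at t)" for t
  proof -
    have "(u has_vector_derivative h y t) (at t)"
      unfolding u[abs_def] by (auto intro!: derivative_eq_intros P hcont)
    then show ?thesis by (simp add: h_def u_def)
  qed
  moreover have "u 0 = u0" using u[of 0] P(1)[OF hcont] by simp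
  ultimately show ?thesis by blast
qed

section \<open>Linear operators on Hilbert spaces and uniform limits\<close>

text \<open>The Lax-Milgram theorem: for small \<open>\<tau>\<close> the map \<open>w \<mapsto> w - \<tau> (M w - f)\<close> is a contraction, since
  coercivity makes the first-order term of \<open>\<parallel>z - \<tau> M z\<parallel>\<^sup>2\<close> at least \<open>2 \<tau> e \<parallel>z\<parallel>\<^sup>2\<close>, against a second-order
  term of size \<open>\<tau>\<^sup>2 C\<^sup>2 \<parallel>z\<parallel>\<^sup>2\<close>.\<close>
lemma coercive_bijective:
  fixes M :: "'a::{real_inner,banach} \<Rightarrow> 'a"
  assumes M: "bounded_linear M" and co: "\<And>x. e * (norm x)\<^sup>2 \<le> M x \<bullet> x" and e: "e > 0"
  shows "\<exists>!w. M w = f"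
proof -
  interpret M: bounded_linear M by fact
  obtain C where C: "C > 0" "\<And>x. norm (M x) \<le> norm x * C" using M.pos_bounded by blast
  \<comment> \<open>The first bound lets half of the coercivity absorb the second-order term, the second keeps \<open>q\<close> nonnegative.\<close>
  define \<tau> where "\<tau> = min (e / C\<^sup>2) (1 / (2 * e))"
  have \<tau>: "\<tau> > 0" "\<tau> \<le> e / C\<^sup>2" "\<tau> \<le> 1 / (2 * e)" using e C by (auto simp: \<tau>_def)
  define q where "q = 1 - \<tau> * e"
  have te: "\<tau> * e \<le> 1 / 2" "\<tau> * e > 0" using \<tau> e by (auto simp: field_simps)
  have q: "0 \<le> q" "q < 1" using te by (auto simp: q_def)
  have step: "(norm (z - \<tau> *\<^sub>R M z))\<^sup>2 \<le> q * (norm z)\<^sup>2" for z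
  proof -
    have "(norm (z - \<tau> *\<^sub>R M z))\<^sup>2 = (norm z)\<^sup>2 - 2 * \<tau> * (M z \<bullet> z) + \<tau>\<^sup>2 * (norm (M z))\<^sup>2"
      unfolding power2_norm_eq_inner by (simp add: algebra_simps inner_commute power2_eq_square)
    also have "\<dots> \<le> (norm z)\<^sup>2 - 2 * \<tau> * (e * (norm z)\<^sup>2) + \<tau>\<^sup>2 * (norm z * C)\<^sup>2"
      using co[of z] \<tau> C(2)[of z] by (intro add_mono diff_mono mult_left_mono power_mono) auto
    also have "\<tau>\<^sup>2 * (norm z * C)\<^sup>2 = \<tau> * (\<tau> * C\<^sup>2) * (norm z)\<^sup>2"
      by (simp add: power2_eq_square)
    also have "\<dots> \<le> \<tau> * e * (norm z)\<^sup>2"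
      using \<tau> C by (intro mult_right_mono mult_left_mono) (auto simp: field_simps)
    finally show ?thesis by (simp add: q_def algebra_simps)
  qed
  define g where "g w = w - \<tau> *\<^sub>R (M w - f)" for w
  have "dist (g x) (g y) \<le> sqrt q * dist x y" for x y
  proof -
    have "g x - g y = (x - y) - \<tau> *\<^sub>R M (x - y)" by (simp add: g_def M.diff algebra_simps)
    then have "(norm (g x - g y))\<^sup>2 \<le> (sqrt q * norm (x - y))\<^sup>2"
      using step[of "x - y"] q by (simp add: power_mult_distrib)
    then show ?thesis
      unfolding dist_norm by (rule power2_le_imp_le) (simp add: q)
  qed
  then have "\<exists>!w. g w = w"
    using q by (intro banach_fix_type[of "sqrt q"]) auto
  moreover have "g w = w \<longleftrightarrow> M w = f" for w using \<tau> by (auto simp: g_def)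
  ultimately show ?thesis by simp
qed

text \<open>By the parallelogram law a minimizing sequence for the distance is Cauchy; the limit \<open>l\<close> minimizes
  the distance, and comparing it with \<open>l + t s\<close> for the best \<open>t\<close> gives orthogonality.\<close>
lemma closed_subspace_projection:
  fixes S :: "'a::{real_inner,banach} set"
  assumes S: "subspace S" "closed S"
  shows "\<exists>p\<in>S. \<forall>s\<in>S. (u - p) \<bullet> s = 0"
proof -
  have ne: "S \<noteq> {}" using S(1) subspace_0 by blast
  define d where "d = infdist u S"
  have dle: "d \<le> norm (u - s)" if "s \<in> S" for s
    using infdist_le[OF that, of u] by (simp add: d_def dist_norm)
  have d0: "d \<ge> 0" by (simp add: d_def infdist_nonneg)
  have "\<exists>p\<in>S. (norm (u - p))\<^sup>2 < d\<^sup>2 + 1 / real (Suc n)" for n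
  proof -
    have "sqrt (d\<^sup>2 + 1 / real (Suc n)) > d"
      using d0 by (intro real_less_rsqrt) auto
    then have "infdist u S < sqrt (d\<^sup>2 + 1 / real (Suc n))" by (simp add: d_def)
    then obtain p where p: "p \<in> S" "dist u p < sqrt (d\<^sup>2 + 1 / real (Suc n))"
      using cInf_lessD[of "dist u ` S"] ne by (auto simp: infdist_notempty[OF ne])
    then have "(dist u p)\<^sup>2 < (sqrt (d\<^sup>2 + 1 / real (Suc n)))\<^sup>2"
      by (intro power_strict_mono) auto
    then show ?thesis using p(1) by (auto simp: dist_norm intro!: bexI[of _ p] add_nonneg_nonneg)
  qed
  then obtain p where pS: "\<And>n. p n \<in> S" and p: "\<And>n. (norm (u - p n))\<^sup>2 < d\<^sup>2 + 1 / real (Suc n)"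
    by metis
  have par: "(norm (p n - p m))\<^sup>2 \<le> 2 / real (Suc n) + 2 / real (Suc m)" for n m
  proof -
    have "(1/2) *\<^sub>R (p n + p m) \<in> S" using pS S(1) by (intro subspace_scale subspace_add) auto
    then have "d\<^sup>2 \<le> (norm (u - (1/2) *\<^sub>R (p n + p m)))\<^sup>2"
      by (intro power_mono dle d0)
    also have "\<dots> = (norm ((u - p n) + (u - p m)) / 2)\<^sup>2"
    proof -
      have "u - (1/2) *\<^sub>R (p n + p m) = (1/2) *\<^sub>R ((u - p n) + (u - p m))"
        by (simp add: algebra_simps flip: scaleR_2)
      then show ?thesis by (simp add: norm_scaleR)
    qed
    also have "\<dots> = (norm (u - p n))\<^sup>2 / 2 + (norm (u - p m))\<^sup>2 / 2 - (norm ((u - p n) - (u - p m)))\<^sup>2 / 4"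
      unfolding power_divide power2_norm_eq_inner inner_add_left inner_add_right inner_diff_left[of "u - p n" "u - p m"]
        inner_diff_right[of _ "u - p n" "u - p m"]
      by (simp add: inner_commute[of "u - p m" "u - p n"] field_simps)
    also have "norm ((u - p n) - (u - p m)) = norm (p n - p m)" by (simp add: norm_minus_commute)
    finally show ?thesis using p[of n] p[of m] by linarith
  qed
  have "Cauchy p"
  proof (rule metric_CauchyI)
    fix e :: real assume e: "e > 0"
    obtain N where N: "N > 0" "1 / real N < e\<^sup>2 / 4" using real_arch_inverse[of "e\<^sup>2/4"] e
      by (auto simp: inverse_eq_divide)
    show "\<exists>M. \<forall>m\<ge>M. \<forall>n\<ge>M. dist (p m) (p n) < e"
    proof (intro exI allI impI)
      fix m n assume mn: "m \<ge> N" "n \<ge> N"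
      have 1: "1 / real (Suc k) \<le> 1 / real N" if "k \<ge> N" for k
        using that N by (intro divide_left_mono) auto
      have "(norm (p m - p n))\<^sup>2 < e\<^sup>2"
        using par[of m n] 1[OF mn(1)] 1[OF mn(2)] N by linarith
      then show "dist (p m) (p n) < e" using e by (simp add: dist_norm power_less_imp_less_base)
    qed
  qed
  then obtain l where l: "p \<longlonglongrightarrow> l" using Cauchy_convergent convergent_def by blast
  have lS: "l \<in> S" using closed_sequentially[OF S(2) pS l] .
  have "(norm (u - l))\<^sup>2 \<le> d\<^sup>2 + 0"
  proof (rule LIMSEQ_le)
    show "(\<lambda>n. (norm (u - p n))\<^sup>2) \<longlonglongrightarrow> (norm (u - l))\<^sup>2" by (intro tendsto_intros l)
    show "(\<lambda>n. d\<^sup>2 + 1 / real (Suc n)) \<longlonglongrightarrow> d\<^sup>2 + 0"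
      using LIMSEQ_inverse_real_of_nat by (intro tendsto_intros) (simp add: inverse_eq_divide)
    show "\<exists>N. \<forall>n\<ge>N. (norm (u - p n))\<^sup>2 \<le> d\<^sup>2 + 1 / real (Suc n)" using p less_imp_le by blast
  qed
  then have ld: "(norm (u - l))\<^sup>2 \<le> d\<^sup>2" by simp
  have "(u - l) \<bullet> s = 0" if s: "s \<in> S" for s
  proof (cases "s = 0")
    case False
    define a where "a = (u - l) \<bullet> s"
    define t where "t = a / (norm s)\<^sup>2"
    have "d\<^sup>2 \<le> (norm (u - (l + t *\<^sub>R s)))\<^sup>2"
      using lS s S(1) by (intro power_mono dle d0 subspace_add subspace_scale)
    also have "\<dots> = (norm (u - l))\<^sup>2 - 2 * t * a + t\<^sup>2 * (norm s)\<^sup>2"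
      unfolding power2_norm_eq_inner a_def by (simp add: algebra_simps inner_commute power2_eq_square)
    also have "\<dots> = (norm (u - l))\<^sup>2 - a\<^sup>2 / (norm s)\<^sup>2"
      using False by (simp add: t_def power2_eq_square)
    finally have "a\<^sup>2 / (norm s)\<^sup>2 \<le> 0" using ld by simp
    then have "a\<^sup>2 \<le> 0" using False by (simp add: divide_le_0_iff)
    then show ?thesis by (simp add: a_def)
  qed auto
  then show ?thesis using lS by blast
qed

text \<open>A functional is a multiple of the inner product with any nonzero vector orthogonal to its kernel.\<close>
lemma Riesz_representation:
  fixes f :: "'a::{real_inner,banach} \<Rightarrow> real"
  assumes "bounded_linear f"
  shows "\<exists>r. \<forall>x. f x = r \<bullet> x"
proof (cases "\<forall>x. f x = 0")
  case True
  then show ?thesis by (intro exI[of _ 0]) simp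
next
  case False
  interpret f: bounded_linear f by fact
  obtain u where u: "f u \<noteq> 0" using False by blast
  define S where "S = {x. f x = 0}"
  have "subspace S" by (auto simp: S_def subspace_def f.zero f.add f.scaleR)
  moreover have "closed S"
    unfolding S_def by (intro closed_Collect_eq continuous_intros linear_continuous_on assms)
  ultimately obtain p where p: "p \<in> S" "\<forall>s\<in>S. (u - p) \<bullet> s = 0"
    using closed_subspace_projection by blast
  define r where "r = u - p"
  have fr: "f r \<noteq> 0" using u p(1) by (simp add: r_def S_def f.diff)
  then have r0: "r \<noteq> 0" using f.zero by auto
  have "f x = (f r / (r \<bullet> r)) *\<^sub>R r \<bullet> x" for x
  proof -
    have "x - (f x / f r) *\<^sub>R r \<in> S" using fr by (simp add: S_def f.diff f.scaleR)
    then have "r \<bullet> (x - (f x / f r) *\<^sub>R r) = 0" using p(2) by (simp add: r_def)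
    then have "r \<bullet> x = f x / f r * (r \<bullet> r)" by (simp add: inner_diff_right)
    then show ?thesis using fr r0 by simp
  qed
  then show ?thesis by blast
qed

lemma closure_subspace:
  fixes S :: "'a::real_normed_vector set"
  assumes S: "subspace S"
  shows "subspace (closure S)"
proof (rule subspaceI)
  show "0 \<in> closure S" using S closure_subset subspace_0 by blast
  show "x + y \<in> closure S" if xy: "x \<in> closure S" "y \<in> closure S" for x y
  proof -
    obtain a b where "\<And>n. a n \<in> S" "a \<longlonglongrightarrow> x" "\<And>n. b n \<in> S" "b \<longlonglongrightarrow> y"
      using xy unfolding closure_sequential by metis
    then show ?thesis unfolding closure_sequential
      by (intro exI[of _ "\<lambda>n. a n + b n"]) (auto intro!: tendsto_intros subspace_add[OF S])
  qed
  show "c *\<^sub>R x \<in> closure S" if x: "x \<in> closure S" for c x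
  proof -
    obtain a where "\<And>n. a n \<in> S" "a \<longlonglongrightarrow> x" using x unfolding closure_sequential by metis
    then show ?thesis unfolding closure_sequential
      by (intro exI[of _ "\<lambda>n. c *\<^sub>R a n"]) (auto intro!: tendsto_intros subspace_scale[OF S])
  qed
qed

text \<open>A vector orthogonal to the range of a symmetric operator lies in its kernel.\<close>
lemma closure_range_symmetric_injective:
  fixes T :: "'a::{real_inner,banach} \<Rightarrow> 'a"
  assumes T: "bounded_linear T" and sym: "\<And>x y. T x \<bullet> y = x \<bullet> T y"
    and inj: "\<And>x. T x = 0 \<Longrightarrow> x = 0"
  shows "closure (range T) = UNIV"
proof -
  interpret T: bounded_linear T by fact
  have "subspace (range T)" using linear_subspace_image[OF T.linear_axioms subspace_UNIV] .
  then have sub: "subspace (closure (range T))" by (rule closure_subspace)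
  have "u \<in> closure (range T)" for u
  proof -
    obtain p where p: "p \<in> closure (range T)" "\<forall>s\<in>closure (range T). (u - p) \<bullet> s = 0"
      using closed_subspace_projection[OF sub closed_closure] by blast
    have "T (u - p) \<bullet> T (u - p) = 0"
      using p(2) closure_subset[of "range T"] by (metis rangeI subsetD sym)
    then have "u - p = 0" using inj[of "u - p"] by simp
    then show ?thesis using p(1) by simp
  qed
  then show ?thesis by blast
qed

text \<open>A continuous function is uniformly continuous near a compact set, even towards points outside it;
  the radius is the Lebesgue number of a cover.\<close>
lemma uniform_limit_compose_continuous:
  fixes q :: "'b::metric_space \<Rightarrow> 'c::metric_space"
  assumes q: "continuous_on UNIV q" and u: "compact (u ` S)" and lim: "uniform_limit S U u F"
  shows "uniform_limit S (\<lambda>n x. q (U n x)) (\<lambda>x. q (u x)) F"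
proof (rule uniform_limitI)
  fix e :: real assume e: "e > 0"
  define B where "B x = {y. dist (q y) (q x) < e / 2}" for x
  have op: "open (B x)" for x
    unfolding B_def by (intro open_Collect_less continuous_intros q)
  have "x \<in> B x" for x using e by (simp add: B_def)
  then have "u ` S \<subseteq> \<Union> (range B)" by blast
  from Heine_Borel_lemma[OF u this] op obtain \<delta> where
    \<delta>: "\<delta> > 0" "\<And>x. x \<in> u ` S \<Longrightarrow> \<exists>G\<in>range B. ball x \<delta> \<subseteq> G" by blast
  have *: "dist (q y) (q (u x)) < e" if x: "x \<in> S" and y: "dist y (u x) < \<delta>" for x y
  proof -
    obtain z where "ball (u x) \<delta> \<subseteq> B z" using \<delta>(2) x by blast
    then have "y \<in> B z" "u x \<in> B z" using y \<delta>(1) by (auto simp: dist_commute)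
    then show ?thesis unfolding B_def using dist_triangle_half_r[of "q z" "q y" e "q (u x)"]
      by (auto simp: dist_commute)
  qed
  show "\<forall>\<^sub>F n in F. \<forall>x\<in>S. dist (q (U n x)) (q (u x)) < e"
    using uniform_limitD[OF lim \<delta>(1)] by eventually_elim (use * in blast)
qed

lemma vector_derivative_of_uniform_limit:
  fixes f :: "nat \<Rightarrow> real \<Rightarrow> 'a::banach"
  assumes der: "\<And>n t. (f n has_vector_derivative g n t) (at t)"
    and lim: "\<And>t. (\<lambda>n. f n t) \<longlonglongrightarrow> f' t"
    and ul: "\<And>r. uniform_limit {-r..r} g g' sequentially"
  shows "(f' has_vector_derivative g' t) (at t)"
proof -
  define r where "r = \<bar>t\<bar> + 1"
  define S where "S = {-r..r}"
  have t: "-r < t" "t < r" by (auto simp: r_def)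
  have "\<exists>h. \<forall>x\<in>S. (\<lambda>n. f n x) \<longlonglongrightarrow> h x \<and> (h has_derivative (\<lambda>y. y *\<^sub>R g' x)) (at x within S)"
  proof (rule has_derivative_sequence[where f' = "\<lambda>n x y. y *\<^sub>R g n x"])
    show "(f n has_derivative (\<lambda>y. y *\<^sub>R g n x)) (at x within S)" for n x
      using der[of n x] has_derivative_at_withinI has_vector_derivative_def by blast
    show "\<forall>\<^sub>F n in sequentially. \<forall>x\<in>S. \<forall>h. norm (h *\<^sub>R g n x - h *\<^sub>R g' x) \<le> e * norm h" if "e > 0" for e
      using uniform_limitD[OF ul[of r] that]
    proof eventually_elim
      case (elim n)
      then show ?case
        by (auto simp: S_def dist_norm simp flip: scaleR_diff_right)
          (metis less_imp_le mult.commute mult_right_mono abs_ge_zero atLeastAtMost_iff)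
    qed
    show "t \<in> S" "convex S" using t by (auto simp: S_def)
  qed (rule lim)
  then obtain h where h: "\<And>x. x \<in> S \<Longrightarrow> (\<lambda>n. f n x) \<longlonglongrightarrow> h x"
    "\<And>x. x \<in> S \<Longrightarrow> (h has_derivative (\<lambda>y. y *\<^sub>R g' x)) (at x within S)" by blast
  have "h x = f' x" if "x \<in> S" for x using h(1)[OF that] lim LIMSEQ_unique by blast
  then have "(f' has_derivative (\<lambda>y. y *\<^sub>R g' t)) (at t within S)"
    using h(2)[of t] t by (intro has_derivative_transform[of t S f' h]) (auto simp: S_def)
  then show ?thesis using t by (simp add: S_def at_within_Icc_at has_vector_derivative_def)
qed

text \<open>The form in which differential identities pass to limits below. The approximations satisfy the
  identity up to errors \<open>\<rho>\<close>, on which the right-hand side \<open>g\<close> depends continuously.\<close>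
lemma equation_of_uniform_limit:
  fixes f :: "'a::banach \<Rightarrow> 'b::banach" and g :: "'a \<times> 'a \<Rightarrow> 'b" and U \<rho> :: "nat \<Rightarrow> real \<Rightarrow> 'a"
  assumes f: "continuous_on UNIV f" and g: "continuous_on UNIV g"
    and Uc: "\<And>n. continuous_on UNIV (U n)"
    and der: "\<And>n t. ((\<lambda>t. f (U n t)) has_vector_derivative g (U n t, \<rho> n t)) (at t)"
    and U: "\<And>r. uniform_limit {-r..r} U u sequentially"
    and \<rho>: "\<And>r. uniform_limit {-r..r} \<rho> (\<lambda>_. 0) sequentially"
  shows "((\<lambda>t. f (u t)) has_vector_derivative g (u t, 0)) (at t)"
proof (rule vector_derivative_of_uniform_limit[OF der])
  have uc: "continuous_on {-r..r} u" for r
    by (rule uniform_limit_theorem[OF always_eventually U[of r]])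
      (auto intro: continuous_on_subset[OF Uc])
  show "(\<lambda>n. f (U n t)) \<longlonglongrightarrow> f (u t)" for t
  proof -
    have "(\<lambda>n. U n t) \<longlonglongrightarrow> u t" by (rule tendsto_uniform_limitI[OF U[of "\<bar>t\<bar>"]]) auto
    then show ?thesis by (rule continuous_on_tendsto_compose[OF f]) auto
  qed
  show "uniform_limit {-r..r} (\<lambda>n t. g (U n t, \<rho> n t)) (\<lambda>t. g (u t, 0)) sequentially" for r
  proof (rule uniform_limit_compose_continuous[OF g, where u = "\<lambda>t. (u t, 0)" and U = "\<lambda>n t. (U n t, \<rho> n t)"])
    show "compact ((\<lambda>t. (u t, 0)) ` {-r..r})"
      by (intro compact_continuous_image continuous_intros uc) auto
    show "uniform_limit {-r..r} (\<lambda>n t. (U n t, \<rho> n t)) (\<lambda>t. (u t, 0)) sequentially"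
      using U[of r] \<rho>[of r] unfolding uniform_limit_iff
    proof (intro allI impI)
      fix e :: real
      assume *: "\<forall>e>0. \<forall>\<^sub>F n in sequentially. \<forall>x\<in>{-r..r}. dist (U n x) (u x) < e"
        "\<forall>e>0. \<forall>\<^sub>F n in sequentially. \<forall>x\<in>{-r..r}. dist (\<rho> n x) 0 < e" and e: "e > 0"
      have "\<forall>\<^sub>F n in sequentially. \<forall>x\<in>{-r..r}. dist (U n x) (u x) < e / 2"
        "\<forall>\<^sub>F n in sequentially. \<forall>x\<in>{-r..r}. dist (\<rho> n x) 0 < e / 2"
        using *(1)[rule_format, of "e / 2"] *(2)[rule_format, of "e / 2"] e by simp_all
      then show "\<forall>\<^sub>F n in sequentially. \<forall>x\<in>{-r..r}. dist (U n x, \<rho> n x) (u x, 0) < e"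
      proof eventually_elim
        case (elim n)
        have "dist (U n x, \<rho> n x) (u x, 0) \<le> dist (U n x) (u x) + dist (\<rho> n x) 0" for x
          unfolding dist_Pair_Pair by (rule sqrt_sum_squares_le_sum) auto
        note le = this
        show ?case
        proof
          fix x assume "x \<in> {-r..r}"
          then have "dist (U n x) (u x) < e / 2" "dist (\<rho> n x) 0 < e / 2" using elim by blast+
          then show "dist (U n x, \<rho> n x) (u x, 0) < e" using le[of x] by linarith
        qed
      qed
    qed
  qed
qed

section \<open>Skew evolution equations with a Lipschitz perturbation\<close>

lemma has_real_derivative_inner_self:
  fixes f :: "real \<Rightarrow> 'a::real_inner"
  assumes "(f has_vector_derivative f') (at t)"
  shows "((\<lambda>t. f t \<bullet> f t) has_real_derivative 2 * (f t \<bullet> f')) (at t)"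
  using bounded_bilinear.has_vector_derivative[OF bounded_bilinear_inner assms assms]
  by (simp add: has_real_derivative_iff_has_vector_derivative inner_commute)

lemma has_vector_derivative_quotient:
  fixes f :: "real \<Rightarrow> 'a::real_normed_vector"
  assumes "(f has_vector_derivative f') (at x)"
  shows "((\<lambda>h. (1 / h) *\<^sub>R (f (x + h) - f x)) \<longlongrightarrow> f') (at 0)"
proof -
  have "((\<lambda>h. norm (f (x + h) - f x - h *\<^sub>R f') / norm h) \<longlongrightarrow> 0) (at 0)"
    using assms by (simp add: has_vector_derivative_def has_derivative_at)
  then have "((\<lambda>h. norm ((1 / h) *\<^sub>R (f (x + h) - f x) - f')) \<longlongrightarrow> 0) (at 0)"
  proof (rule Lim_transform_eventually)
    show "\<forall>\<^sub>F h in at 0. norm (f (x + h) - f x - h *\<^sub>R f') / norm h =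
        norm ((1 / h) *\<^sub>R (f (x + h) - f x) - f')"
    proof (rule eventually_at_filter[THEN iffD2], rule always_eventually, intro allI impI)
      fix h :: real assume "h \<noteq> 0"
      then have "(1 / h) *\<^sub>R (f (x + h) - f x) - f' = (1 / h) *\<^sub>R (f (x + h) - f x - h *\<^sub>R f')"
        by (simp add: scaleR_diff_right)
      then show "norm (f (x + h) - f x - h *\<^sub>R f') / norm h =
          norm ((1 / h) *\<^sub>R (f (x + h) - f x) - f')" by simp
    qed
  qed
  then show ?thesis by (simp add: LIM_zero_iff tendsto_norm_zero_iff)
qed

text \<open>The equation \<open>u' = G T\<^sup>-\<^sup>1 u + F(u)\<close>, for \<open>T\<close> with an unbounded inverse, in the form
  \<open>(T u)' = G u + T F(u)\<close>. The functional \<open>\<Psi>\<close>, with gradient \<open>T m\<close>, is the part of an energy that is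
  added to \<open>\<parallel>u\<parallel>\<^sup>2 / 2\<close>; the balance of \<open>\<parallel>u\<parallel>\<^sup>2 / 2 + \<Psi>(u)\<close> is proved together with existence, because it is
  the limit of the balances for differentiable approximations.\<close>
locale skew_flow =
  fixes T G F m :: "'a::{real_inner,banach} \<Rightarrow> 'a" and \<Psi> :: "'a \<Rightarrow> real" and L :: real
  assumes T: "bounded_linear T" and T_sym: "T x \<bullet> y = x \<bullet> T y"
    and T_pos: "x \<noteq> 0 \<Longrightarrow> 0 < T x \<bullet> x"
    and G: "bounded_linear G" and G_skew: "G x \<bullet> y = - (x \<bullet> G y)"
    and G_norm: "norm (G x) = norm x" and G_T: "G (T x) = T (G x)"
    and F_lip: "norm (F x - F y) \<le> L * norm (x - y)" and L: "L > 0"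
    and m_cont: "continuous_on UNIV m"
    and \<Psi>: "(\<Psi> has_derivative (\<lambda>h. T (m x) \<bullet> h)) (at x)"
begin

sublocale T: bounded_linear T by (rule T)
sublocale G: bounded_linear G by (rule G)

lemma T_nonneg: "0 \<le> T x \<bullet> x"
  using T_pos[of x] by (cases "x = 0") auto

lemma G_self: "G x \<bullet> x = 0"
  using G_skew[of x x] by (simp add: inner_commute)

text \<open>The operator \<open>G T\<close> is again skew, as \<open>G\<close> and \<open>T\<close> commute.\<close>
lemma T_G_self: "T x \<bullet> G x = 0"
proof -
  have "G x \<bullet> T x = - (T x \<bullet> G x)" using G_skew[of x "T x"] by (simp add: G_T T_sym)
  then show ?thesis by (simp add: inner_commute)
qed

lemma F_continuous: "continuous_on UNIV F"
  by (rule lipschitz_on_continuous_on[OF lipschitz_onI[of UNIV F L]])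
    (use L F_lip in \<open>auto simp: dist_norm\<close>)

text \<open>The bounded operator \<open>(T + e)\<^sup>-\<^sup>1\<close> that replaces \<open>T\<^sup>-\<^sup>1\<close>.\<close>
definition R :: "real \<Rightarrow> 'a \<Rightarrow> 'a" where
  "R e f = (THE w. T w + e *\<^sub>R w = f)"

context
  fixes e :: real
  assumes e: "e > 0"
begin

lemma R_ex1: "\<exists>!w. T w + e *\<^sub>R w = f"
proof (rule coercive_bijective[OF _ _ e])
  show "bounded_linear (\<lambda>w. T w + e *\<^sub>R w)"
    by (intro bounded_linear_add T bounded_linear_scaleR_right)
  show "e * (norm x)\<^sup>2 \<le> (T x + e *\<^sub>R x) \<bullet> x" for x
    using T_nonneg[of x] by (simp add: inner_add_left power2_norm_eq_inner)
qed

lemma R_eq: "T (R e f) + e *\<^sub>R R e f = f"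
  unfolding R_def by (rule theI'[OF R_ex1])

lemma R_unique: "T w + e *\<^sub>R w = f \<Longrightarrow> R e f = w"
  using R_ex1[of f] R_eq by blast

lemma R_diff: "R e (f - g) = R e f - R e g"
proof (rule R_unique)
  have "T (R e f - R e g) + e *\<^sub>R (R e f - R e g)
      = (T (R e f) + e *\<^sub>R R e f) - (T (R e g) + e *\<^sub>R R e g)"
    by (simp add: T.diff scaleR_diff_right)
  then show "T (R e f - R e g) + e *\<^sub>R (R e f - R e g) = f - g" by (simp only: R_eq)
qed

lemma R_norm: "norm (R e f) \<le> norm f / e"
proof -
  define w where "w = R e f"
  have "e * (norm w)\<^sup>2 \<le> (T w + e *\<^sub>R w) \<bullet> w"
    using T_nonneg[of w] by (simp add: inner_add_left power2_norm_eq_inner)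
  also have "\<dots> \<le> norm f * norm w"
    using R_eq[of f] norm_cauchy_schwarz[of f w] by (simp add: w_def)
  finally have "norm w * (e * norm w) \<le> norm w * norm f"
    by (simp add: power2_eq_square mult_ac)
  then have "e * norm w \<le> norm f"
    by (cases "w = 0") auto
  then show ?thesis using e by (simp add: w_def field_simps)
qed

text \<open>On the range of \<open>T\<close> the regularized inverses are bounded uniformly in \<open>e\<close>: the vector is \<open>T z\<close> with
  \<open>T z + e z = y\<close>, and the cross term in \<open>\<parallel>T z + e z\<parallel>\<^sup>2\<close> is nonnegative.\<close>
lemma R_T_norm: "norm (R e (T y)) \<le> norm y"
proof -
  define z where "z = R e y"
  have y: "T z + e *\<^sub>R z = y" unfolding z_def by (rule R_eq)
  have "T (T z) + e *\<^sub>R T z = T (T z + e *\<^sub>R z)" by (simp add: T.add T.scaleR)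
  then have "R e (T y) = T z" unfolding y by (rule R_unique)
  moreover have "(norm (T z))\<^sup>2 \<le> (norm y)\<^sup>2"
  proof -
    have "(norm y)\<^sup>2 = (norm (T z))\<^sup>2 + 2 * e * (T z \<bullet> z) + e\<^sup>2 * (norm z)\<^sup>2"
      unfolding y[symmetric] power2_norm_eq_inner
      by (simp add: algebra_simps inner_commute power2_eq_square)
    moreover have "0 \<le> 2 * e * (T z \<bullet> z)" using e T_nonneg[of z] by simp
    ultimately show ?thesis by simp
  qed
  ultimately show ?thesis by (metis norm_ge_zero power2_le_imp_le)
qed

lemma G_R_self: "x \<bullet> G (R e x) = 0"
proof -
  define w where "w = R e x"
  have "x \<bullet> G w = (T w + e *\<^sub>R w) \<bullet> G w"
    using R_eq[of x] by (simp add: w_def)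
  also have "\<dots> = T w \<bullet> G w + e * (G w \<bullet> w)"
    by (simp only: inner_add_left inner_scaleR_left inner_commute[of w "G w"])
  finally have "x \<bullet> G w = T w \<bullet> G w + e * (G w \<bullet> w)" .
  then show ?thesis by (simp add: T_G_self G_self w_def)
qed

end

definition approx :: "real \<Rightarrow> (real \<Rightarrow> 'a) \<Rightarrow> bool" where
  "approx e U \<longleftrightarrow> (\<forall>t. (U has_vector_derivative G (R e (U t)) + F (U t)) (at t))"

lemma approxD: "approx e U \<Longrightarrow> (U has_vector_derivative G (R e (U t)) + F (U t)) (at t)"
  by (simp add: approx_def)

lemma approx_continuous: "approx e U \<Longrightarrow> continuous_on UNIV U"
  using approxD by (meson continuous_at_imp_continuous_on has_vector_derivative_continuous)

lemma approx_exists: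
  assumes e: "e > 0"
  shows "\<exists>U. approx e U \<and> U 0 = u0"
proof -
  have "norm ((G (R e x) + F x) - (G (R e y) + F y)) \<le> (1 / e + L) * norm (x - y)" for x y
  proof -
    have "(G (R e x) + F x) - (G (R e y) + F y) = G (R e (x - y)) + (F x - F y)"
      by (simp add: R_diff[OF e] G.diff)
    then have "norm ((G (R e x) + F x) - (G (R e y) + F y)) \<le> norm (R e (x - y)) + norm (F x - F y)"
      by (metis G_norm norm_triangle_ineq)
    also have "\<dots> \<le> norm (x - y) / e + L * norm (x - y)"
      by (intro add_mono R_norm e F_lip)
    finally show ?thesis by (simp add: algebra_simps)
  qed
  moreover have "1 / e + L > 0" using e L by (simp add: add_pos_pos)
  ultimately show ?thesis
    using global_Lipschitz_ODE[of "\<lambda>x. G (R e x) + F x" "1 / e + L" u0] by (auto simp: approx_def)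
qed

text \<open>The linear part is skew and drops out of the derivative of the squared distance.\<close>
lemma approx_dist:
  assumes e: "e > 0" and U: "approx e U" and V: "approx e V"
  shows "norm (U t - V t) \<le> exp (L * \<bar>t\<bar>) * norm (U 0 - V 0)"
proof -
  define \<phi> where "\<phi> s = (U s - V s) \<bullet> (U s - V s)" for s
  define \<phi>' where "\<phi>' s = 2 * ((U s - V s) \<bullet> (F (U s) - F (V s)))" for s
  have "(\<phi> has_real_derivative \<phi>' s) (at s)" for s
  proof -
    have "((\<lambda>s. U s - V s) has_vector_derivative G (R e (U s - V s)) + (F (U s) - F (V s))) (at s)"
      by (rule derivative_eq_intros approxD[OF U] approxD[OF V] refl)+
        (simp add: R_diff[OF e] G.diff)
    from has_real_derivative_inner_self[OF this] show ?thesis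
      using G_R_self[OF e, of "U s - V s"] by (simp add: \<phi>_def[abs_def] \<phi>'_def inner_add_right)
  qed
  moreover have "\<bar>\<phi>' s\<bar> \<le> 2 * L * \<phi> s + 0" for s
  proof -
    have "\<bar>\<phi>' s\<bar> \<le> 2 * (norm (U s - V s) * norm (F (U s) - F (V s)))"
      unfolding \<phi>'_def by (simp add: abs_mult Cauchy_Schwarz_ineq2)
    also have "\<dots> \<le> 2 * (norm (U s - V s) * (L * norm (U s - V s)))"
      by (intro mult_left_mono F_lip) auto
    finally show ?thesis by (simp add: \<phi>_def mult_ac power2_eq_square flip: power2_norm_eq_inner)
  qed
  ultimately have "\<phi> t \<le> \<phi> 0 * exp (2 * L * \<bar>t\<bar>)"
    using gronwall[of "\<bar>t\<bar> + 1" \<phi> \<phi>' "2 * L" 0 t] L by auto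
  also have "exp (2 * L * \<bar>t\<bar>) = (exp (L * \<bar>t\<bar>))\<^sup>2"
    by (simp add: mult.assoc flip: exp_double)
  finally have "(norm (U t - V t))\<^sup>2 \<le> (exp (L * \<bar>t\<bar>) * norm (U 0 - V 0))\<^sup>2"
    by (simp add: \<phi>_def power_mult_distrib power2_norm_eq_inner mult.commute)
  then show ?thesis by (rule power2_le_imp_le) simp
qed

text \<open>A time translate of a solution is a solution, so the speed at time \<open>t\<close> is at most
  \<open>exp (L \<bar>t\<bar>)\<close> times the initial speed, which is bounded uniformly in \<open>e\<close> for data in the range of \<open>T\<close>.\<close>
lemma approx_speed:
  assumes e: "e > 0" and U: "approx e U" and U0: "U 0 = T y"
  shows "norm (G (R e (U t)) + F (U t)) \<le> (norm y + norm (F (T y))) * exp (L * \<bar>t\<bar>)"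
proof -
  have "norm (G (R e (U t)) + F (U t)) \<le> exp (L * \<bar>t\<bar>) * norm (G (R e (U 0)) + F (U 0))"
  proof (rule tendsto_le)
    show "((\<lambda>h. norm ((1 / h) *\<^sub>R (U (t + h) - U t))) \<longlongrightarrow> norm (G (R e (U t)) + F (U t))) (at 0)"
      by (intro tendsto_norm has_vector_derivative_quotient approxD U)
    show "((\<lambda>h. exp (L * \<bar>t\<bar>) * norm ((1 / h) *\<^sub>R (U (0 + h) - U 0)))
        \<longlongrightarrow> exp (L * \<bar>t\<bar>) * norm (G (R e (U 0)) + F (U 0))) (at 0)"
      by (intro tendsto_mult_left tendsto_norm has_vector_derivative_quotient approxD U)
    have "norm ((1 / h) *\<^sub>R (U (t + h) - U t)) \<le> exp (L * \<bar>t\<bar>) * norm ((1 / h) *\<^sub>R (U (0 + h) - U 0))" for h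
    proof -
      have "approx e (\<lambda>s. U (s + h))"
        unfolding approx_def
      proof
        fix s
        have "((\<lambda>s. s + h) has_vector_derivative 1) (at s)" by (auto intro!: derivative_eq_intros)
        from vector_diff_chain_at[OF this approxD[OF U]]
        show "((\<lambda>s. U (s + h)) has_vector_derivative G (R e (U (s + h))) + F (U (s + h))) (at s)"
          by (simp add: o_def)
      qed
      from approx_dist[OF e this U, of t]
      have "norm (U (t + h) - U t) / \<bar>h\<bar> \<le> exp (L * \<bar>t\<bar>) * norm (U (0 + h) - U 0) / \<bar>h\<bar>"
        by (intro divide_right_mono) auto
      then show ?thesis by simp
    qed
    then show "\<forall>\<^sub>F h in at 0. norm ((1 / h) *\<^sub>R (U (t + h) - U t))
        \<le> exp (L * \<bar>t\<bar>) * norm ((1 / h) *\<^sub>R (U (0 + h) - U 0))"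
      by (intro always_eventually allI)
  qed simp
  also have "norm (G (R e (U 0)) + F (U 0)) \<le> norm y + norm (F (T y))"
    using norm_triangle_ineq[of "G (R e (T y))" "F (T y)"] R_T_norm[OF e, of y]
    by (simp add: U0 G_norm)
  finally show ?thesis by (simp add: mult.commute)
qed

text \<open>A bound for \<open>\<parallel>(T + e)\<^sup>-\<^sup>1 U(t)\<parallel>\<close> on \<open>[-r, r]\<close> that is uniform in \<open>e\<close>; it comes from the speed bound, used
  once for \<open>U'\<close> and once for the variation of \<open>F(U)\<close>.\<close>
definition yosida_bound :: "'a \<Rightarrow> real \<Rightarrow> real" where
  "yosida_bound y r = 2 * (norm y + norm (F (T y))) * exp (L * r) + norm (F (T y))"

lemma approx_R_bound:
  assumes e: "e > 0" and U: "approx e U" and U0: "U 0 = T y" and t: "\<bar>t\<bar> \<le> r"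
  shows "norm (R e (U t)) \<le> yosida_bound y r"
proof -
  define k where "k = norm y + norm (F (T y))"
  have k: "k \<ge> 0" by (simp add: k_def)
  have E: "k * exp (L * \<bar>t\<bar>) \<le> k * exp (L * r)" using t L k by (intro mult_left_mono) auto
  have "norm (U t - U 0) \<le> k / L * exp (L * \<bar>t\<bar>) - k / L"
    by (rule norm_growth[OF approxD[OF U] approx_speed[OF e U U0, folded k_def] L])
  then have "L * norm (U t - U 0) \<le> L * (k / L * exp (L * \<bar>t\<bar>) - k / L)"
    using L by (intro mult_left_mono) auto
  then have 1: "norm (F (U t) - F (T y)) \<le> k * exp (L * \<bar>t\<bar>) - k"
    using F_lip[of "U t" "T y"] L by (simp add: U0 algebra_simps)
  have "norm (R e (U t)) = norm ((G (R e (U t)) + F (U t)) - (F (U t) - F (T y)) - F (T y))"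
    by (simp add: G_norm)
  also have "\<dots> \<le> norm (G (R e (U t)) + F (U t)) + norm (F (U t) - F (T y)) + norm (F (T y))"
    by norm
  also have "\<dots> \<le> k * exp (L * r) + k * exp (L * r) + norm (F (T y))"
    using approx_speed[OF e U U0, of t] 1 E k unfolding k_def[symmetric] by linarith
  finally show ?thesis by (simp add: yosida_bound_def k_def algebra_simps)
qed

text \<open>With \<open>w\<close>, \<open>z\<close> the regularized inverses applied to the two solutions, \<open>U - V\<close> equals
  \<open>T (w - z) + (e w - d z)\<close>, and the first term is orthogonal to \<open>G (w - z)\<close>. What remains is of order
  \<open>e + d\<close> because \<open>w\<close> and \<open>z\<close> are bounded.\<close>
lemma approx_Cauchy:
  assumes e: "e > 0" and d: "d > 0" and U: "approx e U" "U 0 = T y" and V: "approx d V" "V 0 = T y"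
    and t: "\<bar>t\<bar> < r"
  shows "(norm (U t - V t))\<^sup>2 \<le> 2 * (yosida_bound y r)\<^sup>2 / L * exp (2 * L * r) * (e + d)"
proof -
  define K where "K = yosida_bound y r"
  have K: "K \<ge> 0" by (simp add: K_def yosida_bound_def)
  define \<phi> where "\<phi> s = (U s - V s) \<bullet> (U s - V s)" for s
  define \<phi>' where "\<phi>' s = 2 * ((U s - V s) \<bullet> ((G (R e (U s)) + F (U s)) - (G (R d (V s)) + F (V s))))" for s
  have "(\<phi> has_real_derivative \<phi>' s) (at s)" for s
    unfolding \<phi>_def[abs_def] \<phi>'_def
    by (intro has_real_derivative_inner_self derivative_intros approxD U V)
  moreover have "\<bar>\<phi>' s\<bar> \<le> 2 * L * \<phi> s + 4 * K\<^sup>2 * (e + d)" if s: "\<bar>s\<bar> < r" for s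
  proof -
    define w z where "w = R e (U s)" and "z = R d (V s)"
    have w: "norm w \<le> K" and z: "norm z \<le> K"
      using approx_R_bound[OF e U, of s r] approx_R_bound[OF d V, of s r] s by (auto simp: w_def z_def K_def)
    have UV: "U s - V s = T (w - z) + (e *\<^sub>R w - d *\<^sub>R z)"
      using R_eq[OF e, of "U s"] R_eq[OF d, of "V s"] by (simp add: w_def z_def T.diff algebra_simps)
    have "(U s - V s) \<bullet> G (w - z) = (e *\<^sub>R w - d *\<^sub>R z) \<bullet> G (w - z)"
      unfolding UV by (simp add: inner_add_left T_G_self)
    also have "\<bar>\<dots>\<bar> \<le> norm (e *\<^sub>R w - d *\<^sub>R z) * norm (w - z)"
      using Cauchy_Schwarz_ineq2[of "e *\<^sub>R w - d *\<^sub>R z" "G (w - z)"] by (simp add: G_norm)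
    also have "\<dots> \<le> (e * K + d * K) * (K + K)"
    proof (intro mult_mono)
      show "norm (e *\<^sub>R w - d *\<^sub>R z) \<le> e * K + d * K"
      proof -
        have "e * norm w \<le> e * K" "d * norm z \<le> d * K" using w z e d by (auto intro!: mult_left_mono)
        moreover have "norm (e *\<^sub>R w - d *\<^sub>R z) \<le> e * norm w + d * norm z"
          using norm_triangle_ineq4[of "e *\<^sub>R w" "d *\<^sub>R z"] e d by simp
        ultimately show ?thesis by linarith
      qed
      show "norm (w - z) \<le> K + K" using norm_triangle_ineq4[of w z] w z by linarith
    qed (use K e d in auto)
    finally have 1: "\<bar>(U s - V s) \<bullet> G (w - z)\<bar> \<le> 2 * K\<^sup>2 * (e + d)"
      by (simp add: algebra_simps power2_eq_square)
    have "\<bar>(U s - V s) \<bullet> (F (U s) - F (V s))\<bar> \<le> norm (U s - V s) * norm (F (U s) - F (V s))"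
      by (rule Cauchy_Schwarz_ineq2)
    also have "\<dots> \<le> norm (U s - V s) * (L * norm (U s - V s))"
      by (intro mult_left_mono F_lip) auto
    also have "\<dots> = L * \<phi> s"
      by (simp add: \<phi>_def mult_ac power2_eq_square flip: power2_norm_eq_inner)
    finally have 2: "\<bar>(U s - V s) \<bullet> (F (U s) - F (V s))\<bar> \<le> L * \<phi> s" .
    have "\<phi>' s = 2 * ((U s - V s) \<bullet> G (w - z)) + 2 * ((U s - V s) \<bullet> (F (U s) - F (V s)))"
      by (simp add: \<phi>'_def w_def z_def G.diff inner_add_right inner_diff_right algebra_simps)
    then show ?thesis using 1 2 by linarith
  qed
  ultimately have "\<phi> t \<le> (\<phi> 0 + 4 * K\<^sup>2 * (e + d) / (2 * L)) * exp (2 * L * \<bar>t\<bar>) - 4 * K\<^sup>2 * (e + d) / (2 * L)"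
    using t L by (intro gronwall[of r \<phi> \<phi>']) auto
  also have "\<phi> 0 = 0" by (simp add: \<phi>_def U V)
  also have "(0 + 4 * K\<^sup>2 * (e + d) / (2 * L)) * exp (2 * L * \<bar>t\<bar>) - 4 * K\<^sup>2 * (e + d) / (2 * L)
      \<le> (4 * K\<^sup>2 * (e + d) / (2 * L)) * exp (2 * L * \<bar>t\<bar>)"
    using e d L by simp
  also have "\<dots> \<le> (4 * K\<^sup>2 * (e + d) / (2 * L)) * exp (2 * L * r)"
    using t L e d by (intro mult_left_mono) auto
  finally show ?thesis by (simp add: \<phi>_def K_def power2_norm_eq_inner mult_ac)
qed

definition solves :: "(real \<Rightarrow> 'a) \<Rightarrow> bool" where
  "solves u \<longleftrightarrow> continuous_on UNIV u \<and>
     (\<forall>t. ((\<lambda>t. T (u t)) has_vector_derivative G (u t) + T (F (u t))) (at t)) \<and>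
     (\<forall>t. ((\<lambda>t. (u t \<bullet> u t) / 2 + \<Psi> (u t)) has_real_derivative
        (u t + T (m (u t))) \<bullet> F (u t) + m (u t) \<bullet> G (u t)) (at t))"

text \<open>Used twice: for \<open>e \<rightarrow> 0\<close>, with the error \<open>\<rho> = - e G (T + e)\<^sup>-\<^sup>1 U\<close>, and for the approximation of the
  initial value, with \<open>\<rho> = 0\<close>.\<close>
lemma solves_limit:
  assumes Uc: "\<And>n. continuous_on UNIV (U n)"
    and T': "\<And>n t. ((\<lambda>t. T (U n t)) has_vector_derivative G (U n t) + T (F (U n t)) + \<rho> n t) (at t)"
    and E': "\<And>n t. ((\<lambda>t. (U n t \<bullet> U n t) / 2 + \<Psi> (U n t)) has_real_derivative
        (U n t + T (m (U n t))) \<bullet> F (U n t) + m (U n t) \<bullet> G (U n t) + m (U n t) \<bullet> \<rho> n t) (at t)"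
    and U: "\<And>r. uniform_limit {-r..r} U u sequentially"
    and \<rho>: "\<And>r. uniform_limit {-r..r} \<rho> (\<lambda>_. 0) sequentially"
  shows "solves u"
proof -
  note [continuous_intros] = continuous_on_compose2[OF F_continuous] continuous_on_compose2[OF m_cont]
    continuous_on_compose2[OF linear_continuous_on[OF T]] continuous_on_compose2[OF linear_continuous_on[OF G]]
  have \<Psi>c: "continuous_on UNIV \<Psi>"
    using \<Psi> by (meson continuous_at_imp_continuous_on has_derivative_continuous)
  have "continuous_on UNIV u"
  proof -
    have "continuous_on {-r..r} u" for r
      by (rule uniform_limit_theorem[OF always_eventually U[of r]]) (auto intro: continuous_on_subset[OF Uc])
    then have "continuous_on {-(\<bar>t\<bar> + 1)<..<\<bar>t\<bar> + 1} u" for t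
      by (rule continuous_on_subset[where s = "{- (\<bar>t\<bar> + 1)..\<bar>t\<bar> + 1}"]) auto
    then have "continuous (at t) u" for t
    proof -
      have "t \<in> {-(\<bar>t\<bar> + 1)<..<\<bar>t\<bar> + 1}" by auto
      then show ?thesis
        using continuous_on_eq_continuous_at[OF open_greaterThanLessThan, of "-(\<bar>t\<bar> + 1)" "\<bar>t\<bar> + 1" u]
          \<open>\<And>t. continuous_on {-(\<bar>t\<bar> + 1)<..<\<bar>t\<bar> + 1} u\<close>[of t] by blast
    qed
    then show ?thesis by (simp add: continuous_at_imp_continuous_on)
  qed
  moreover have "((\<lambda>t. T (u t)) has_vector_derivative (\<lambda>(x, r). G x + T (F x) + r) (u t, 0)) (at t)" for t
    by (rule equation_of_uniform_limit[OF _ _ Uc _ U \<rho>])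
      (auto simp: split_def intro!: continuous_intros T')
  moreover have "((\<lambda>t. (\<lambda>x. (x \<bullet> x) / 2 + \<Psi> x) (u t)) has_vector_derivative
      (\<lambda>(x, r). (x + T (m x)) \<bullet> F x + m x \<bullet> G x + m x \<bullet> r) (u t, 0)) (at t)" for t
    by (rule equation_of_uniform_limit[OF _ _ Uc _ U \<rho>])
      (auto simp: split_def intro!: continuous_intros \<Psi>c E'[unfolded has_real_derivative_iff_has_vector_derivative])
  ultimately show ?thesis
    by (simp add: solves_def has_real_derivative_iff_has_vector_derivative)
qed

definition limit_of_approx :: "'a \<Rightarrow> (real \<Rightarrow> 'a) \<Rightarrow> bool" where
  "limit_of_approx y u \<longleftrightarrow> (\<exists>U. (\<forall>n. approx (1 / real (Suc n)) (U n) \<and> U n 0 = T y) \<and>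
     (\<forall>r. uniform_limit {-r..r} U u sequentially))"

lemma limit_of_approx_exists: "\<exists>u. limit_of_approx y u"
proof -
  define e where "e n = 1 / real (Suc n)" for n
  have e: "e n > 0" for n by (simp add: e_def)
  have e_le: "e n \<le> 1 / real (Suc N)" if "n \<ge> N" for n N
    using that unfolding e_def by (intro divide_left_mono) auto
  have "\<forall>n. \<exists>U. approx (e n) U \<and> U 0 = T y" using approx_exists[OF e] by blast
  from choice[OF this] obtain U where U: "\<And>n. approx (e n) (U n)" "\<And>n. U n 0 = T y"
    by blast
  have conv: "uniformly_convergent_on {-r..r} U" for r
  proof (rule Cauchy_uniformly_convergent, rule uniformly_Cauchy_onI)
    fix \<epsilon> :: real assume \<epsilon>: "\<epsilon> > 0"
    define C where "C = 2 * (yosida_bound y (r + 1))\<^sup>2 / L * exp (2 * L * (r + 1))"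
    have C: "C \<ge> 0" using L by (simp add: C_def)
    obtain N where N: "inverse (real (Suc N)) < \<epsilon>\<^sup>2 / (2 * C + 1)"
      using reals_Archimedean[of "\<epsilon>\<^sup>2 / (2 * C + 1)"] \<epsilon> C by auto
    have "dist (U n x) (U k x) < \<epsilon>" if "x \<in> {-r..r}" "n \<ge> N" "k \<ge> N" for x n k
    proof -
      have "(norm (U n x - U k x))\<^sup>2 \<le> C * (e n + e k)"
        unfolding C_def using that by (intro approx_Cauchy e U) auto
      also have "\<dots> \<le> C * (2 * (1 / real (Suc N)))"
        using e_le[OF that(2)] e_le[OF that(3)] C by (intro mult_left_mono) auto
      also have "\<dots> \<le> (2 * C + 1) * inverse (real (Suc N))"
        by (simp add: inverse_eq_divide field_simps)
      also have "\<dots> < \<epsilon>\<^sup>2"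
        using N C by (simp add: field_simps)
      finally show ?thesis using \<epsilon> by (simp add: dist_norm power_less_imp_less_base)
    qed
    then show "\<exists>M. \<forall>x\<in>{-r..r}. \<forall>m\<ge>M. \<forall>n\<ge>M. dist (U m x) (U n x) < \<epsilon>" by blast
  qed
  define u where "u t = lim (\<lambda>n. U n t)" for t
  have "uniform_limit {-r..r} U u sequentially" for r
    using conv[of r] unfolding uniformly_convergent_uniform_limit_iff u_def .
  then show ?thesis using U unfolding limit_of_approx_def e_def by blast
qed

lemma uniform_limit_at_point:
  assumes "\<And>r. uniform_limit {-r..r} U (u :: real \<Rightarrow> 'a) sequentially"
  shows "(\<lambda>n. U n t) \<longlonglongrightarrow> u t"
  by (rule tendsto_uniform_limitI[OF assms[of "\<bar>t\<bar>"]]) auto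

lemma limit_of_approx_initial: "limit_of_approx y u \<Longrightarrow> u 0 = T y"
proof -
  assume "limit_of_approx y u"
  then obtain U where "\<And>n. U n 0 = T y" "(\<lambda>n. U n 0) \<longlonglongrightarrow> u 0"
    unfolding limit_of_approx_def using uniform_limit_at_point by meson
  then show ?thesis by (simp add: LIMSEQ_const_iff)
qed

lemma limit_of_approx_dist:
  assumes u: "limit_of_approx y u" and v: "limit_of_approx z v"
  shows "norm (u t - v t) \<le> exp (L * \<bar>t\<bar>) * norm (T y - T z)"
proof -
  obtain U where U: "\<And>n. approx (1 / real (Suc n)) (U n)" "\<And>n. U n 0 = T y" "(\<lambda>n. U n t) \<longlonglongrightarrow> u t"
    using u unfolding limit_of_approx_def using uniform_limit_at_point by meson
  obtain V where V: "\<And>n. approx (1 / real (Suc n)) (V n)" "\<And>n. V n 0 = T z" "(\<lambda>n. V n t) \<longlonglongrightarrow> v t"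
    using v unfolding limit_of_approx_def using uniform_limit_at_point by meson
  have "(\<lambda>n. norm (U n t - V n t)) \<longlonglongrightarrow> norm (u t - v t)"
    by (intro tendsto_intros U V)
  moreover have "norm (U n t - V n t) \<le> exp (L * \<bar>t\<bar>) * norm (T y - T z)" for n
    using approx_dist[OF _ U(1) V(1), of n t] by (simp add: U V)
  ultimately show ?thesis by (intro LIMSEQ_le_const2) auto
qed

lemma limit_of_approx_solves:
  assumes "limit_of_approx y u"
  shows "solves u"
proof -
  define e where "e n = 1 / real (Suc n)" for n
  have e: "e n > 0" for n by (simp add: e_def)
  obtain U where U: "\<And>n. approx (e n) (U n)" "\<And>n. U n 0 = T y"
    and lim: "\<And>r. uniform_limit {-r..r} U u sequentially"
    using assms unfolding limit_of_approx_def e_def by blast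
  define \<rho> where "\<rho> n t = - e n *\<^sub>R G (R (e n) (U n t))" for n t
  have TR: "T (R (e n) x) = x - e n *\<^sub>R R (e n) x" for n x
    using R_eq[OF e, of n x] by (simp add: algebra_simps)
  show ?thesis
  proof (rule solves_limit[where U = U and \<rho> = \<rho>])
    show "continuous_on UNIV (U n)" for n by (rule approx_continuous[OF U(1)])
    show "((\<lambda>t. T (U n t)) has_vector_derivative G (U n t) + T (F (U n t)) + \<rho> n t) (at t)" for n t
    proof -
      have "((\<lambda>t. T (U n t)) has_vector_derivative T (G (R (e n) (U n t)) + F (U n t))) (at t)"
        by (rule T.has_vector_derivative[OF approxD[OF U(1)]])
      moreover have "T (G (R (e n) (U n t)) + F (U n t)) = G (U n t) + T (F (U n t)) + \<rho> n t"
        by (simp add: T.add G_T[symmetric] TR G.diff G.scaleR \<rho>_def)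
      ultimately show ?thesis by simp
    qed
    show "((\<lambda>t. (U n t \<bullet> U n t) / 2 + \<Psi> (U n t)) has_real_derivative
        (U n t + T (m (U n t))) \<bullet> F (U n t) + m (U n t) \<bullet> G (U n t) + m (U n t) \<bullet> \<rho> n t) (at t)" for n t
    proof -
      define x w where "x = U n t" and "w = R (e n) (U n t)"
      have "((\<lambda>t. \<Psi> (U n t)) has_vector_derivative T (m x) \<bullet> (G w + F x)) (at t)"
        using diff_chain_at[OF approxD[OF U(1), unfolded has_vector_derivative_def] \<Psi>, of n t]
        by (simp add: o_def has_vector_derivative_def x_def w_def)
      then have "((\<lambda>t. (U n t \<bullet> U n t) / 2 + \<Psi> (U n t)) has_real_derivative
          2 * (x \<bullet> (G w + F x)) / 2 + T (m x) \<bullet> (G w + F x)) (at t)"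
        unfolding has_real_derivative_iff_has_vector_derivative[symmetric] x_def w_def
        by (intro DERIV_add DERIV_cdivide has_real_derivative_inner_self approxD U)
      moreover have "T (m x) \<bullet> G w = m x \<bullet> G x + m x \<bullet> \<rho> n t"
      proof -
        have "T (m x) \<bullet> G w = m x \<bullet> G (T w)" by (simp add: T_sym G_T)
        also have "G (T w) = G x + \<rho> n t"
          by (simp add: w_def x_def TR \<rho>_def G.diff G.scaleR)
        finally show ?thesis by (simp add: inner_add_right)
      qed
      moreover have "x \<bullet> G w = 0" unfolding x_def w_def by (rule G_R_self[OF e])
      ultimately show ?thesis
        by (simp add: x_def inner_add_left inner_add_right algebra_simps)
    qed
    show "uniform_limit {-r..r} \<rho> (\<lambda>_. 0) sequentially" for r
    proof (rule uniform_limitI)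
      fix \<epsilon> :: real assume \<epsilon>: "\<epsilon> > 0"
      have "(\<lambda>n. e n * yosida_bound y r) \<longlonglongrightarrow> 0 * yosida_bound y r"
        unfolding e_def using LIMSEQ_inverse_real_of_nat by (intro tendsto_intros) (simp add: inverse_eq_divide)
      then have "\<forall>\<^sub>F n in sequentially. e n * yosida_bound y r < \<epsilon>"
        using \<epsilon> by (auto dest: order_tendstoD(2))
      then show "\<forall>\<^sub>F n in sequentially. \<forall>t\<in>{-r..r}. dist (\<rho> n t) 0 < \<epsilon>"
      proof eventually_elim
        case (elim n)
        have "norm (\<rho> n t) \<le> e n * yosida_bound y r" if "t \<in> {-r..r}" for t
        proof -
          have "\<bar>t\<bar> \<le> r" using that by auto
          from mult_left_mono[OF approx_R_bound[OF e U this], of "e n" n] e[of n]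
          show ?thesis by (simp add: \<rho>_def G_norm)
        qed
        then have "norm (\<rho> n t) < \<epsilon>" if "t \<in> {-r..r}" for t
          using that elim by (meson order.strict_trans1)
        then show ?case by simp
      qed
    qed
  qed (rule lim)
qed

text \<open>Initial values in the range of \<open>T\<close> are dense, and the estimate for the distance of two solutions
  carries the existence over to all initial values.\<close>
theorem solution_exists: "\<exists>u. solves u \<and> u 0 = u0"
proof -
  have inj: "x = 0" if "T x = 0" for x using T_pos[of x] that by (cases "x = 0") auto
  have "u0 \<in> closure (range T)"
    using closure_range_symmetric_injective[OF T T_sym inj] by simp
  then obtain v where vT: "\<And>n. v n \<in> range T" and v: "v \<longlonglongrightarrow> u0" unfolding closure_sequential by blast
  have "\<forall>n. \<exists>y. v n = T y" using vT by (simp add: image_iff)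
  then obtain y where y: "\<And>n. v n = T (y n)" using choice[of "\<lambda>n y. v n = T y"] by blast
  have "\<forall>n. \<exists>U. limit_of_approx (y n) U" using limit_of_approx_exists by blast
  from choice[OF this] obtain U where U: "\<And>n. limit_of_approx (y n) (U n)" by blast
  have sol: "solves (U n)" for n by (rule limit_of_approx_solves[OF U])
  have dist: "dist (U n t) (U k t) \<le> exp (L * r) * dist (v n) (v k)" if "t \<in> {-r..r}" for n k t r
  proof -
    have "exp (L * \<bar>t\<bar>) \<le> exp (L * r)" using that L by auto
    then have "exp (L * \<bar>t\<bar>) * dist (v n) (v k) \<le> exp (L * r) * dist (v n) (v k)"
      by (intro mult_right_mono) auto
    then show ?thesis using limit_of_approx_dist[OF U U, of n t k] by (simp add: dist_norm y)
  qed
  have conv: "uniformly_convergent_on {-r..r} U" for r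
  proof (rule Cauchy_uniformly_convergent, rule uniformly_Cauchy_onI)
    fix \<epsilon> :: real assume \<epsilon>: "\<epsilon> > 0"
    obtain N where N: "\<And>n k. n \<ge> N \<Longrightarrow> k \<ge> N \<Longrightarrow> dist (v n) (v k) < \<epsilon> / exp (L * r)"
      using metric_CauchyD[OF LIMSEQ_imp_Cauchy[OF v], of "\<epsilon> / exp (L * r)"] \<epsilon> by auto
    have "dist (U n x) (U k x) < \<epsilon>" if "x \<in> {-r..r}" "n \<ge> N" "k \<ge> N" for x n k
      using dist[OF that(1), of n k] N[OF that(2,3)] by (simp add: field_simps)
    then show "\<exists>M. \<forall>x\<in>{-r..r}. \<forall>m\<ge>M. \<forall>n\<ge>M. dist (U m x) (U n x) < \<epsilon>" by blast
  qed
  define u where "u t = lim (\<lambda>n. U n t)" for t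
  have lim: "uniform_limit {-r..r} U u sequentially" for r
    using conv[of r] unfolding uniformly_convergent_uniform_limit_iff u_def .
  have "solves u"
    by (rule solves_limit[where U = U and \<rho> = "\<lambda>_ _. 0"])
      (use sol lim in \<open>auto simp: solves_def intro: uniform_limit_const\<close>)
  moreover have "u 0 = u0"
  proof (rule LIMSEQ_unique[OF _ v])
    have "(\<lambda>n. U n 0) = v" using limit_of_approx_initial[OF U] y by auto
    then show "v \<longlonglongrightarrow> u 0" using uniform_limit_at_point[OF lim, of 0] by simp
  qed
  ultimately show ?thesis by blast
qed

end

section \<open>Smooth test functions\<close>

definition smooth :: "(real \<Rightarrow> real) \<Rightarrow> bool" where
  "smooth f \<longleftrightarrow> (\<forall>n. (deriv ^^ n) f differentiable_on UNIV)"

text \<open>A coinduction principle: a class of functions that is closed under differentiation consists of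
  smooth functions.\<close>
lemma smooth_coinduct:
  assumes f: "f \<in> C" and C: "\<And>g. g \<in> C \<Longrightarrow> \<exists>g'\<in>C. \<forall>x. (g has_real_derivative g' x) (at x)"
  shows "smooth f"
  unfolding smooth_def
proof
  fix n
  have "deriv g \<in> C" "g differentiable_on UNIV" if "g \<in> C" for g
  proof -
    obtain g' where g': "g' \<in> C" "\<And>x. (g has_real_derivative g' x) (at x)" using C[OF \<open>g \<in> C\<close>] by blast
    have "deriv g = g'" using g'(2) DERIV_imp_deriv by blast
    then show "deriv g \<in> C" using g'(1) by simp
    show "g differentiable_on UNIV"
      using g'(2) by (meson differentiable_at_imp_differentiable_on real_differentiable_def)
  qed
  then have "(deriv ^^ n) f \<in> C" by (induction n) (auto simp: f)
  then show "(deriv ^^ n) f differentiable_on UNIV" by fact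
qed

lemma smooth_deriv: "smooth f \<Longrightarrow> smooth (deriv f)"
  unfolding smooth_def by (metis comp_apply funpow_Suc_right)

lemma smooth_has_deriv: "smooth f \<Longrightarrow> (f has_real_derivative deriv f x) (at x)"
  unfolding smooth_def
  by (drule spec[of _ 0]) (auto simp: differentiable_on_def DERIV_deriv_iff_real_differentiable)

lemma smooth_continuous: "smooth f \<Longrightarrow> continuous_on S f"
  using smooth_has_deriv by (meson DERIV_isCont continuous_at_imp_continuous_on)

lemma smooth_antiderivative:
  assumes "\<And>x. (F has_real_derivative f x) (at x)" "smooth f"
  shows "smooth F"
proof (rule smooth_coinduct)
  show "F \<in> insert F {g. smooth g}" by simp
  show "\<exists>g'\<in>insert F {g. smooth g}. \<forall>x. (g has_real_derivative g' x) (at x)"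
    if "g \<in> insert F {g. smooth g}" for g
    using that assms smooth_deriv smooth_has_deriv by blast
qed

lemma smooth_diff:
  assumes "smooth f" "smooth g" shows "smooth (\<lambda>x. f x - g x)"
proof (rule smooth_coinduct)
  let ?C = "{(\<lambda>x. f x - g x) | f g. smooth f \<and> smooth g}"
  show "(\<lambda>x. f x - g x) \<in> ?C" using assms by blast
  fix h assume "h \<in> ?C"
  then obtain p q where h: "h = (\<lambda>x. p x - q x)" "smooth p" "smooth q" by blast
  have "\<forall>x. (h has_real_derivative deriv p x - deriv q x) (at x)"
    using h by (auto intro!: derivative_intros smooth_has_deriv)
  moreover have "(\<lambda>x. deriv p x - deriv q x) \<in> ?C" using h smooth_deriv by blast
  ultimately show "\<exists>h'\<in>?C. \<forall>x. (h has_real_derivative h' x) (at x)"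
    by (intro bexI[of _ "\<lambda>x. deriv p x - deriv q x"]) auto
qed

lemma smooth_affine:
  assumes "smooth f" shows "smooth (\<lambda>x. c * f (a * x + b))"
proof (rule smooth_coinduct)
  let ?C = "{(\<lambda>x. c * f (a * x + b)) | c f. smooth f}"
  show "(\<lambda>x. c * f (a * x + b)) \<in> ?C" using assms by blast
  fix h assume "h \<in> ?C"
  then obtain k p where h: "h = (\<lambda>x. k * p (a * x + b))" "smooth p" by blast
  have "\<forall>x. (h has_real_derivative (k * a) * deriv p (a * x + b)) (at x)"
    using h by (auto intro!: derivative_eq_intros DERIV_chain2[OF smooth_has_deriv])
  moreover have "(\<lambda>x. (k * a) * deriv p (a * x + b)) \<in> ?C" using h smooth_deriv by blast
  ultimately show "\<exists>h'\<in>?C. \<forall>x. (h has_real_derivative h' x) (at x)"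
    by (intro bexI[of _ "\<lambda>x. (k * a) * deriv p (a * x + b)"]) auto
qed

text \<open>By the Leibniz rule the sums of products of smooth functions, unlike the products alone, are closed
  under differentiation.\<close>
inductive sum_of_products :: "(real \<Rightarrow> real) \<Rightarrow> bool" where
  prod: "smooth f \<Longrightarrow> smooth g \<Longrightarrow> sum_of_products (\<lambda>x. f x * g x)"
| sum: "sum_of_products f \<Longrightarrow> sum_of_products g \<Longrightarrow> sum_of_products (\<lambda>x. f x + g x)"

lemma smooth_mult:
  assumes "smooth f" "smooth g" shows "smooth (\<lambda>x. f x * g x)"
proof (rule smooth_coinduct)
  show "(\<lambda>x. f x * g x) \<in> {h. sum_of_products h}" using assms by (auto intro: sum_of_products.prod)
  fix h assume "h \<in> {h. sum_of_products h}"
  then have "sum_of_products h" by simp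
  then show "\<exists>h'\<in>{h. sum_of_products h}. \<forall>x. (h has_real_derivative h' x) (at x)"
  proof induction
    case (prod f g)
    have "\<forall>x. ((\<lambda>x. f x * g x) has_real_derivative deriv f x * g x + f x * deriv g x) (at x)"
      using prod by (auto intro!: derivative_eq_intros smooth_has_deriv)
    moreover have "sum_of_products (\<lambda>x. deriv f x * g x + f x * deriv g x)"
      using prod smooth_deriv by (auto intro!: sum_of_products.intros)
    ultimately show ?case by (intro bexI[of _ "\<lambda>x. deriv f x * g x + f x * deriv g x"]) auto
  next
    case (sum f g)
    then obtain f' g' where *: "sum_of_products f'" "\<And>x. (f has_real_derivative f' x) (at x)"
      "sum_of_products g'" "\<And>x. (g has_real_derivative g' x) (at x)" by auto
    then have "sum_of_products (\<lambda>x. f' x + g' x)" by (blast intro: sum_of_products.sum)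
    then show ?case using * by (intro bexI[of _ "\<lambda>x. f' x + g' x"]) (auto intro!: derivative_intros)
  qed
qed

text \<open>The functions \<open>p(1/x) exp (-1/x)\<close> for \<open>x > 0\<close>, extended by zero. Differentiation replaces \<open>p\<close> by
  \<open>X\<^sup>2 (p - p')\<close>, so this class is closed under it.\<close>
definition flat :: "real poly \<Rightarrow> real \<Rightarrow> real" where
  "flat p x = (if x \<le> 0 then 0 else poly p (1 / x) * exp (- (1 / x)))"

lemma poly_exp_tendsto_0: "((\<lambda>y::real. poly p y * exp (- y)) \<longlongrightarrow> 0) at_top"
proof -
  have "((\<lambda>y::real. \<Sum>i\<le>degree p. coeff p i * (y ^ i / exp y)) \<longlongrightarrow> (\<Sum>i\<le>degree p. coeff p i * 0)) at_top"
    by (intro tendsto_intros tendsto_power_div_exp_0)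
  moreover have "(\<Sum>i\<le>degree p. coeff p i * (y ^ i / exp y)) = poly p y * exp (- y)" for y :: real
    by (simp add: poly_altdef sum_distrib_right exp_minus divide_inverse mult.assoc)
  ultimately show ?thesis by simp
qed

lemma flat_has_derivative:
  "(flat p has_real_derivative flat (monom 1 2 * (p - pderiv p)) x) (at x)"
proof -
  consider "x < 0" | "x = 0" | "x > 0" by linarith
  then show ?thesis
  proof cases
    case 1
    have "((\<lambda>x. 0) has_real_derivative 0) (at x)" by simp
    then have "(flat p has_real_derivative 0) (at x)"
      by (rule has_field_derivative_transform_within_open[of _ _ _ "{..<0}"]) (use 1 in \<open>auto simp: flat_def\<close>)
    then show ?thesis using 1 by (simp add: flat_def)
  next
    case 3
    have "((\<lambda>x. poly p (1 / x) * exp (- (1 / x))) has_real_derivative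
        poly (pderiv p) (1 / x) * (- 1 / x^2) * exp (- (1 / x)) + poly p (1 / x) * (exp (- (1 / x)) * (1 / x^2))) (at x)"
      using 3 by (auto intro!: derivative_eq_intros DERIV_chain2[OF poly_DERIV] simp: power2_eq_square)
    then have "(flat p has_real_derivative
        poly (pderiv p) (1 / x) * (- 1 / x^2) * exp (- (1 / x)) + poly p (1 / x) * (exp (- (1 / x)) * (1 / x^2))) (at x)"
      by (rule has_field_derivative_transform_within_open[of _ _ _ "{0<..}"]) (use 3 in \<open>auto simp: flat_def\<close>)
    then show ?thesis using 3 by (simp add: flat_def poly_monom field_simps)
  next
    case 2
    have "((\<lambda>h. (flat p (0 + h) - flat p 0) / h) \<longlongrightarrow> 0) (at 0)"
    proof (rule filterlim_split_at_real)
      show "((\<lambda>h. (flat p (0 + h) - flat p 0) / h) \<longlongrightarrow> 0) (at_left 0)"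
        by (rule Lim_transform_eventually[OF tendsto_const])
          (auto simp: flat_def eventually_at_filter)
      have "((\<lambda>h. poly (monom 1 1 * p) (inverse h) * exp (- inverse h)) \<longlongrightarrow> 0) (at_right 0)"
        by (rule filterlim_compose[OF poly_exp_tendsto_0 filterlim_inverse_at_top_right])
      then show "((\<lambda>h. (flat p (0 + h) - flat p 0) / h) \<longlongrightarrow> 0) (at_right 0)"
        by (rule Lim_transform_eventually)
          (auto simp: flat_def eventually_at_filter poly_monom field_simps)
    qed
    then show ?thesis using 2 by (simp add: DERIV_def flat_def)
  qed
qed

lemma smooth_flat: "smooth (flat p)"
proof (rule smooth_coinduct[of _ "range flat"])
  show "\<exists>g'\<in>range flat. \<forall>x. (g has_real_derivative g' x) (at x)" if "g \<in> range flat" for g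
    using that flat_has_derivative by blast
qed simp

definition step :: "real \<Rightarrow> real" where "step = flat 1"

lemma step: "smooth step" "0 \<le> step x" "step x \<le> 1" "x \<le> 0 \<Longrightarrow> step x = 0" "x > 0 \<Longrightarrow> step x > 0"
  by (auto simp: step_def smooth_flat) (auto simp: flat_def)

text \<open>A smooth function supported in \<open>[a, b]\<close>, with values in \<open>[0, 1]\<close>, that tends to the indicator of
  \<open>(a, b)\<close> as \<open>n \<rightarrow> \<infinity>\<close>.\<close>
definition bump :: "real \<Rightarrow> real \<Rightarrow> real \<Rightarrow> real \<Rightarrow> real" where
  "bump n a b x = step (n * (x - a)) * step (n * (b - x))"

lemma bump_smooth: "smooth (bump n a b)"
proof -
  have "smooth (\<lambda>x. (1 * step (n * x + (- n * a))) * (1 * step (- n * x + n * b)))"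
    by (intro smooth_mult smooth_affine step)
  then show ?thesis by (simp add: bump_def[abs_def] algebra_simps)
qed

lemma bump_range: "0 \<le> bump n a b x" "bump n a b x \<le> 1"
  using step(2,3) by (auto simp: bump_def intro!: mult_le_one mult_nonneg_nonneg)

lemma bump_zero: "n > 0 \<Longrightarrow> x \<notin> {a<..<b} \<Longrightarrow> bump n a b x = 0"
  using step(4) by (auto simp: bump_def not_less mult_nonneg_nonpos)

lemma bump_pos: "n > 0 \<Longrightarrow> x \<in> {a<..<b} \<Longrightarrow> bump n a b x > 0"
  using step(5) by (auto simp: bump_def)

lemma step_tendsto: "x > 0 \<Longrightarrow> (\<lambda>n. step (real (Suc n) * x)) \<longlonglongrightarrow> 1"
proof -
  assume x: "x > 0"
  have "(\<lambda>n. exp (- (inverse (real (Suc n)) * (1 / x)))) \<longlonglongrightarrow> exp (- (0 * (1 / x)))"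
    by (intro tendsto_intros LIMSEQ_inverse_real_of_nat)
  then show ?thesis using x
    by (simp add: step_def flat_def inverse_eq_divide mult_le_0_iff not_le)
qed

lemma bump_tendsto: "(\<lambda>n. bump (real (Suc n)) a b x) \<longlonglongrightarrow> indicator {a<..<b} x"
proof (cases "x \<in> {a<..<b}")
  case True
  then have "(\<lambda>n. bump (real (Suc n)) a b x) \<longlonglongrightarrow> 1 * 1"
    unfolding bump_def by (intro tendsto_mult step_tendsto) auto
  then show ?thesis using True by simp
next
  case False
  then have "bump (real (Suc n)) a b x = 0" for n by (intro bump_zero) auto
  then show ?thesis using False by simp
qed

text \<open>The primitive of a function with compact support and integral zero has compact support.\<close>
lemma test_function_with_derivative:
  assumes \<sigma>: "smooth \<sigma>" and supp: "\<And>x. x \<notin> {-r..r} \<Longrightarrow> \<sigma> x = 0" and r: "r \<ge> 0"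
    and int: "(\<sigma> has_integral 0) {-r..r}"
  shows "\<exists>\<phi>. test_function \<phi> \<and> deriv \<phi> = \<sigma>"
proof -
  obtain f where f: "\<And>x. (f has_vector_derivative \<sigma> x) (at x)"
    using continuous_has_antiderivative[OF smooth_continuous[OF \<sigma>]] by blast
  define \<phi> where "\<phi> x = f x - f (-r)" for x
  have \<phi>: "(\<phi> has_real_derivative \<sigma> x) (at x)" for x
    unfolding \<phi>_def has_real_derivative_iff_has_vector_derivative
    using has_vector_derivative_diff[OF f has_vector_derivative_const] by simp
  have "(\<sigma> has_integral (f r - f (-r))) {-r..r}"
    by (rule fundamental_theorem_of_calculus) (use r has_vector_derivative_at_within[OF f] in auto)
  then have fr: "f r = f (-r)" using has_integral_unique[OF int] by fastforce
  have flat: "f x = f y" if "\<And>z. z \<in> closed_segment x y \<Longrightarrow> z \<noteq> x \<Longrightarrow> \<sigma> z = 0" for x y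
  proof -
    have "\<sigma> z = 0" if "z \<in> {min x y<..<max x y}" for z
      using that \<open>\<And>z. z \<in> closed_segment x y \<Longrightarrow> z \<noteq> x \<Longrightarrow> \<sigma> z = 0\<close>[of z]
      by (cases "x \<le> y") (auto simp: closed_segment_eq_real_ivl min_def max_def)
    then have "norm (f (max x y) - f (min x y)) \<le> 0 - 0"
    proof (cases "min x y < max x y")
      case True
      then show ?thesis
      proof (rule differentiable_bound_general[where f' = \<sigma> and \<phi>' = "\<lambda>_. 0"])
        show "continuous_on {min x y..max x y} f"
          using f by (meson continuous_at_imp_continuous_on has_vector_derivative_continuous)
        show "(f has_vector_derivative \<sigma> z) (at z)" for z by (rule f)
      qed (use \<open>\<And>z. z \<in> {min x y<..<max x y} \<Longrightarrow> \<sigma> z = 0\<close> in auto)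
    qed auto
    then show ?thesis by (auto simp: min_def max_def split: if_splits)
  qed
  have zero: "\<phi> x = 0" if "x \<notin> {-r..r}" for x
  proof (cases "x < -r")
    case True
    have "f (-r) = f x"
      by (rule flat) (use True supp in \<open>auto simp: closed_segment_eq_real_ivl\<close>)
    then show ?thesis by (simp add: \<phi>_def)
  next
    case False
    then have "x > r" using that by auto
    have "f r = f x"
      by (rule flat) (use \<open>x > r\<close> supp in \<open>auto simp: closed_segment_eq_real_ivl\<close>)
    then show ?thesis by (simp add: \<phi>_def fr)
  qed
  have "smooth \<phi>" by (rule smooth_antiderivative[OF \<phi> \<sigma>])
  moreover have "{x. \<phi> x \<noteq> 0} \<subseteq> {-r..r}" using zero by blast
  then have "closure {x. \<phi> x \<noteq> 0} \<subseteq> {-r..r}" by (simp add: closure_minimal)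
  then have "compact (closure {x. \<phi> x \<noteq> 0})"
    using bounded_subset[OF bounded_closed_interval] by (simp add: compact_eq_bounded_closed)
  moreover have "deriv \<phi> = \<sigma>" using \<phi> DERIV_imp_deriv by blast
  ultimately show ?thesis unfolding test_function_def smooth_def by blast
qed

lemma test_function_props:
  assumes "test_function \<phi>"
  shows "(\<phi> has_real_derivative deriv \<phi> x) (at x)" "continuous_on S \<phi>" "continuous_on S (deriv \<phi>)"
    and "\<exists>r>0. \<forall>x. \<bar>x\<bar> \<ge> r \<longrightarrow> \<phi> x = 0 \<and> deriv \<phi> x = 0"
proof -
  have s: "smooth \<phi>" using assms by (simp add: test_function_def smooth_def)
  then show d: "(\<phi> has_real_derivative deriv \<phi> x) (at x)" for x by (rule smooth_has_deriv)
  show "continuous_on S \<phi>" "continuous_on S (deriv \<phi>)"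
    using s by (auto intro: smooth_continuous smooth_deriv)
  have "bounded {x. \<phi> x \<noteq> 0}"
    using assms closure_subset bounded_subset compact_imp_bounded by (metis test_function_def)
  then obtain b where b: "\<And>x. \<phi> x \<noteq> 0 \<Longrightarrow> \<bar>x\<bar> \<le> b" unfolding bounded_iff by auto
  define r where "r = \<bar>b\<bar> + 1"
  have z: "\<phi> x = 0" if "\<bar>x\<bar> > \<bar>b\<bar>" for x using b[of x] that by fastforce
  have "deriv \<phi> x = 0" if "\<bar>x\<bar> \<ge> r" for x
  proof -
    have "((\<lambda>_. 0) has_real_derivative 0) (at x)" by simp
    then have "(\<phi> has_real_derivative 0) (at x)"
    proof (rule has_field_derivative_transform_within_open[of _ _ _ "{y. \<bar>b\<bar> < \<bar>y\<bar>}"])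
      show "open {y::real. \<bar>b\<bar> < \<bar>y\<bar>}" by (intro open_Collect_less continuous_intros)
    qed (use that z in \<open>auto simp: r_def\<close>)
    then show ?thesis using DERIV_imp_deriv by blast
  qed
  then show "\<exists>r>0. \<forall>x. \<bar>x\<bar> \<ge> r \<longrightarrow> \<phi> x = 0 \<and> deriv \<phi> x = 0"
    using z by (intro exI[of _ r]) (auto simp: r_def)
qed

section \<open>Primitives of locally integrable functions\<close>

definition loc_int :: "(real \<Rightarrow> complex) \<Rightarrow> bool" where
  "loc_int h \<longleftrightarrow> (\<forall>a b. set_integrable lborel {a..b} h)"

text \<open>The function \<open>F\<close> is locally absolutely continuous with derivative \<open>g\<close> almost everywhere.\<close>
definition ac_primitive :: "(real \<Rightarrow> complex) \<Rightarrow> (real \<Rightarrow> complex) \<Rightarrow> bool" where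
  "ac_primitive F g \<longleftrightarrow> loc_int g \<and> (\<forall>a b. a \<le> b \<longrightarrow> F b - F a = (LINT x:{a..b}|lborel. g x))"

lemma loc_int_D: "loc_int h \<Longrightarrow> set_integrable lborel {a..b} h"
  by (simp add: loc_int_def)

lemma loc_int_diff: "loc_int f \<Longrightarrow> loc_int g \<Longrightarrow> loc_int (\<lambda>x. f x - g x)"
  by (simp add: loc_int_def)

lemma loc_int_continuous: "continuous_on UNIV f \<Longrightarrow> loc_int f"
  unfolding loc_int_def by (blast intro: borel_integrable_atLeastAtMost' continuous_on_subset)

lemma loc_int_cmult_continuous:
  assumes "loc_int g" "continuous_on UNIV F"
  shows "loc_int (\<lambda>x. F x * g x)"
  unfolding loc_int_def
proof (intro allI)
  fix a b :: real
  have "compact (F ` {a..b})"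
    by (intro compact_continuous_image continuous_on_subset[OF assms(2)]) auto
  then obtain B where "\<forall>y\<in>F ` {a..b}. norm y \<le> B"
    using compact_imp_bounded bounded_iff by metis
  then have B: "norm (F x) \<le> B" if "x \<in> {a..b}" for x using that by blast
  have [measurable]: "F \<in> borel_measurable borel"
    by (rule borel_measurable_continuous_onI[OF assms(2)])
  note g = assms(1)[unfolded loc_int_def set_integrable_def, rule_format, of a b]
  note [measurable] = borel_measurable_integrable[OF g]
  have "integrable lborel (\<lambda>x. F x * (indicator {a..b} x *\<^sub>R g x))"
  proof (rule Bochner_Integration.integrable_bound)
    show "integrable lborel (\<lambda>x. B *\<^sub>R norm (indicator {a..b} x *\<^sub>R g x))"
      using integrable_norm[OF g] by simp
    show "AE x in lborel. norm (F x * (indicator {a..b} x *\<^sub>R g x))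
        \<le> norm (B *\<^sub>R norm (indicator {a..b} x *\<^sub>R g x))"
    proof (rule AE_I2)
      fix x
      show "norm (F x * (indicator {a..b} x *\<^sub>R g x)) \<le> norm (B *\<^sub>R norm (indicator {a..b} x *\<^sub>R g x))"
      proof (cases "x \<in> {a..b}")
        case True
        then have "norm (F x) \<le> \<bar>B\<bar>" using B[of x] by linarith
        then show ?thesis using True by (simp add: norm_mult abs_mult mult_right_mono)
      qed simp
    qed
  qed measurable
  then show "set_integrable lborel {a..b} (\<lambda>x. F x * g x)"
    unfolding set_integrable_def by (simp add: scaleR_conv_of_real mult_ac)
qed

text \<open>Intervals generate the Borel sets and are stable under intersection, so on each \<open>[-n, n]\<close> the
  integrals over all Borel sets vanish.\<close>
lemma AE_zero_of_interval_integrals: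
  assumes h: "loc_int h" and zero: "\<And>a b. a \<le> b \<Longrightarrow> (LINT x:{a..b}|lborel. h x) = 0"
  shows "AE x in lborel. h x = 0"
proof -
  have "AE x in lborel. indicator {- real n..real n} x *\<^sub>R h x = 0" for n
  proof (rule sigma_finite_measure.density_zero[OF lborel.sigma_finite_measure_axioms])
    define k where "k x = indicator {- real n..real n} x *\<^sub>R h x" for x
    have k: "integrable lborel k" using loc_int_D[OF h] by (simp add: k_def[abs_def] set_integrable_def)
    then show "integrable lborel (\<lambda>x. indicator {- real n..real n} x *\<^sub>R h x)" by (simp add: k_def[abs_def])
    have sk: "set_integrable lborel A k" if "A \<in> sets borel" for A
      unfolding set_integrable_def using k that by (intro integrable_mult_indicator) auto
    define \<G> where "\<G> = range (\<lambda>(a, b). {a..b::real})"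
    have Icc: "(LINT x:{a..b}|lborel. k x) = 0" for a b
    proof -
      have "(LINT x:{a..b}|lborel. k x) = (LINT x:{max a (- real n)..min b (real n)}|lborel. h x)"
        unfolding set_lebesgue_integral_def k_def
        by (intro Bochner_Integration.integral_cong) (auto simp: indicator_def)
      also have "\<dots> = 0"
        using zero[of "max a (- real n)" "min b (real n)"]
        by (cases "max a (- real n) \<le> min b (real n)") (auto simp: set_lebesgue_integral_def)
      finally show ?thesis .
    qed
    have UN: "(LINT x:UNIV|lborel. k x) = 0"
    proof -
      have "(LINT x:UNIV|lborel. k x) = (LINT x:{- real n..real n}|lborel. k x)"
        unfolding set_lebesgue_integral_def k_def
        by (intro Bochner_Integration.integral_cong) (auto simp: indicator_def)
      then show ?thesis by (simp add: Icc)
    qed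
    have "(LINT x:A|lborel. k x) = 0" if "A \<in> sigma_sets UNIV \<G>" for A
    proof (rule sigma_sets_induct_disjoint[OF _ _ that])
      show "Int_stable \<G>"
      proof (rule Int_stableI)
        fix A B assume "A \<in> \<G>" "B \<in> \<G>"
        then obtain a b c d where "A = {a..b}" "B = {c..d}" by (auto simp: \<G>_def)
        then have "A \<inter> B = {max a c..min b d}" by auto
        then show "A \<inter> B \<in> \<G>" by (auto simp: \<G>_def)
      qed
      show "\<G> \<subseteq> Pow UNIV" by simp
      show "(LINT x:A|lborel. k x) = 0" if "A \<in> \<G>" for A
        using that Icc by (auto simp: \<G>_def)
      show "(LINT x:{}|lborel. k x) = 0" by (simp add: set_lebesgue_integral_def)
      have borel: "A \<in> sigma_sets UNIV \<G> \<Longrightarrow> A \<in> sets borel" for A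
        unfolding \<G>_def borel_eq_atLeastAtMost by (simp add: sets_measure_of)
      show "(LINT x:UNIV - A|lborel. k x) = 0"
        if "A \<in> sigma_sets UNIV \<G>" "(LINT x:A|lborel. k x) = 0" for A
      proof -
        have "(LINT x:A \<union> (UNIV - A)|lborel. k x) = (LINT x:A|lborel. k x) + (LINT x:UNIV - A|lborel. k x)"
          using borel[OF that(1)] by (intro set_integral_Un sk) auto
        then show ?thesis using that UN by simp
      qed
      show "(LINT x:(\<Union>i. A i)|lborel. k x) = 0"
        if "disjoint_family A" "range A \<subseteq> sigma_sets UNIV \<G>" "\<And>i. (LINT x:A i|lborel. k x) = 0"
        for A :: "nat \<Rightarrow> real set"
      proof -
        have A: "A i \<in> sets borel" for i using that(2) borel by blast
        have "(LINT x:(\<Union>i. A i)|lborel. k x) = (\<Sum>i. (LINT x:A i|lborel. k x))"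
          using that(1) A by (intro lebesgue_integral_countable_add sk) (auto simp: disjoint_family_on_def)
        then show ?thesis using that(3) by simp
      qed
    qed
    then show "(LINT x:A|lborel. indicator {- real n..real n} x *\<^sub>R h x) = 0" if "A \<in> sets lborel" for A
      using that unfolding k_def[symmetric] \<G>_def by (simp add: borel_eq_atLeastAtMost sets_measure_of)
  qed
  then have "AE x in lborel. \<forall>n. indicator {- real n..real n} x *\<^sub>R h x = 0" by (simp only: AE_all_countable) simp
  then show ?thesis
  proof eventually_elim
    case (elim x)
    obtain n where "\<bar>x\<bar> \<le> real n" using real_arch_simple by blast
    then have "x \<in> {- real n..real n}" by auto
    then show ?case using elim[rule_format, of n] by simp
  qed
qed

lemma ac_primitive_unique:
  assumes "ac_primitive F g" "ac_primitive F g'"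
  shows "AE x in lborel. g x = g' x"
proof -
  have "AE x in lborel. g x - g' x = 0"
  proof (rule AE_zero_of_interval_integrals)
    show "loc_int (\<lambda>x. g x - g' x)" using assms by (auto simp: ac_primitive_def intro: loc_int_diff)
    show "(LINT x:{a..b}|lborel. g x - g' x) = 0" if "a \<le> b" for a b
      using assms that by (subst set_integral_diff) (auto simp: ac_primitive_def loc_int_def)
  qed
  then show ?thesis by simp
qed

lemma ac_primitive_continuous:
  assumes "ac_primitive F g"
  shows "continuous_on S F"
proof -
  have "continuous_on UNIV F"
  proof (rule continuous_at_imp_continuous_on, rule ballI)
    fix x :: real
    define a where "a = x - 1"
    have g: "set_integrable lborel {a..b} g" for b using assms by (simp add: ac_primitive_def loc_int_def)
    have "continuous_on {a..x+1} (\<lambda>y. F a + integral {a..y} g)"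
      by (intro continuous_intros indefinite_integral_continuous_1 set_borel_integral_eq_integral(1) g)
    moreover have "F a + integral {a..y} g = F y" if "y \<in> {a..x+1}" for y
      using assms that set_borel_integral_eq_integral(2)[OF g[of y]]
      by (auto simp: ac_primitive_def algebra_simps)
    ultimately have "continuous_on {a..x+1} F" by (simp cong: continuous_on_cong_simp)
    then have "continuous_on {a<..<x+1} F" by (rule continuous_on_subset) auto
    then show "isCont F x"
      using continuous_on_eq_continuous_at[OF open_greaterThanLessThan, of a "x+1" F] by (simp add: a_def)
  qed
  then show ?thesis by (rule continuous_on_subset) simp
qed

lemma ac_primitive_exists:
  assumes "loc_int g"
  shows "\<exists>F. ac_primitive F g"
proof -
  define F where "F x = integral {0..x} g - integral {x..0} g" for x
  have int: "g integrable_on {x..y}" for x y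
    by (rule set_borel_integral_eq_integral(1)[OF loc_int_D[OF assms]])
  have "F b - F a = integral {a..b} g" if "a \<le> b" for a b
  proof -
    consider "0 \<le> a" | "a < 0" "0 \<le> b" | "b < 0" by linarith
    then show ?thesis
    proof cases
      case 1
      then have "integral {0..a} g + integral {a..b} g = integral {0..b} g"
        using that by (intro Henstock_Kurzweil_Integration.integral_combine int) auto
      moreover have "integral {a..0} g = 0" "integral {b..0} g = 0"
        using 1 that by (cases "a = 0"; cases "b = 0"; simp)+
      ultimately show ?thesis by (simp add: F_def algebra_simps)
    next
      case 2
      then have "integral {a..0} g + integral {0..b} g = integral {a..b} g"
        by (intro Henstock_Kurzweil_Integration.integral_combine int) auto
      moreover have "integral {0..a} g = 0" "integral {b..0} g = 0"
        using 2 by (cases "b = 0"; simp)+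
      ultimately show ?thesis by (simp add: F_def algebra_simps)
    next
      case 3
      then have "integral {a..b} g + integral {b..0} g = integral {a..0} g"
        using that by (intro Henstock_Kurzweil_Integration.integral_combine int) auto
      moreover have "integral {0..a} g = 0" "integral {0..b} g = 0" using 3 that by auto
      ultimately show ?thesis by (simp add: F_def algebra_simps)
    qed
  qed
  then show ?thesis using assms set_borel_integral_eq_integral(2)[OF loc_int_D[OF assms]]
    by (auto simp: ac_primitive_def)
qed

text \<open>The product rule is Fubini's theorem for \<open>f(x) g(y)\<close> on the square \<open>[a, b]\<^sup>2\<close>, cut along the diagonal:
  the part below it is \<open>\<integral>f (G - G a)\<close>, the part above it is \<open>\<integral>g (F - F a)\<close>.\<close>
lemma ac_primitive_mult:
  assumes F: "ac_primitive F f" and G: "ac_primitive G g"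
  shows "ac_primitive (\<lambda>x. F x * G x) (\<lambda>x. f x * G x + F x * g x)"
proof -
  have Fc: "continuous_on UNIV F" and Gc: "continuous_on UNIV G"
    using F G by (auto intro: ac_primitive_continuous)
  have lf: "loc_int f" and lg: "loc_int g" using F G by (auto simp: ac_primitive_def)
  have lfG: "loc_int (\<lambda>x. f x * G x)" using loc_int_cmult_continuous[OF lf Gc] by (simp add: mult.commute)
  have lFg: "loc_int (\<lambda>x. F x * g x)" by (rule loc_int_cmult_continuous[OF lg Fc])
  have "F b * G b - F a * G a = (LINT x:{a..b}|lborel. f x * G x + F x * g x)" if ab: "a \<le> b" for a b
  proof -
    define f1 where "f1 x = indicator {a..b} x *\<^sub>R f x" for x
    define g1 where "g1 x = indicator {a..b} x *\<^sub>R g x" for x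
    have f1: "integrable lborel f1" and g1: "integrable lborel g1"
      using loc_int_D[OF lf, of a b] loc_int_D[OF lg, of a b] by (auto simp: set_integrable_def f1_def[abs_def] g1_def[abs_def])
    note [measurable] = borel_measurable_integrable[OF f1] borel_measurable_integrable[OF g1]
    have prod: "integrable (lborel \<Otimes>\<^sub>M lborel) (\<lambda>(x, y). f1 x * g1 y)"
    proof (rule lborel_pair.Fubini_integrable)
      show "integrable lborel (\<lambda>x. \<integral>y. norm (case (x, y) of (x, y) \<Rightarrow> f1 x * g1 y) \<partial>lborel)"
        using f1 by (simp add: norm_mult)
      show "AE x in lborel. integrable lborel (\<lambda>y. case (x, y) of (x, y) \<Rightarrow> f1 x * g1 y)"
        using g1 by simp
    qed measurable
    define h1 where "h1 x y = indicator {..x} y *\<^sub>R (f1 x * g1 y)" for x y :: real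
    define h2 where "h2 x y = indicator {x<..} y *\<^sub>R (f1 x * g1 y)" for x y :: real
    have [measurable]: "(\<lambda>(x, y). indicator {..x} y *\<^sub>R (f1 x * g1 y)) \<in> borel_measurable (lborel \<Otimes>\<^sub>M lborel)"
      "(\<lambda>(x, y). indicator {x<..} y *\<^sub>R (f1 x * g1 y)) \<in> borel_measurable (lborel \<Otimes>\<^sub>M lborel)"
      unfolding indicator_def atMost_iff greaterThan_iff by measurable
    have i1: "integrable (lborel \<Otimes>\<^sub>M lborel) (\<lambda>(x, y). h1 x y)"
      by (rule Bochner_Integration.integrable_bound[OF prod])
        (auto simp: h1_def split_def indicator_def intro!: AE_I2)
    have i2: "integrable (lborel \<Otimes>\<^sub>M lborel) (\<lambda>(x, y). h2 x y)"
      by (rule Bochner_Integration.integrable_bound[OF prod])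
        (auto simp: h2_def split_def indicator_def intro!: AE_I2)
    have If: "(\<integral>x. f1 x \<partial>lborel) = F b - F a" and Ig: "(\<integral>x. g1 x \<partial>lborel) = G b - G a"
      using F G ab by (auto simp: ac_primitive_def set_lebesgue_integral_def f1_def g1_def)
    have inner1: "(\<integral>y. h1 x y \<partial>lborel) = f1 x * (G x - G a)" for x
    proof (cases "x \<in> {a..b}")
      case True
      have "(\<integral>y. h1 x y \<partial>lborel) = (\<integral>y. f1 x * (indicator {a..x} y *\<^sub>R g y) \<partial>lborel)"
        by (intro Bochner_Integration.integral_cong) (use True in \<open>auto simp: h1_def g1_def indicator_def\<close>)
      also have "\<dots> = f1 x * (\<integral>y. indicator {a..x} y *\<^sub>R g y \<partial>lborel)"
        by (rule integral_mult_right_zero)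
      finally show ?thesis using G True by (auto simp: ac_primitive_def set_lebesgue_integral_def)
    qed (auto simp: h1_def f1_def)
    have inner2: "(\<integral>x. h2 x y \<partial>lborel) = g1 y * (F y - F a)" for y
    proof (cases "y \<in> {a..b}")
      case True
      have "(\<integral>x. h2 x y \<partial>lborel) = (\<integral>x. g1 y * (indicator {a..y} x *\<^sub>R f x) \<partial>lborel)"
      proof (rule integral_cong_AE)
        have "AE x in lborel. x \<noteq> y" by (rule AE_lborel_singleton)
        then show "AE x in lborel. h2 x y = g1 y * (indicator {a..y} x *\<^sub>R f x)"
          by eventually_elim (use True in \<open>auto simp: h2_def f1_def indicator_def\<close>)
        show "(\<lambda>x. h2 x y) \<in> borel_measurable lborel"
          unfolding h2_def indicator_def greaterThan_iff by measurable
        have "(\<lambda>x. indicator {a..y} x *\<^sub>R f x) \<in> borel_measurable lborel"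
          using loc_int_D[OF lf, of a y] unfolding set_integrable_def by (rule borel_measurable_integrable)
        then show "(\<lambda>x. g1 y * (indicator {a..y} x *\<^sub>R f x)) \<in> borel_measurable lborel" by measurable
      qed
      also have "\<dots> = g1 y * (\<integral>x. indicator {a..y} x *\<^sub>R f x \<partial>lborel)"
        by (rule integral_mult_right_zero)
      finally show ?thesis using F True by (auto simp: ac_primitive_def set_lebesgue_integral_def)
    qed (auto simp: h2_def g1_def)
    have "(\<integral>x. f1 x \<partial>lborel) * (\<integral>y. g1 y \<partial>lborel) = (\<integral>x. (\<integral>y. f1 x * g1 y \<partial>lborel) \<partial>lborel)"
      by simp
    also have "\<dots> = (\<integral>(x, y). f1 x * g1 y \<partial>(lborel \<Otimes>\<^sub>M lborel))"
      using lborel_pair.integral_fst'[OF prod] by simp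
    also have "\<dots> = (\<integral>(x, y). h1 x y + h2 x y \<partial>(lborel \<Otimes>\<^sub>M lborel))"
      by (intro Bochner_Integration.integral_cong) (auto simp: h1_def h2_def indicator_def)
    also have "\<dots> = (\<integral>(x, y). h1 x y \<partial>(lborel \<Otimes>\<^sub>M lborel)) + (\<integral>(x, y). h2 x y \<partial>(lborel \<Otimes>\<^sub>M lborel))"
      using Bochner_Integration.integral_add[OF i1 i2] by (simp add: split_def)
    also have "(\<integral>(x, y). h1 x y \<partial>(lborel \<Otimes>\<^sub>M lborel)) = (\<integral>x. f1 x * (G x - G a) \<partial>lborel)"
      using lborel_pair.integral_fst'[OF i1] by (simp add: inner1)
    also have "(\<integral>(x, y). h2 x y \<partial>(lborel \<Otimes>\<^sub>M lborel)) = (\<integral>y. g1 y * (F y - F a) \<partial>lborel)"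
      using lborel_pair.integral_snd[OF i2] by (simp add: inner2)
    also have "(\<integral>x. f1 x * (G x - G a) \<partial>lborel) = (LINT x:{a..b}|lborel. f x * G x) - (F b - F a) * G a"
    proof -
      have "(\<integral>x. f1 x * (G x - G a) \<partial>lborel) = (\<integral>x. indicator {a..b} x *\<^sub>R (f x * G x) - f1 x * G a \<partial>lborel)"
        by (intro Bochner_Integration.integral_cong) (auto simp: f1_def algebra_simps)
      also have "\<dots> = (\<integral>x. indicator {a..b} x *\<^sub>R (f x * G x) \<partial>lborel) - (\<integral>x. f1 x * G a \<partial>lborel)"
        using loc_int_D[OF lfG, of a b] f1
        by (intro Bochner_Integration.integral_diff) (auto simp: set_integrable_def)
      finally show ?thesis by (simp add: If set_lebesgue_integral_def)
    qed
    also have "(\<integral>y. g1 y * (F y - F a) \<partial>lborel) = (LINT x:{a..b}|lborel. F x * g x) - (G b - G a) * F a"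
    proof -
      have "(\<integral>y. g1 y * (F y - F a) \<partial>lborel) = (\<integral>x. indicator {a..b} x *\<^sub>R (F x * g x) - g1 x * F a \<partial>lborel)"
        by (intro Bochner_Integration.integral_cong) (auto simp: g1_def algebra_simps)
      also have "\<dots> = (\<integral>x. indicator {a..b} x *\<^sub>R (F x * g x) \<partial>lborel) - (\<integral>x. g1 x * F a \<partial>lborel)"
        using loc_int_D[OF lFg, of a b] g1
        by (intro Bochner_Integration.integral_diff) (auto simp: set_integrable_def)
      finally show ?thesis by (simp add: Ig set_lebesgue_integral_def)
    qed
    finally have "(LINT x:{a..b}|lborel. f x * G x) + (LINT x:{a..b}|lborel. F x * g x) = F b * G b - F a * G a"
      by (simp add: If Ig algebra_simps)
    moreover have "(LINT x:{a..b}|lborel. f x * G x + F x * g x)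
        = (LINT x:{a..b}|lborel. f x * G x) + (LINT x:{a..b}|lborel. F x * g x)"
      by (rule set_integral_add(2)[OF loc_int_D[OF lfG] loc_int_D[OF lFg]])
    ultimately show ?thesis by simp
  qed
  moreover have "loc_int (\<lambda>x. f x * G x + F x * g x)"
    using lfG lFg by (simp add: loc_int_def)
  ultimately show ?thesis by (simp add: ac_primitive_def)
qed

lemma ac_primitive_of_real:
  assumes d: "\<And>x. (\<phi> has_real_derivative \<phi>' x) (at x)" and c: "continuous_on UNIV \<phi>'"
  shows "ac_primitive (\<lambda>x. of_real (\<phi> x)) (\<lambda>x. of_real (\<phi>' x))"
proof -
  have "complex_of_real (\<phi> b) - of_real (\<phi> a) = (LINT x:{a..b}|lborel. of_real (\<phi>' x))" if "a \<le> b" for a b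
    unfolding set_lebesgue_integral_def
    using that d
    by (intro integral_FTC_atLeastAtMost[symmetric] has_vector_derivative_of_real continuous_intros continuous_on_subset[OF c])
      (auto simp: has_real_derivative_iff_has_vector_derivative intro: has_vector_derivative_at_within)
  moreover have "loc_int (\<lambda>x. of_real (\<phi>' x))"
    by (intro loc_int_continuous continuous_intros c)
  ultimately show ?thesis by (simp add: ac_primitive_def)
qed

lemma integral_eq_set_integral:
  fixes f :: "real \<Rightarrow> complex"
  assumes "\<And>x. \<bar>x\<bar> \<ge> r \<Longrightarrow> f x = 0"
  shows "(\<integral>x. f x \<partial>lborel) = (LINT x:{-r..r}|lborel. f x)"
  unfolding set_lebesgue_integral_def
  by (intro Bochner_Integration.integral_cong) (use assms in \<open>auto simp: indicator_def\<close>)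

text \<open>Integrate the product rule for \<open>\<phi> F\<close> over an interval containing the support of \<open>\<phi>\<close>.\<close>
lemma ac_primitive_has_weak_deriv:
  assumes F: "ac_primitive F g"
  shows "has_weak_deriv F g"
  unfolding has_weak_deriv_def
proof (intro allI impI)
  fix \<phi> assume \<phi>: "test_function \<phi>"
  note \<phi>' = test_function_props[OF \<phi>]
  obtain r where r: "r > 0" "\<And>x. \<bar>x\<bar> \<ge> r \<Longrightarrow> \<phi> x = 0 \<and> deriv \<phi> x = 0" using \<phi>'(4) by blast
  define P where "P x = complex_of_real (\<phi> x)" for x
  define Q where "Q x = complex_of_real (deriv \<phi> x)" for x
  have P: "ac_primitive P Q" unfolding P_def Q_def by (rule ac_primitive_of_real[OF \<phi>'(1,3)])
  have prod: "ac_primitive (\<lambda>x. P x * F x) (\<lambda>x. Q x * F x + P x * g x)" by (rule ac_primitive_mult[OF P F])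
  have "(LINT x:{-r..r}|lborel. Q x * F x + P x * g x) = P r * F r - P (-r) * F (-r)"
    using prod r(1) by (auto simp: ac_primitive_def)
  also have "\<dots> = 0" using r(1) r(2)[of r] r(2)[of "-r"] by (simp add: P_def)
  finally have "(LINT x:{-r..r}|lborel. Q x * F x) + (LINT x:{-r..r}|lborel. P x * g x) = 0"
  proof (subst (asm) set_integral_add(2))
    have Qc: "continuous_on UNIV Q" unfolding Q_def by (intro continuous_intros \<phi>')
    show "set_integrable lborel {-r..r} (\<lambda>x. Q x * F x)"
      by (intro loc_int_D loc_int_continuous continuous_intros Qc ac_primitive_continuous[OF F])
    show "set_integrable lborel {-r..r} (\<lambda>x. P x * g x)"
      using F by (intro loc_int_D loc_int_cmult_continuous ac_primitive_continuous[OF P]) (simp add: ac_primitive_def)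
  qed simp
  moreover have "(\<integral>x. deriv \<phi> x *\<^sub>R F x \<partial>lborel) = (LINT x:{-r..r}|lborel. Q x * F x)"
    unfolding Q_def scaleR_conv_of_real using r(2) by (intro integral_eq_set_integral) auto
  moreover have "(\<integral>x. \<phi> x *\<^sub>R g x \<partial>lborel) = (LINT x:{-r..r}|lborel. P x * g x)"
    unfolding P_def scaleR_conv_of_real using r(2) by (intro integral_eq_set_integral) auto
  ultimately show "(\<integral>x. deriv \<phi> x *\<^sub>R F x \<partial>lborel) = - (\<integral>x. \<phi> x *\<^sub>R g x \<partial>lborel)"
    by (simp add: eq_neg_iff_add_eq_0)
qed

section \<open>Weak derivatives and \<open>L\<^sup>2\<close>\<close>

lemma integrable_cutoff_mult:
  fixes \<psi> :: "real \<Rightarrow> real"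
  assumes \<psi>: "continuous_on UNIV \<psi>" "\<And>x. \<bar>x\<bar> \<ge> r \<Longrightarrow> \<psi> x = 0" and f: "loc_int f"
  shows "integrable lborel (\<lambda>x. \<psi> x *\<^sub>R f x)"
proof -
  have "continuous_on UNIV (\<lambda>x. complex_of_real (\<psi> x))" by (intro continuous_intros \<psi>)
  from loc_int_D[OF loc_int_cmult_continuous[OF f this], of "-r" r]
  have "integrable lborel (\<lambda>x. indicator {-r..r} x *\<^sub>R (of_real (\<psi> x) * f x))"
    by (simp add: set_integrable_def)
  moreover have "(\<lambda>x. indicator {-r..r} x *\<^sub>R (of_real (\<psi> x) * f x)) = (\<lambda>x. \<psi> x *\<^sub>R f x)"
  proof
    fix x
    show "indicator {-r..r} x *\<^sub>R (of_real (\<psi> x) * f x) = \<psi> x *\<^sub>R f x"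
    proof (cases "\<bar>x\<bar> \<ge> r")
      case False
      then have "x \<in> {-r..r}" by auto
      then show ?thesis by (simp add: scaleR_conv_of_real)
    qed (simp add: \<psi>(2))
  qed
  ultimately show ?thesis by simp
qed

text \<open>Testing with a primitive of \<open>bump n a b - k bump 1 0 1\<close>, where \<open>k\<close> makes the integral zero, shows that
  \<open>\<integral>bump n a b * h\<close> is \<open>c\<close> times the integral of the bump, with \<open>c\<close> independent of \<open>n\<close>, \<open>a\<close>, \<open>b\<close>. As
  \<open>n \<rightarrow> \<infinity>\<close>, all interval integrals of \<open>h - c\<close> vanish.\<close>
lemma constant_of_zero_weak_deriv:
  assumes h: "loc_int h" and zero: "\<And>\<phi>. test_function \<phi> \<Longrightarrow> (\<integral>x. deriv \<phi> x *\<^sub>R h x \<partial>lborel) = 0"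
  shows "\<exists>c. AE x in lborel. h x = c"
proof -
  have b_cont: "continuous_on S (bump n a b)" for S n a b by (rule smooth_continuous[OF bump_smooth])
  have b_supp: "bump n a b x = 0" if "n > 0" "\<bar>x\<bar> \<ge> max \<bar>a\<bar> \<bar>b\<bar>" for n a b x
    using that by (intro bump_zero) auto
  define I where "I n a b = (\<integral>x. bump n a b x \<partial>lborel)" for n a b
  have bI: "(bump n a b has_integral I n a b) {-r..r}" "integrable lborel (bump n a b)"
    if "n > 0" "r \<ge> max \<bar>a\<bar> \<bar>b\<bar>" for n a b r
  proof -
    have si: "set_integrable lborel {-r..r} (bump n a b)"
      by (intro borel_integrable_atLeastAtMost' b_cont)
    have e: "(\<lambda>x. indicator {-r..r} x *\<^sub>R bump n a b x) = bump n a b"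
    proof
      fix x show "indicator {-r..r} x *\<^sub>R bump n a b x = bump n a b x"
        using b_supp[OF that(1), of a b x] that(2) by (cases "x \<in> {-r..r}") auto
    qed
    show "integrable lborel (bump n a b)" using si unfolding set_integrable_def e .
    have "I n a b = integral {-r..r} (bump n a b)"
      using set_borel_integral_eq_integral(2)[OF si] unfolding set_lebesgue_integral_def e I_def by simp
    then show "(bump n a b has_integral I n a b) {-r..r}"
      using set_borel_integral_eq_integral(1)[OF si] by (simp add: has_integral_integral)
  qed
  have bh: "integrable lborel (\<lambda>x. bump n a b x *\<^sub>R h x)" if "n > 0" for n a b
    by (rule integrable_cutoff_mult[OF b_cont b_supp[OF that] h])
  have I0: "I 1 0 1 > 0"
  proof -
    have "I 1 0 1 \<ge> 0" unfolding I_def using bump_range(1) by (intro integral_nonneg_AE) auto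
    moreover have "I 1 0 1 \<noteq> 0"
    proof
      assume "I 1 0 1 = 0"
      then have "(\<integral>x. bump 1 0 1 x \<partial>lborel) = 0" by (simp add: I_def)
      then have "AE x in lborel. bump 1 0 1 x = 0"
        by (subst (asm) integral_nonneg_eq_0_iff_AE) (use bI(2)[where n = 1 and a = 0 and b = 1 and r = 1] bump_range(1) in auto)
      then have "AE x in lborel. x \<notin> {0<..<1::real}"
        by eventually_elim (use bump_pos[of 1 _ 0 1] in force)
      then have "{0<..<1::real} \<in> null_sets lborel"
        by (subst AE_iff_null_sets) auto
      then show False by (simp add: null_sets_def)
    qed
    ultimately show ?thesis by simp
  qed
  define c where "c = (1 / I 1 0 1) *\<^sub>R (\<integral>x. bump 1 0 1 x *\<^sub>R h x \<partial>lborel)"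
  have key: "(\<integral>x. bump n a b x *\<^sub>R h x \<partial>lborel) = I n a b *\<^sub>R c" if n: "n > 0" for n a b
  proof -
    define k where "k = I n a b / I 1 0 1"
    define \<sigma> where "\<sigma> x = bump n a b x - k * bump 1 0 1 x" for x
    define r where "r = max (max \<bar>a\<bar> \<bar>b\<bar>) 1"
    have "\<exists>\<phi>. test_function \<phi> \<and> deriv \<phi> = \<sigma>"
    proof (rule test_function_with_derivative)
      show "smooth \<sigma>" unfolding \<sigma>_def using smooth_affine[OF bump_smooth, of k 1 0 1 1 0]
        by (intro smooth_diff bump_smooth) simp
      show "\<sigma> x = 0" if "x \<notin> {-r..r}" for x
      proof -
        have "\<bar>x\<bar> \<ge> r" using that by auto
        then show ?thesis using b_supp[OF n, of a b x] b_supp[of 1 0 1 x] by (simp add: \<sigma>_def r_def)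
      qed
      show "r \<ge> 0" by (simp add: r_def)
      have "(\<sigma> has_integral (I n a b - k * I 1 0 1)) {-r..r}"
        unfolding \<sigma>_def by (intro has_integral_diff has_integral_mult_right bI n) (auto simp: r_def)
      then show "(\<sigma> has_integral 0) {-r..r}" using I0 by (simp add: k_def)
    qed
    then obtain \<phi> where "test_function \<phi>" "deriv \<phi> = \<sigma>" by blast
    then have "0 = (\<integral>x. \<sigma> x *\<^sub>R h x \<partial>lborel)" using zero by force
    also have "\<dots> = (\<integral>x. bump n a b x *\<^sub>R h x - k *\<^sub>R (bump 1 0 1 x *\<^sub>R h x) \<partial>lborel)"
      by (simp add: \<sigma>_def scaleR_diff_left)
    also have "\<dots> = (\<integral>x. bump n a b x *\<^sub>R h x \<partial>lborel) - k *\<^sub>R (\<integral>x. bump 1 0 1 x *\<^sub>R h x \<partial>lborel)"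
    proof (subst Bochner_Integration.integral_diff)
      show "integrable lborel (\<lambda>x. bump n a b x *\<^sub>R h x)" by (rule bh[OF n])
      show "integrable lborel (\<lambda>x. k *\<^sub>R (bump 1 0 1 x *\<^sub>R h x))"
        by (rule integrable_scaleR_right[OF bh]) simp
    qed (simp only: integral_scaleR_right)
    finally show ?thesis by (simp add: c_def k_def)
  qed
  have "AE x in lborel. h x - c = 0"
  proof (rule AE_zero_of_interval_integrals)
    have lc: "loc_int (\<lambda>x. c)" by (intro loc_int_continuous continuous_intros)
    show "loc_int (\<lambda>x. h x - c)" by (rule loc_int_diff[OF h lc])
    fix a b :: real assume ab: "a \<le> b"
    have ih: "integrable lborel (\<lambda>x. indicator {a..b} x *\<^sub>R h x)"
      using loc_int_D[OF h] by (simp add: set_integrable_def)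
    have ind: "indicator {a<..<b} x *\<^sub>R h x = indicator {a<..<b} x *\<^sub>R (indicator {a..b} x *\<^sub>R h x)" for x
      by (auto simp: indicator_def)
    have bind: "bump n a b x *\<^sub>R h x = bump n a b x *\<^sub>R (indicator {a..b} x *\<^sub>R h x)" if "n > 0" for x n
      using bump_zero[OF that, of x a b] by (cases "x \<in> {a..b}") auto
    note [measurable] = borel_measurable_integrable[OF ih]
    have [measurable]: "bump n a b \<in> borel_measurable borel" for n
      by (rule borel_measurable_continuous_onI[OF b_cont])
    have l1: "(\<lambda>n. \<integral>x. bump (real (Suc n)) a b x *\<^sub>R h x \<partial>lborel)
        \<longlonglongrightarrow> (\<integral>x. indicator {a<..<b} x *\<^sub>R h x \<partial>lborel)"
    proof (rule integral_dominated_convergence)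
      show "integrable lborel (\<lambda>x. norm (indicator {a..b} x *\<^sub>R h x))" using ih by (rule integrable_norm)
      show "(\<lambda>x. indicator {a<..<b} x *\<^sub>R h x) \<in> borel_measurable lborel"
        unfolding ind by measurable
      show "(\<lambda>x. bump (real (Suc n)) a b x *\<^sub>R h x) \<in> borel_measurable lborel" for n
      proof -
        have "(\<lambda>x. bump (real (Suc n)) a b x *\<^sub>R h x) = (\<lambda>x. bump (real (Suc n)) a b x *\<^sub>R (indicator {a..b} x *\<^sub>R h x))"
          by (rule ext, rule bind) simp
        moreover have "\<dots> \<in> borel_measurable lborel" by measurable
        ultimately show ?thesis by simp
      qed
      show "AE x in lborel. (\<lambda>n. bump (real (Suc n)) a b x *\<^sub>R h x) \<longlonglongrightarrow> indicator {a<..<b} x *\<^sub>R h x"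
        by (intro AE_I2 tendsto_intros bump_tendsto)
      show "AE x in lborel. norm (bump (real (Suc n)) a b x *\<^sub>R h x) \<le> norm (indicator {a..b} x *\<^sub>R h x)" for n
      proof (rule AE_I2)
        fix x
        have "norm (bump (real (Suc n)) a b x *\<^sub>R h x) = bump (real (Suc n)) a b x * norm (indicator {a..b} x *\<^sub>R h x)"
          by (subst bind) (simp_all add: bump_range(1))
        also have "\<dots> \<le> 1 * norm (indicator {a..b} x *\<^sub>R h x)"
          by (intro mult_right_mono bump_range) auto
        finally show "norm (bump (real (Suc n)) a b x *\<^sub>R h x) \<le> norm (indicator {a..b} x *\<^sub>R h x)" by simp
      qed
    qed
    have l2: "(\<lambda>n. I (real (Suc n)) a b) \<longlonglongrightarrow> (\<integral>x. indicator {a<..<b} x \<partial>lborel)"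
      unfolding I_def
    proof (rule integral_dominated_convergence)
      show "integrable lborel (indicator {a..b} :: real \<Rightarrow> real)"
        by (rule integrable_real_indicator) (auto simp: emeasure_lborel_Icc_eq)
      show "AE x in lborel. (\<lambda>n. bump (real (Suc n)) a b x) \<longlonglongrightarrow> indicator {a<..<b} x"
        by (intro AE_I2 bump_tendsto)
      show "AE x in lborel. norm (bump (real (Suc n)) a b x) \<le> indicator {a..b} x" for n
      proof (rule AE_I2)
        fix x show "norm (bump (real (Suc n)) a b x) \<le> indicator {a..b} x"
          using bump_range[of "real (Suc n)" a b x] bump_zero[of "real (Suc n)" x a b]
          by (cases "x \<in> {a..b}") auto
      qed
    qed auto
    have "(\<lambda>n. I (real (Suc n)) a b *\<^sub>R c) \<longlonglongrightarrow> (b - a) *\<^sub>R c"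
      using tendsto_scaleR[OF l2 tendsto_const[of c]] ab by simp
    then have 1: "(\<integral>x. indicator {a<..<b} x *\<^sub>R h x \<partial>lborel) = (b - a) *\<^sub>R c"
      using l1 LIMSEQ_unique by (simp add: key)
    have "(LINT x:{a..b}|lborel. h x) = (\<integral>x. indicator {a<..<b} x *\<^sub>R h x \<partial>lborel)"
      unfolding set_lebesgue_integral_def
    proof (rule integral_cong_AE)
      have "AE x in lborel. x \<noteq> a" "AE x in lborel. x \<noteq> b" by (rule AE_lborel_singleton)+
      then show "AE x in lborel. indicator {a..b} x *\<^sub>R h x = indicator {a<..<b} x *\<^sub>R h x"
        by eventually_elim (auto simp: indicator_def)
      show "(\<lambda>x. indicator {a<..<b} x *\<^sub>R h x) \<in> borel_measurable lborel" unfolding ind by measurable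
    qed measurable
    moreover have "(LINT x:{a..b}|lborel. c) = (b - a) *\<^sub>R c"
      using ab by (simp add: set_lebesgue_integral_def)
    ultimately show "(LINT x:{a..b}|lborel. h x - c) = 0"
      using set_integral_diff(2)[OF loc_int_D[OF h] loc_int_D[OF lc]] 1 by simp
  qed
  then show ?thesis by (intro exI[of _ c]) simp
qed

text \<open>The function and any primitive of its weak derivative differ by a function with weak derivative zero.\<close>
lemma has_weak_deriv_ac_primitive:
  assumes f: "loc_int f" and g: "loc_int g" and wd: "has_weak_deriv f g"
  shows "\<exists>F. ac_primitive F g \<and> (AE x in lborel. f x = F x)"
proof -
  obtain F where F: "ac_primitive F g" using ac_primitive_exists[OF g] by blast
  have lF: "loc_int F" by (intro loc_int_continuous ac_primitive_continuous[OF F])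
  have "\<exists>c. AE x in lborel. f x - F x = c"
  proof (rule constant_of_zero_weak_deriv)
    show "loc_int (\<lambda>x. f x - F x)" by (rule loc_int_diff[OF f lF])
    fix \<phi> assume \<phi>: "test_function \<phi>"
    note \<phi>' = test_function_props[OF \<phi>]
    obtain r where r: "\<And>x. \<bar>x\<bar> \<ge> r \<Longrightarrow> deriv \<phi> x = 0" using \<phi>'(4) by blast
    have "(\<integral>x. deriv \<phi> x *\<^sub>R (f x - F x) \<partial>lborel)
        = (\<integral>x. deriv \<phi> x *\<^sub>R f x \<partial>lborel) - (\<integral>x. deriv \<phi> x *\<^sub>R F x \<partial>lborel)"
      unfolding scaleR_diff_right
      by (intro Bochner_Integration.integral_diff integrable_cutoff_mult[OF \<phi>'(3) r] f lF)
    then show "(\<integral>x. deriv \<phi> x *\<^sub>R (f x - F x) \<partial>lborel) = 0"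
      using wd ac_primitive_has_weak_deriv[OF F] \<phi> by (simp add: has_weak_deriv_def)
  qed
  then obtain c where c: "AE x in lborel. f x - F x = c" by blast
  have "ac_primitive (\<lambda>x. F x + c) g" using F by (simp add: ac_primitive_def)
  moreover have "AE x in lborel. f x = F x + c" using c by eventually_elim (simp add: algebra_simps)
  ultimately show ?thesis by blast
qed

lemma L2_D: "f \<in> L2 \<Longrightarrow> f \<in> borel_measurable borel" "f \<in> L2 \<Longrightarrow> integrable lborel (\<lambda>x. (cmod (f x))\<^sup>2)"
  by (auto simp: L2_def)

lemma L2_bound:
  assumes f: "f \<in> borel_measurable borel" and g: "integrable lborel g"
    and le: "AE x in lborel. (cmod (f x))\<^sup>2 \<le> g x"
  shows "f \<in> L2"
  unfolding L2_def
proof (intro CollectI conjI)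
  show "integrable lborel (\<lambda>x. (cmod (f x))\<^sup>2)"
    by (rule Bochner_Integration.integrable_bound[OF g]) (use f le in auto)
qed (use f in simp)

lemma L2_loc_int: "f \<in> L2 \<Longrightarrow> loc_int f"
  unfolding loc_int_def set_integrable_def
proof (intro allI)
  fix a b :: real assume f: "f \<in> L2"
  note [measurable] = L2_D(1)[OF f]
  show "integrable lborel (\<lambda>x. indicator {a..b} x *\<^sub>R f x)"
  proof (rule Bochner_Integration.integrable_bound)
    show "integrable lborel (\<lambda>x. indicator {a..b} x + (cmod (f x))\<^sup>2)"
      by (intro Bochner_Integration.integrable_add L2_D(2)[OF f] integrable_real_indicator)
        (auto simp: emeasure_lborel_Icc_eq)
    show "AE x in lborel. norm (indicator {a..b} x *\<^sub>R f x) \<le> norm (indicator {a..b} x + (cmod (f x))\<^sup>2)"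
    proof (rule AE_I2)
      fix x
      have "0 \<le> (cmod (f x) - 1)\<^sup>2" by simp
      then have "cmod (f x) \<le> 1 + (cmod (f x))\<^sup>2"
        by (simp add: power2_diff) (smt (verit) norm_ge_zero)
      then show "norm (indicator {a..b} x *\<^sub>R f x) \<le> norm (indicator {a..b} x + (cmod (f x))\<^sup>2)"
        by (auto simp: indicator_def)
    qed
  qed measurable
qed

lemma L2_add: assumes "f \<in> L2" "g \<in> L2" shows "(\<lambda>x. f x + g x) \<in> L2"
proof (rule L2_bound)
  show "(\<lambda>x. f x + g x) \<in> borel_measurable borel" using assms[THEN L2_D(1)] by measurable
  show "integrable lborel (\<lambda>x. 2 * (cmod (f x))\<^sup>2 + 2 * (cmod (g x))\<^sup>2)" using assms[THEN L2_D(2)] by simp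
  show "AE x in lborel. (cmod (f x + g x))\<^sup>2 \<le> 2 * (cmod (f x))\<^sup>2 + 2 * (cmod (g x))\<^sup>2"
  proof (rule AE_I2)
    fix x
    have "(cmod (f x + g x))\<^sup>2 \<le> (cmod (f x) + cmod (g x))\<^sup>2" by (intro power_mono norm_triangle_ineq) auto
    also have "\<dots> \<le> 2 * (cmod (f x))\<^sup>2 + 2 * (cmod (g x))\<^sup>2" using sum_squares_bound[of "cmod (f x)" "cmod (g x)"] by (simp add: power2_sum)
    finally show "(cmod (f x + g x))\<^sup>2 \<le> 2 * (cmod (f x))\<^sup>2 + 2 * (cmod (g x))\<^sup>2" .
  qed
qed

lemma L2_cmult: assumes "f \<in> L2" shows "(\<lambda>x. c * f x) \<in> L2"
  using assms by (auto simp: L2_def norm_mult power_mult_distrib)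

lemma L2_cnj: assumes "f \<in> L2" shows "(\<lambda>x. cnj (f x)) \<in> L2"
  using assms unfolding L2_def by (auto intro: borel_measurable_continuous_on[OF continuous_on_cnj[OF continuous_on_id]])

lemma L2_zero: "(\<lambda>x. 0) \<in> L2" by (simp add: L2_def)

lemma L2_diff: assumes "f \<in> L2" "g \<in> L2" shows "(\<lambda>x. f x - g x) \<in> L2"
  using L2_add[OF assms(1) L2_cmult[OF assms(2), of "-1"]] by simp

lemma L2_bounded_mult:
  assumes f: "f \<in> L2" and F: "F \<in> borel_measurable borel" "\<And>x. cmod (F x) \<le> B"
  shows "(\<lambda>x. F x * f x) \<in> L2" "L2_norm (\<lambda>x. F x * f x) \<le> B * L2_norm f"
proof -
  note [measurable] = L2_D(1)[OF f] F(1)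
  have B: "B \<ge> 0" using F(2)[of 0] norm_ge_zero order_trans by blast
  have le: "(cmod (F x * f x))\<^sup>2 \<le> B\<^sup>2 * (cmod (f x))\<^sup>2" for x
    unfolding norm_mult power_mult_distrib using F(2) B by (intro mult_right_mono power_mono) auto
  have i: "integrable lborel (\<lambda>x. B\<^sup>2 * (cmod (f x))\<^sup>2)" using L2_D(2)[OF f] by simp
  show m: "(\<lambda>x. F x * f x) \<in> L2" by (rule L2_bound[OF _ i]) (use le in auto)
  have "(\<integral>x. (cmod (F x * f x))\<^sup>2 \<partial>lborel) \<le> (\<integral>x. B\<^sup>2 * (cmod (f x))\<^sup>2 \<partial>lborel)"
    by (rule integral_mono[OF L2_D(2)[OF m] i le])
  then have "L2_norm (\<lambda>x. F x * f x) \<le> sqrt (B\<^sup>2 * (\<integral>x. (cmod (f x))\<^sup>2 \<partial>lborel))"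
    unfolding L2_norm_def by simp
  then show "L2_norm (\<lambda>x. F x * f x) \<le> B * L2_norm f" using B by (simp add: real_sqrt_mult L2_norm_def)
qed

lemma L2_norm_nonneg: "0 \<le> L2_norm f"
  by (simp add: L2_norm_def)

lemma L2_norm_sq: "(L2_norm f)\<^sup>2 = (\<integral>x. (cmod (f x))\<^sup>2 \<partial>lborel)"
  unfolding L2_norm_def by (intro real_sqrt_pow2 integral_nonneg_AE) auto

lemma L2_mult_integrable:
  assumes "f \<in> L2" "g \<in> L2"
  shows "integrable lborel (\<lambda>x. f x * g x)" "(\<integral>x. cmod (f x) * cmod (g x) \<partial>lborel) \<le> L2_norm f * L2_norm g"
    "cmod (\<integral>x. f x * g x \<partial>lborel) \<le> L2_norm f * L2_norm g"
proof -
  note [measurable] = assms[THEN L2_D(1)]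
  show i: "integrable lborel (\<lambda>x. f x * g x)"
  proof (rule Bochner_Integration.integrable_bound)
    show "integrable lborel (\<lambda>x. (cmod (f x))\<^sup>2 + (cmod (g x))\<^sup>2)" using assms[THEN L2_D(2)] by simp
    show "AE x in lborel. norm (f x * g x) \<le> norm ((cmod (f x))\<^sup>2 + (cmod (g x))\<^sup>2)"
    proof (rule AE_I2)
      fix x
      have "0 \<le> cmod (f x) * cmod (g x)" by simp
      moreover have "2 * (cmod (f x) * cmod (g x)) \<le> (cmod (f x))\<^sup>2 + (cmod (g x))\<^sup>2"
        using sum_squares_bound[of "cmod (f x)" "cmod (g x)"] by (simp add: mult.assoc)
      ultimately have "cmod (f x) * cmod (g x) \<le> (cmod (f x))\<^sup>2 + (cmod (g x))\<^sup>2" by linarith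
      then show "norm (f x * g x) \<le> norm ((cmod (f x))\<^sup>2 + (cmod (g x))\<^sup>2)"
        by (simp add: norm_mult)
    qed
  qed measurable
  define J where "J = (\<integral>x. cmod (f x) * cmod (g x) \<partial>lborel)"
  have J0: "J \<ge> 0" unfolding J_def by (intro integral_nonneg_AE) auto
  have "ennreal (J\<^sup>2) = (\<integral>\<^sup>+ x. ennreal (cmod (f x)) * ennreal (cmod (g x)) \<partial>lborel)\<^sup>2"
  proof -
    have "(\<integral>\<^sup>+ x. ennreal (cmod (f x)) * ennreal (cmod (g x)) \<partial>lborel) = ennreal J"
      unfolding J_def using integrable_norm[OF i]
      by (subst nn_integral_eq_integral[symmetric]) (auto simp: norm_mult ennreal_mult)
    then show ?thesis using J0 by (simp add: ennreal_power)
  qed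
  also have "\<dots> \<le> (\<integral>\<^sup>+ x. (ennreal (cmod (f x)))\<^sup>2 \<partial>lborel) * (\<integral>\<^sup>+ x. (ennreal (cmod (g x)))\<^sup>2 \<partial>lborel)"
    by (rule Cauchy_Schwarz_nn_integral) measurable
  also have "\<dots> = ennreal ((L2_norm f)\<^sup>2 * (L2_norm g)\<^sup>2)"
    using assms[THEN L2_D(2)] by (simp add: L2_norm_sq ennreal_power nn_integral_eq_integral ennreal_mult)
  finally have "J\<^sup>2 \<le> (L2_norm f * L2_norm g)\<^sup>2"
    by (subst (asm) ennreal_le_iff) (simp_all add: power_mult_distrib)
  then show J: "J \<le> L2_norm f * L2_norm g"
    by (rule power2_le_imp_le) (simp add: L2_norm_nonneg)
  have "cmod (\<integral>x. f x * g x \<partial>lborel) \<le> (\<integral>x. cmod (f x * g x) \<partial>lborel)" by (rule integral_norm_bound)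
  then show "cmod (\<integral>x. f x * g x \<partial>lborel) \<le> L2_norm f * L2_norm g"
    using J by (simp add: J_def norm_mult)
qed

text \<open>The square \<open>F\<^sup>2\<close> has derivative \<open>2 F g\<close>, so \<open>\<bar>F x\<bar>\<^sup>2 \<le> \<bar>F y\<bar>\<^sup>2 + 2 \<parallel>F\<parallel> \<parallel>g\<parallel>\<close>; average over \<open>y\<close> in
  \<open>[x, x + 1]\<close>.\<close>
lemma sup_bound:
  assumes F: "ac_primitive F g" "F \<in> L2" and g: "g \<in> L2"
  shows "(cmod (F x))\<^sup>2 \<le> L2_norm F * (L2_norm F + 2 * L2_norm g)"
proof -
  define c where "c = 2 * (L2_norm F * L2_norm g)"
  note [measurable] = L2_D(1)[OF F(2)] L2_D(1)[OF g]
  have le: "(cmod (F x))\<^sup>2 \<le> (cmod (F y))\<^sup>2 + c" if "x \<le> y" for y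
  proof -
    have "F y * F y - F x * F x = (LINT z:{x..y}|lborel. g z * F z + F z * g z)"
      using ac_primitive_mult[OF F(1) F(1)] that by (simp add: ac_primitive_def)
    also have "cmod \<dots> \<le> (\<integral>z. cmod (indicator {x..y} z *\<^sub>R (g z * F z + F z * g z)) \<partial>lborel)"
      unfolding set_lebesgue_integral_def by (rule integral_norm_bound)
    also have "\<dots> \<le> (\<integral>z. 2 * (cmod (F z) * cmod (g z)) \<partial>lborel)"
    proof (rule integral_mono')
      show "integrable lborel (\<lambda>z. 2 * (cmod (F z) * cmod (g z)))"
        using integrable_norm[OF L2_mult_integrable(1)[OF F(2) g]] by (simp add: norm_mult)
      show "cmod (indicator {x..y} z *\<^sub>R (g z * F z + F z * g z)) \<le> 2 * (cmod (F z) * cmod (g z))" for z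
        by (simp add: indicator_def norm_mult mult.commute[of "g z"] flip: mult_2)
    qed simp
    also have "\<dots> \<le> c" unfolding c_def using L2_mult_integrable(2)[OF F(2) g] by simp
    finally have "cmod (F y * F y - F x * F x) \<le> c" .
    moreover have "cmod (F x * F x) \<le> cmod (F y * F y) + cmod (F y * F y - F x * F x)"
      by (metis norm_triangle_sub norm_minus_commute)
    ultimately show ?thesis by (simp add: norm_mult power2_eq_square)
  qed
  have "(cmod (F x))\<^sup>2 = (\<integral>y. indicator {x..x+1} y * (cmod (F x))\<^sup>2 \<partial>lborel)" by simp
  also have "\<dots> \<le> (\<integral>y. (cmod (F y))\<^sup>2 + indicator {x..x+1} y * c \<partial>lborel)"
  proof (rule integral_mono)
    show "integrable lborel (\<lambda>y. (cmod (F y))\<^sup>2 + indicator {x..x+1} y * c)" using L2_D(2)[OF F(2)] by simp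
    show "indicator {x..x+1} y * (cmod (F x))\<^sup>2 \<le> (cmod (F y))\<^sup>2 + indicator {x..x+1} y * c" for y
      using le[of y] by (auto simp: indicator_def)
  qed simp
  also have "\<dots> = (L2_norm F)\<^sup>2 + c" using L2_D(2)[OF F(2)] by (simp add: L2_norm_sq)
  finally show ?thesis by (simp add: c_def power2_eq_square algebra_simps)
qed

lemma L2_norm_cong_AE:
  assumes "f \<in> L2" "g \<in> borel_measurable borel" "AE x in lborel. f x = g x"
  shows "g \<in> L2" "L2_norm f = L2_norm g"
proof -
  note [measurable] = L2_D(1)[OF assms(1)] assms(2)
  have ae: "AE x in lborel. (cmod (f x))\<^sup>2 = (cmod (g x))\<^sup>2" using assms(3) by eventually_elim simp
  show "L2_norm f = L2_norm g" unfolding L2_norm_def by (rule arg_cong[OF integral_cong_AE]) (use ae in auto)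
  show "g \<in> L2" by (rule L2_bound[OF assms(2) L2_D(2)[OF assms(1)]]) (use ae in auto)
qed

text \<open>The Riesz-Fischer theorem. Along a subsequence with \<open>\<parallel>D k\<parallel> \<le> 4\<^sup>-\<^sup>k\<close> for the consecutive differences
  \<open>D k\<close>, the sum of \<open>4\<^sup>k \<bar>D k x\<bar>\<^sup>2\<close> has a finite integral; so almost everywhere \<open>\<bar>D k x\<bar>\<close> is at most a constant times
  \<open>2\<^sup>-\<^sup>k\<close>, and the subsequence converges. Fatou's lemma identifies the limit in the norm.\<close>
lemma L2_complete:
  assumes F: "\<And>n. F n \<in> L2" and C: "\<And>e. e > 0 \<Longrightarrow> \<exists>N. \<forall>m\<ge>N. \<forall>n\<ge>N. L2_norm (\<lambda>x. F m x - F n x) < e"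
  shows "\<exists>f\<in>L2. (\<lambda>n. L2_norm (\<lambda>x. F n x - f x)) \<longlonglongrightarrow> 0"
proof -
  note [measurable] = L2_D(1)[OF F]
  have "\<exists>N. \<forall>m\<ge>N. \<forall>n\<ge>N. L2_norm (\<lambda>x. F m x - F n x) < (1/4) ^ k" for k :: nat by (intro C) simp
  then obtain N where N: "\<And>k m n. m \<ge> N k \<Longrightarrow> n \<ge> N k \<Longrightarrow> L2_norm (\<lambda>x. F m x - F n x) < (1/4) ^ k" by metis
  define r where "r k = (\<Sum>i\<le>k. N i) + k" for k
  have rN: "N k \<le> r k" for k unfolding r_def by (simp add: member_le_sum trans_le_add1)
  have rmono: "strict_mono r" by (simp add: strict_mono_Suc_iff r_def)
  define D where "D k x = F (r (Suc k)) x - F (r k) x" for k x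
  have DL2: "D k \<in> L2" for k unfolding D_def by (intro L2_diff F)
  have Dn: "(\<integral>x. (cmod (D k x))\<^sup>2 \<partial>lborel) \<le> (1/16) ^ k" for k
  proof -
    have "N k \<le> r (Suc k)" using rN[of k] strict_mono_less_eq[OF rmono, of k "Suc k"] by simp
    then have "L2_norm (D k) \<le> (1/4) ^ k" unfolding D_def using N[of k] rN[of k] less_imp_le by blast
    then have "(L2_norm (D k))\<^sup>2 \<le> ((1/4) ^ k)\<^sup>2" by (intro power_mono) (auto simp: L2_norm_nonneg)
    also have "((1/4 :: real) ^ k)\<^sup>2 = (1/16) ^ k" by (simp add: power2_eq_square flip: power_mult_distrib)
    finally show ?thesis by (simp add: L2_norm_sq)
  qed
  have "AE x in lborel. (\<Sum>k. ennreal (4 ^ k * (cmod (D k x))\<^sup>2)) \<noteq> \<infinity>"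
  proof (rule nn_integral_PInf_AE)
    show "(\<lambda>x. \<Sum>k. ennreal (4 ^ k * (cmod (D k x))\<^sup>2)) \<in> borel_measurable lborel"
      unfolding D_def by measurable
    have "(\<integral>\<^sup>+ x. (\<Sum>k. ennreal (4 ^ k * (cmod (D k x))\<^sup>2)) \<partial>lborel)
        = (\<Sum>k. \<integral>\<^sup>+ x. ennreal (4 ^ k * (cmod (D k x))\<^sup>2) \<partial>lborel)"
      unfolding D_def by (rule nn_integral_suminf) measurable
    also have "\<dots> \<le> (\<Sum>k. ennreal ((1/4) ^ k))"
    proof (rule suminf_le)
      fix k
      have "(\<integral>\<^sup>+ x. ennreal (4 ^ k * (cmod (D k x))\<^sup>2) \<partial>lborel) = ennreal (4 ^ k * (\<integral>x. (cmod (D k x))\<^sup>2 \<partial>lborel))"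
        using L2_D(2)[OF DL2[of k]] by (subst nn_integral_eq_integral) auto
      also have "\<dots> \<le> ennreal (4 ^ k * (1/16) ^ k)" using Dn[of k] by (intro ennreal_leI mult_left_mono) auto
      also have "4 ^ k * (1/16) ^ k = ((1/4) ^ k :: real)" by (simp flip: power_mult_distrib)
      finally show "(\<integral>\<^sup>+ x. ennreal (4 ^ k * (cmod (D k x))\<^sup>2) \<partial>lborel) \<le> ennreal ((1/4) ^ k)" .
    qed auto
    also have "\<dots> = ennreal (\<Sum>k. (1/4) ^ k)"
      by (intro suminf_ennreal2) (auto intro: summable_geometric)
    finally show "(\<integral>\<^sup>+ x. (\<Sum>k. ennreal (4 ^ k * (cmod (D k x))\<^sup>2)) \<partial>lborel) \<noteq> \<infinity>"
      by (auto simp: top_unique)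
  qed
  then have ae: "AE x in lborel. convergent (\<lambda>k. F (r k) x)"
  proof eventually_elim
    case (elim x)
    define S where "S = (\<Sum>k. ennreal (4 ^ k * (cmod (D k x))\<^sup>2))"
    define v where "v = enn2real S"
    have S: "S = ennreal v" using elim by (simp add: v_def S_def top.not_eq_extremum)
    have v0: "v \<ge> 0" by (simp add: v_def)
    have Dle: "cmod (D k x) \<le> sqrt v * (1/2) ^ k" for k
    proof -
      have "ennreal (4 ^ k * (cmod (D k x))\<^sup>2) \<le> S"
        unfolding S_def
        by (rule ccontr, drule not_le_imp_less, drule ennreal_suminf_lessD[where i = k]) simp
      then have "ennreal (4 ^ k * (cmod (D k x))\<^sup>2) \<le> ennreal v" using S by simp
      then have "4 ^ k * (cmod (D k x))\<^sup>2 \<le> v" using v0 by (simp add: ennreal_le_iff)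
      then have "sqrt (4 ^ k * (cmod (D k x))\<^sup>2) \<le> sqrt v" by simp
      moreover have "sqrt (4 ^ k * (cmod (D k x))\<^sup>2) = 2 ^ k * cmod (D k x)"
        by (simp add: real_sqrt_mult real_sqrt_power)
      ultimately have "2 ^ k * cmod (D k x) * (1/2) ^ k \<le> sqrt v * (1/2) ^ k"
        by (intro mult_right_mono) auto
      moreover have "2 ^ k * cmod (D k x) * (1/2) ^ k = cmod (D k x)" by (simp add: power_one_over)
      ultimately show ?thesis by simp
    qed
    have "summable (\<lambda>k. sqrt v * (1/2::real) ^ k)" by (intro summable_mult summable_geometric) simp
    then have "summable (\<lambda>k. D k x)" by (rule summable_comparison_test'[of _ 0]) (rule Dle)
    then have "convergent (\<lambda>n. \<Sum>k<n. D k x)" by (simp add: summable_iff_convergent)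
    moreover have "(\<Sum>k<n. D k x) = F (r n) x - F (r 0) x" for n
      unfolding D_def by (rule sum_lessThan_telescope)
    ultimately have "convergent (\<lambda>n. F (r n) x - F (r 0) x)" by simp
    from convergent_add[OF this convergent_const[of "F (r 0) x"]] show ?case by simp
  qed
  define f where "f x = lim (\<lambda>k. F (r k) x)" for x
  have fm[measurable]: "f \<in> borel_measurable borel" unfolding f_def by (rule borel_measurable_lim_metric) measurable
  have lim: "AE x in lborel. (\<lambda>k. F (r k) x) \<longlonglongrightarrow> f x"
    using ae by eventually_elim (simp add: f_def convergent_LIMSEQ_iff)
  have est: "(\<integral>\<^sup>+ x. ennreal ((cmod (F n x - f x))\<^sup>2) \<partial>lborel) \<le> ennreal (e\<^sup>2)"
    if e: "e > 0" "\<And>m. m \<ge> M \<Longrightarrow> L2_norm (\<lambda>x. F n x - F m x) < e" for n e M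
  proof -
    have "(\<integral>\<^sup>+ x. ennreal ((cmod (F n x - f x))\<^sup>2) \<partial>lborel)
        = (\<integral>\<^sup>+ x. liminf (\<lambda>k. ennreal ((cmod (F n x - F (r k) x))\<^sup>2)) \<partial>lborel)"
    proof (rule nn_integral_cong_AE)
      show "AE x in lborel. ennreal ((cmod (F n x - f x))\<^sup>2) = liminf (\<lambda>k. ennreal ((cmod (F n x - F (r k) x))\<^sup>2))"
        using lim
      proof eventually_elim
        case (elim x)
        then have "(\<lambda>k. ennreal ((cmod (F n x - F (r k) x))\<^sup>2)) \<longlonglongrightarrow> ennreal ((cmod (F n x - f x))\<^sup>2)"
          by (intro tendsto_intros tendsto_ennrealI)
        then show ?case by (intro lim_imp_Liminf[symmetric]) auto
      qed
    qed
    also have "\<dots> \<le> liminf (\<lambda>k. \<integral>\<^sup>+ x. ennreal ((cmod (F n x - F (r k) x))\<^sup>2) \<partial>lborel)"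
      by (rule nn_integral_liminf) measurable
    also have "\<dots> \<le> limsup (\<lambda>k. \<integral>\<^sup>+ x. ennreal ((cmod (F n x - F (r k) x))\<^sup>2) \<partial>lborel)"
      by (rule Liminf_le_Limsup) simp
    also have "\<dots> \<le> ennreal (e\<^sup>2)"
    proof (rule Limsup_bounded)
      have "(\<integral>\<^sup>+ x. ennreal ((cmod (F n x - F (r k) x))\<^sup>2) \<partial>lborel) \<le> ennreal (e\<^sup>2)" if "k \<ge> M" for k
      proof -
        have "r k \<ge> M" using that seq_suble[OF rmono, of k] by simp
        then have "(L2_norm (\<lambda>x. F n x - F (r k) x))\<^sup>2 \<le> e\<^sup>2"
          using e(2)[of "r k"] by (intro power_mono) (auto simp: L2_norm_nonneg)
        then show ?thesis
          using L2_D(2)[OF L2_diff[OF F F]] by (subst nn_integral_eq_integral) (auto simp: L2_norm_sq)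
      qed
      then show "\<forall>\<^sub>F k in sequentially. (\<integral>\<^sup>+ x. ennreal ((cmod (F n x - F (r k) x))\<^sup>2) \<partial>lborel) \<le> ennreal (e\<^sup>2)"
        unfolding eventually_sequentially by blast
    qed
    finally show ?thesis .
  qed
  have dL2: "(\<lambda>x. F n x - f x) \<in> L2 \<and> L2_norm (\<lambda>x. F n x - f x) \<le> e"
    if e: "e > 0" "\<And>m. m \<ge> M \<Longrightarrow> L2_norm (\<lambda>x. F n x - F m x) < e" for n e M
  proof -
    have le: "(\<integral>\<^sup>+ x. ennreal ((cmod (F n x - f x))\<^sup>2) \<partial>lborel) \<le> ennreal (e\<^sup>2)"
      by (rule est[OF e])
    have i: "integrable lborel (\<lambda>x. (cmod (F n x - f x))\<^sup>2)"
      by (rule integrableI_bounded) (use le_less_trans[OF le ennreal_less_top] in simp_all)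
    have "ennreal (\<integral>x. (cmod (F n x - f x))\<^sup>2 \<partial>lborel) \<le> ennreal (e\<^sup>2)"
      using le by (subst (asm) nn_integral_eq_integral[OF i]) auto
    then have "(L2_norm (\<lambda>x. F n x - f x))\<^sup>2 \<le> e\<^sup>2" by (simp add: L2_norm_sq)
    then have "L2_norm (\<lambda>x. F n x - f x) \<le> e" by (rule power2_le_imp_le) (use e in simp)
    then show ?thesis using i by (simp add: L2_def)
  qed
  obtain M where M: "\<And>m n. m \<ge> M \<Longrightarrow> n \<ge> M \<Longrightarrow> L2_norm (\<lambda>x. F m x - F n x) < 1" using C[of 1] by auto
  have "(\<lambda>x. F M x - f x) \<in> L2" using dL2[of 1 M M] M by auto
  from L2_diff[OF F[of M] this] have "f \<in> L2" by simp
  moreover have "(\<lambda>n. L2_norm (\<lambda>x. F n x - f x)) \<longlonglongrightarrow> 0"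
  proof (rule LIMSEQ_I)
    fix e :: real assume e: "e > 0"
    obtain M where M: "\<And>m n. m \<ge> M \<Longrightarrow> n \<ge> M \<Longrightarrow> L2_norm (\<lambda>x. F m x - F n x) < e / 2" using C[of "e/2"] e by auto
    have "norm (L2_norm (\<lambda>x. F n x - f x) - 0) < e" if "n \<ge> M" for n
      using dL2[of "e/2" M n] M that e by (auto simp: L2_norm_nonneg)
    then show "\<exists>M. \<forall>n\<ge>M. norm (L2_norm (\<lambda>x. F n x - f x) - 0) < e" by blast
  qed
  ultimately show ?thesis by blast
qed

section \<open>The Hilbert space \<open>H\<^sup>1\<close>\<close>

definition L2_inner :: "(real \<Rightarrow> complex) \<Rightarrow> (real \<Rightarrow> complex) \<Rightarrow> real" where
  "L2_inner f g = Re (\<integral>x. f x * cnj (g x) \<partial>lborel)"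

lemma L2_inner_integrable: "f \<in> L2 \<Longrightarrow> g \<in> L2 \<Longrightarrow> integrable lborel (\<lambda>x. f x * cnj (g x))"
  by (intro L2_mult_integrable(1) L2_cnj)

lemma L2_norm_cnj [simp]: "L2_norm (\<lambda>x. cnj (f x)) = L2_norm f"
  by (simp add: L2_norm_def)

lemma L2_inner_bound: "f \<in> L2 \<Longrightarrow> g \<in> L2 \<Longrightarrow> \<bar>L2_inner f g\<bar> \<le> L2_norm f * L2_norm g"
  unfolding L2_inner_def using L2_mult_integrable(3)[OF _ L2_cnj, of f g]
    abs_Re_le_cmod[of "\<integral>x. f x * cnj (g x) \<partial>lborel"] by simp

lemma L2_inner_self: "f \<in> L2 \<Longrightarrow> L2_inner f f = (L2_norm f)\<^sup>2"
proof -
  assume "f \<in> L2"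
  have "(\<integral>x. f x * cnj (f x) \<partial>lborel) = (\<integral>x. complex_of_real ((cmod (f x))\<^sup>2) \<partial>lborel)"
    by (simp only: complex_norm_square)
  then show ?thesis unfolding L2_inner_def L2_norm_sq by (simp del: of_real_power)
qed

lemma L2_inner_commute: "L2_inner f g = L2_inner g f"
proof -
  have "(\<integral>x. g x * cnj (f x) \<partial>lborel) = (\<integral>x. cnj (f x * cnj (g x)) \<partial>lborel)"
    by (simp add: mult.commute)
  also have "\<dots> = cnj (\<integral>x. f x * cnj (g x) \<partial>lborel)" by (rule Bochner_Integration.integral_cnj)
  finally show ?thesis by (simp add: L2_inner_def)
qed

lemma L2_inner_add_left:
  "f \<in> L2 \<Longrightarrow> g \<in> L2 \<Longrightarrow> h \<in> L2 \<Longrightarrow> L2_inner (\<lambda>x. f x + g x) h = L2_inner f h + L2_inner g h"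
  by (simp add: L2_inner_def distrib_right Bochner_Integration.integral_add L2_inner_integrable)

lemma L2_inner_scaleR_left: "L2_inner (\<lambda>x. r *\<^sub>R f x) h = r * L2_inner f h"
  by (simp add: L2_inner_def)

lemma L2_inner_cong_AE:
  assumes "f \<in> L2" "f' \<in> L2" "g \<in> L2" "g' \<in> L2"
    and "AE x in lborel. f x = f' x" "AE x in lborel. g x = g' x"
  shows "L2_inner f g = L2_inner f' g'"
proof -
  note [measurable] = borel_measurable_integrable[OF L2_inner_integrable]
  have "(\<integral>x. f x * cnj (g x) \<partial>lborel) = (\<integral>x. f' x * cnj (g' x) \<partial>lborel)"
  proof (rule integral_cong_AE)
    show "AE x in lborel. f x * cnj (g x) = f' x * cnj (g' x)"
      using assms(5,6) by eventually_elim simp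
  qed (intro borel_measurable_integrable L2_inner_integrable assms)+
  then show ?thesis by (simp add: L2_inner_def)
qed

lemma L2_norm_triangle:
  assumes "f \<in> L2" "g \<in> L2"
  shows "L2_norm (\<lambda>x. f x + g x) \<le> L2_norm f + L2_norm g"
proof (rule power2_le_imp_le)
  have "(L2_norm (\<lambda>x. f x + g x))\<^sup>2 = L2_inner (\<lambda>x. f x + g x) (\<lambda>x. f x + g x)"
    by (simp add: L2_inner_self L2_add assms)
  also have "\<dots> = L2_inner f f + 2 * L2_inner f g + L2_inner g g"
  proof -
    have 1: "L2_inner (\<lambda>x. f x + g x) h = L2_inner f h + L2_inner g h" if "h \<in> L2" for h
      by (rule L2_inner_add_left[OF assms that])
    have 2: "L2_inner h (\<lambda>x. f x + g x) = L2_inner f h + L2_inner g h" if "h \<in> L2" for h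
      by (subst L2_inner_commute) (rule 1[OF that])
    show ?thesis
      unfolding 1[OF L2_add[OF assms]] 2[OF assms(1)] 2[OF assms(2)]
      using L2_inner_commute[of f g] by simp
  qed
  also have "\<dots> \<le> (L2_norm f)\<^sup>2 + 2 * (L2_norm f * L2_norm g) + (L2_norm g)\<^sup>2"
    using L2_inner_bound[OF assms] by (simp add: L2_inner_self assms)
  finally show "(L2_norm (\<lambda>x. f x + g x))\<^sup>2 \<le> (L2_norm f + L2_norm g)\<^sup>2" by (simp add: power2_sum)
qed (simp add: L2_norm_nonneg)

text \<open>Nonempty open sets are not negligible.\<close>
lemma continuous_AE_eq:
  fixes f g :: "real \<Rightarrow> complex"
  assumes f: "continuous_on UNIV f" and g: "continuous_on UNIV g" and ae: "AE x in lborel. f x = g x"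
  shows "f = g"
proof (rule ccontr)
  assume "f \<noteq> g"
  define S where "S = {x. f x \<noteq> g x}"
  have "open S" unfolding S_def by (intro open_Collect_neq f g)
  moreover have "S \<noteq> {}" using \<open>f \<noteq> g\<close> by (auto simp: S_def)
  moreover have "negligible S"
  proof -
    have "S \<in> sets lborel" using \<open>open S\<close> by simp
    moreover have "AE x in lborel. x \<notin> S" using ae by eventually_elim (simp add: S_def)
    ultimately have "S \<in> null_sets lborel" by (simp add: AE_iff_null_sets)
    then show ?thesis by (simp add: negligible_iff_null_sets null_sets_completionI)
  qed
  ultimately show False using open_not_negligible by blast
qed

lemma H1_continuous_representative:
  assumes "f \<in> H1"
  shows "weak_deriv f \<in> L2" "\<exists>F. ac_primitive F (weak_deriv f) \<and> (AE x in lborel. f x = F x)"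
proof -
  have f: "f \<in> L2" "\<exists>g. g \<in> L2 \<and> has_weak_deriv f g" using assms by (auto simp: H1_def)
  from someI_ex[OF f(2)] show w: "weak_deriv f \<in> L2" by (simp add: weak_deriv_def)
  from someI_ex[OF f(2)] have "has_weak_deriv f (weak_deriv f)" by (simp add: weak_deriv_def)
  then show "\<exists>F. ac_primitive F (weak_deriv f) \<and> (AE x in lborel. f x = F x)"
    by (intro has_weak_deriv_ac_primitive L2_loc_int f w)
qed

lemma ac_primitive_H1: "F \<in> L2 \<Longrightarrow> g \<in> L2 \<Longrightarrow> ac_primitive F g \<Longrightarrow> F \<in> H1"
  by (auto simp: H1_def intro: ac_primitive_has_weak_deriv)

lemma ac_primitive_zero: "ac_primitive (\<lambda>_. 0) (\<lambda>_. 0)"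
  by (simp add: ac_primitive_def loc_int_continuous set_lebesgue_integral_def)

text \<open>Every class in \<open>H\<^sup>1\<close> has exactly one continuous member, so this type is \<open>H\<^sup>1\<close> itself and its algebraic
  operations are pointwise.\<close>
typedef h1 = "{F \<in> H1. continuous_on UNIV F}"
  morphisms fn Abs_h1
proof
  have "(\<lambda>_. 0) \<in> H1"
    by (rule ac_primitive_H1[OF L2_zero L2_zero]) (rule ac_primitive_zero)
  then show "(\<lambda>_. 0) \<in> {F \<in> H1. continuous_on UNIV F}" by simp
qed

text \<open>Only determined almost everywhere, so the rules for derivatives below hold almost everywhere, while
  those for \<open>fn\<close> hold at every point.\<close>
definition dr :: "h1 \<Rightarrow> real \<Rightarrow> complex" where
  "dr F = weak_deriv (fn F)"

lemma fn_continuous: "continuous_on S (fn F)"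
  using fn[of F] by (auto intro: continuous_on_subset)

lemma fn_H1: "fn F \<in> H1"
  using fn[of F] by simp

lemma fn_L2: "fn F \<in> L2"
  using fn_H1[of F] by (simp add: H1_def)

lemma dr_L2: "dr F \<in> L2"
  unfolding dr_def by (rule H1_continuous_representative(1)[OF fn_H1])

lemma ac_fn: "ac_primitive (fn F) (dr F)"
proof -
  obtain G where G: "ac_primitive G (dr F)" "AE x in lborel. fn F x = G x"
    using H1_continuous_representative(2)[OF fn_H1, of F] by (auto simp: dr_def)
  have "fn F = G" by (rule continuous_AE_eq[OF fn_continuous ac_primitive_continuous[OF G(1)] G(2)])
  then show ?thesis using G(1) by simp
qed

text \<open>The way to introduce elements of the type: exhibit a function in \<open>L\<^sup>2\<close> and a derivative in \<open>L\<^sup>2\<close>.\<close>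
lemma Abs_h1:
  assumes "F \<in> L2" "g \<in> L2" "ac_primitive F g"
  shows "fn (Abs_h1 F) = F" "AE x in lborel. dr (Abs_h1 F) x = g x"
proof -
  show 1: "fn (Abs_h1 F) = F"
    using assms by (intro Abs_h1_inverse) (auto intro: ac_primitive_H1 ac_primitive_continuous)
  show "AE x in lborel. dr (Abs_h1 F) x = g x"
    using ac_primitive_unique[OF ac_fn[of "Abs_h1 F"]] assms(3) by (simp add: 1)
qed

lemma h1_eqI: "(\<And>x. fn F x = fn G x) \<Longrightarrow> F = G"
  by (simp add: fn_inject[symmetric] fun_eq_iff)

lemma ac_primitive_add: "ac_primitive F f \<Longrightarrow> ac_primitive G g \<Longrightarrow> ac_primitive (\<lambda>x. F x + G x) (\<lambda>x. f x + g x)"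
  by (auto simp: ac_primitive_def loc_int_def) (simp add: set_integral_add(2) add_diff_add)

lemma ac_primitive_cmult: "ac_primitive F f \<Longrightarrow> ac_primitive (\<lambda>x. c * F x) (\<lambda>x. c * f x)"
  by (auto simp: ac_primitive_def loc_int_def simp flip: right_diff_distrib)

lemma ac_primitive_cnj:
  assumes "ac_primitive F f" shows "ac_primitive (\<lambda>x. cnj (F x)) (\<lambda>x. cnj (f x))"
proof -
  have e: "indicator S x *\<^sub>R cnj z = cnj (indicator S x *\<^sub>R z)" for S and x :: real and z
    by (simp add: scaleR_conv_of_real)
  have "cnj (F b) - cnj (F a) = (LINT x:{a..b}|lborel. cnj (f x))" if "a \<le> b" for a b
  proof -
    have "(LINT x:{a..b}|lborel. cnj (f x)) = cnj (LINT x:{a..b}|lborel. f x)"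
      unfolding set_lebesgue_integral_def e by (rule Bochner_Integration.integral_cnj)
    moreover have "F b - F a = (LINT x:{a..b}|lborel. f x)" using assms that by (simp add: ac_primitive_def)
    ultimately show ?thesis by (metis complex_cnj_diff)
  qed
  moreover have "loc_int (\<lambda>x. cnj (f x))"
    using assms unfolding ac_primitive_def loc_int_def set_integrable_def e
    by (simp only: complex_integrable_cnj simp_thms)
  ultimately show ?thesis by (simp add: ac_primitive_def)
qed

definition cscale :: "complex \<Rightarrow> h1 \<Rightarrow> h1" where
  "cscale c F = Abs_h1 (\<lambda>x. c * fn F x)"

lemma fn_cscale [simp]: "fn (cscale c F) x = c * fn F x"
  and dr_cscale: "AE x in lborel. dr (cscale c F) x = c * dr F x"
  unfolding cscale_def
  using Abs_h1[OF L2_cmult[OF fn_L2[of F]] L2_cmult[OF dr_L2[of F]] ac_primitive_cmult[OF ac_fn], of c]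
  by simp_all

definition hcnj :: "h1 \<Rightarrow> h1" where
  "hcnj F = Abs_h1 (\<lambda>x. cnj (fn F x))"

lemma fn_hcnj [simp]: "fn (hcnj F) x = cnj (fn F x)"
  and dr_hcnj: "AE x in lborel. dr (hcnj F) x = cnj (dr F x)"
  unfolding hcnj_def
  using Abs_h1[OF L2_cnj[OF fn_L2[of F]] L2_cnj[OF dr_L2[of F]] ac_primitive_cnj[OF ac_fn]]
  by simp_all

instantiation h1 :: real_vector
begin

definition zero_h1 :: h1 where "zero_h1 = Abs_h1 (\<lambda>_. 0)"
definition plus_h1 :: "h1 \<Rightarrow> h1 \<Rightarrow> h1" where "plus_h1 F G = Abs_h1 (\<lambda>x. fn F x + fn G x)"
definition scaleR_h1 :: "real \<Rightarrow> h1 \<Rightarrow> h1" where "scaleR_h1 r F = cscale (of_real r) F"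
definition uminus_h1 :: "h1 \<Rightarrow> h1" where "uminus_h1 F = cscale (-1) F"
definition minus_h1 :: "h1 \<Rightarrow> h1 \<Rightarrow> h1" where "minus_h1 F G = F + cscale (-1) G"
lemma fn_zero [simp]: "fn 0 x = 0"
  using Abs_h1(1)[OF L2_zero L2_zero ac_primitive_zero] by (simp add: zero_h1_def)

lemma fn_plus [simp]: "fn (F + G) x = fn F x + fn G x"
  and dr_plus: "AE x in lborel. dr (F + G) x = dr F x + dr G x"
  unfolding plus_h1_def
  using Abs_h1[OF L2_add[OF fn_L2 fn_L2] L2_add[OF dr_L2 dr_L2] ac_primitive_add[OF ac_fn ac_fn], of F G]
  by simp_all

lemma fn_scaleR [simp]: "fn (r *\<^sub>R F) x = of_real r * fn F x"
  by (simp add: scaleR_h1_def)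

lemma fn_uminus [simp]: "fn (- F) x = - fn F x"
  by (simp add: uminus_h1_def)

lemma fn_minus [simp]: "fn (F - G) x = fn F x - fn G x"
  by (simp add: minus_h1_def)

instance
proof
  fix F G H :: h1 and r s :: real
  show "F + G + H = F + (G + H)" "F + G = G + F" "0 + F = F" "- F + F = 0" "F - G = F + - G"
    "r *\<^sub>R (F + G) = r *\<^sub>R F + r *\<^sub>R G" "(r + s) *\<^sub>R F = r *\<^sub>R F + s *\<^sub>R F"
    "r *\<^sub>R s *\<^sub>R F = (r * s) *\<^sub>R F" "1 *\<^sub>R F = F"
    by (rule h1_eqI; simp add: algebra_simps)+
qed

end

instantiation h1 :: real_inner
begin

definition inner_h1 :: "h1 \<Rightarrow> h1 \<Rightarrow> real" where
  "inner_h1 F G = L2_inner (fn F) (fn G) + L2_inner (dr F) (dr G)"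
definition norm_h1 :: "h1 \<Rightarrow> real" where "norm_h1 F = sqrt (F \<bullet> F)"
definition dist_h1 :: "h1 \<Rightarrow> h1 \<Rightarrow> real" where "dist_h1 F G = norm (F - G)"
definition sgn_h1 :: "h1 \<Rightarrow> h1" where "sgn_h1 F = inverse (norm F) *\<^sub>R F"
definition uniformity_h1 :: "(h1 \<times> h1) filter" where
  "uniformity_h1 = (INF e\<in>{0 <..}. principal {(x, y). dist x y < e})"
definition open_h1 :: "h1 set \<Rightarrow> bool" where
  "open_h1 S = (\<forall>x\<in>S. \<forall>\<^sub>F (x', y) in uniformity. x' = x \<longrightarrow> y \<in> S)"

lemma inner_h1_self: "F \<bullet> F = (L2_norm (fn F))\<^sup>2 + (L2_norm (dr F))\<^sup>2" for F :: h1
  by (simp add: inner_h1_def L2_inner_self fn_L2 dr_L2)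

instance
proof
  fix F G H :: h1 and r s :: real
  show "dist F G = norm (F - G)" by (rule dist_h1_def)
  show "sgn F = F /\<^sub>R norm F" by (rule sgn_h1_def)
  show "uniformity = (INF e\<in>{0 <..}. principal {(x :: h1, y). dist x y < e})" by (rule uniformity_h1_def)
  show "open S = (\<forall>x\<in>S. \<forall>\<^sub>F (x', y) in uniformity. x' = x \<longrightarrow> y \<in> S)" for S :: "h1 set"
    by (rule open_h1_def)
  show "F \<bullet> G = G \<bullet> F" by (simp add: inner_h1_def L2_inner_commute)
  show "(F + G) \<bullet> H = F \<bullet> H + G \<bullet> H"
  proof -
    have "L2_inner (dr (F + G)) (dr H) = L2_inner (\<lambda>x. dr F x + dr G x) (dr H)"
      by (intro L2_inner_cong_AE dr_L2 L2_add dr_plus) simp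
    moreover have "fn (F + G) = (\<lambda>x. fn F x + fn G x)" by (simp add: fun_eq_iff)
    ultimately show ?thesis by (simp add: inner_h1_def L2_inner_add_left fn_L2 dr_L2)
  qed
  show "r *\<^sub>R F \<bullet> G = r * (F \<bullet> G)"
  proof -
    have "L2_inner (dr (r *\<^sub>R F)) (dr G) = L2_inner (\<lambda>x. of_real r * dr F x) (dr G)"
      unfolding scaleR_h1_def by (intro L2_inner_cong_AE dr_L2 L2_cmult dr_cscale) simp
    moreover have "fn (r *\<^sub>R F) = (\<lambda>x. of_real r * fn F x)" by (simp add: fun_eq_iff)
    ultimately show ?thesis
      by (simp add: inner_h1_def L2_inner_scaleR_left[unfolded scaleR_conv_of_real] distrib_left)
  qed
  show "0 \<le> F \<bullet> F" by (simp add: inner_h1_self)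
  show "(F \<bullet> F = 0) = (F = 0)"
  proof
    assume "F \<bullet> F = 0"
    then have "(L2_norm (fn F))\<^sup>2 = 0" using sum_power2_eq_zero_iff by (simp add: inner_h1_self)
    then have "(\<integral>x. (cmod (fn F x))\<^sup>2 \<partial>lborel) = 0" by (simp add: L2_norm_sq)
    then have "AE x in lborel. (cmod (fn F x))\<^sup>2 = 0"
      by (subst (asm) integral_nonneg_eq_0_iff_AE) (use L2_D(2)[OF fn_L2] in auto)
    then have "fn F = (\<lambda>_. 0)" by (intro continuous_AE_eq fn_continuous) auto
    then show "F = 0" by (intro h1_eqI) simp
  next
    assume "F = 0"
    have "L2_inner (dr (cscale 0 0)) (dr (0::h1)) = L2_inner (\<lambda>x. 0 * dr 0 x) (dr (0::h1))"
      by (intro L2_inner_cong_AE dr_L2 L2_cmult dr_cscale) simp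
    moreover have "cscale 0 0 = (0 :: h1)" by (rule h1_eqI) simp
    ultimately have "L2_inner (dr 0) (dr (0::h1)) = 0" by (simp add: L2_inner_def)
    moreover have "L2_inner (fn 0) (fn (0::h1)) = 0" by (simp add: L2_inner_def)
    ultimately show "F \<bullet> F = 0" using \<open>F = 0\<close> by (simp add: inner_h1_def)
  qed
  show "norm F = sqrt (F \<bullet> F)" by (rule norm_h1_def)
qed

end

lemma norm_h1_sq: "(norm F)\<^sup>2 = (L2_norm (fn F))\<^sup>2 + (L2_norm (dr F))\<^sup>2" for F :: h1
  by (simp add: power2_norm_eq_inner inner_h1_self)

lemma L2_norm_fn_le: "L2_norm (fn F) \<le> norm F" and L2_norm_dr_le: "L2_norm (dr F) \<le> norm F"
  by (rule power2_le_imp_le; simp add: norm_h1_sq)+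

lemma norm_h1_H1_norm: "norm F = H1_norm (fn F)" for F :: h1
  by (simp add: H1_norm_def norm_h1_def inner_h1_self dr_def)

lemma dr_minus: "AE x in lborel. dr (F - G) x = dr F x - dr G x"
proof -
  have "AE x in lborel. dr (F + cscale (-1) G) x = dr F x + dr (cscale (-1) G) x" by (rule dr_plus)
  moreover have "AE x in lborel. dr (cscale (-1) G) x = -1 * dr G x" by (rule dr_cscale)
  ultimately show ?thesis unfolding minus_h1_def by eventually_elim simp
qed

lemma L2_norm_fn_minus: "L2_norm (\<lambda>x. fn F x - fn G x) = L2_norm (fn (F - G))"
  by (rule arg_cong[where f = L2_norm]) (simp add: fun_eq_iff)

lemma L2_norm_dr_minus: "L2_norm (\<lambda>x. dr F x - dr G x) = L2_norm (dr (F - G))"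
  by (rule L2_norm_cong_AE(2)[symmetric, OF dr_L2 L2_D(1)[OF L2_diff[OF dr_L2 dr_L2]] dr_minus])

lemma of_real_L2:
  assumes \<psi>: "continuous_on UNIV \<psi>" "\<And>x. \<bar>x\<bar> \<ge> r \<Longrightarrow> \<psi> x = 0"
  shows "(\<lambda>x. complex_of_real (\<psi> x)) \<in> L2"
proof (rule L2_bound)
  have c: "continuous_on UNIV (\<lambda>x. complex_of_real (\<psi> x))" by (intro continuous_intros \<psi>)
  then show "(\<lambda>x. complex_of_real (\<psi> x)) \<in> borel_measurable borel" by (rule borel_measurable_continuous_onI)
  show "integrable lborel (\<lambda>x. norm (\<psi> x *\<^sub>R complex_of_real (\<psi> x)))"
    by (intro integrable_norm integrable_cutoff_mult[OF \<psi>] loc_int_continuous c)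
qed (simp add: power2_eq_square abs_mult)

text \<open>Weak differentiation is closed in \<open>L\<^sup>2\<close>, since test functions lie in \<open>L\<^sup>2\<close>. This makes \<open>H\<^sup>1\<close> complete.\<close>
lemma has_weak_deriv_L2_limit:
  assumes F: "\<And>n. F n \<in> L2" "\<And>n. G n \<in> L2" "\<And>n. has_weak_deriv (F n) (G n)"
    and f: "f \<in> L2" "(\<lambda>n. L2_norm (\<lambda>x. F n x - f x)) \<longlonglongrightarrow> 0"
    and g: "g \<in> L2" "(\<lambda>n. L2_norm (\<lambda>x. G n x - g x)) \<longlonglongrightarrow> 0"
  shows "has_weak_deriv f g"
  unfolding has_weak_deriv_def
proof (intro allI impI)
  fix \<phi> assume \<phi>: "test_function \<phi>"
  note \<phi>' = test_function_props[OF \<phi>]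
  obtain r where r: "\<And>x. \<bar>x\<bar> \<ge> r \<Longrightarrow> \<phi> x = 0" "\<And>x. \<bar>x\<bar> \<ge> r \<Longrightarrow> deriv \<phi> x = 0" using \<phi>'(4) by blast
  have lim: "(\<lambda>n. \<integral>x. \<psi> x *\<^sub>R P n x \<partial>lborel) \<longlonglongrightarrow> (\<integral>x. \<psi> x *\<^sub>R p x \<partial>lborel)"
    if \<psi>: "(\<lambda>x. complex_of_real (\<psi> x)) \<in> L2" and P: "\<And>n. P n \<in> L2" "p \<in> L2"
      and l: "(\<lambda>n. L2_norm (\<lambda>x. P n x - p x)) \<longlonglongrightarrow> 0" for \<psi> P p
  proof (rule LIM_zero_cancel, rule Lim_null_comparison)
    show "(\<lambda>n. L2_norm (\<lambda>x. complex_of_real (\<psi> x)) * L2_norm (\<lambda>x. P n x - p x)) \<longlonglongrightarrow> 0"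
      by (rule tendsto_mult_right_zero[OF l])
    have "norm ((\<integral>x. \<psi> x *\<^sub>R P n x \<partial>lborel) - (\<integral>x. \<psi> x *\<^sub>R p x \<partial>lborel))
        \<le> L2_norm (\<lambda>x. complex_of_real (\<psi> x)) * L2_norm (\<lambda>x. P n x - p x)" for n
    proof -
      have "(\<integral>x. \<psi> x *\<^sub>R P n x \<partial>lborel) - (\<integral>x. \<psi> x *\<^sub>R p x \<partial>lborel)
          = (\<integral>x. complex_of_real (\<psi> x) * P n x - complex_of_real (\<psi> x) * p x \<partial>lborel)"
        unfolding scaleR_conv_of_real
        by (rule Bochner_Integration.integral_diff[symmetric]) (intro L2_mult_integrable \<psi> P)+
      also have "\<dots> = (\<integral>x. complex_of_real (\<psi> x) * (P n x - p x) \<partial>lborel)" by (simp add: right_diff_distrib)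
      finally show ?thesis using L2_mult_integrable(3)[OF \<psi> L2_diff[OF P]] by simp
    qed
    then show "\<forall>\<^sub>F n in sequentially. norm ((\<integral>x. \<psi> x *\<^sub>R P n x \<partial>lborel) - (\<integral>x. \<psi> x *\<^sub>R p x \<partial>lborel))
        \<le> L2_norm (\<lambda>x. complex_of_real (\<psi> x)) * L2_norm (\<lambda>x. P n x - p x)"
      by (intro always_eventually allI)
  qed
  have "(\<lambda>n. \<integral>x. deriv \<phi> x *\<^sub>R F n x \<partial>lborel) \<longlonglongrightarrow> (\<integral>x. deriv \<phi> x *\<^sub>R f x \<partial>lborel)"
    by (intro lim of_real_L2[OF \<phi>'(3) r(2)] F f)
  moreover have "(\<lambda>n. \<integral>x. deriv \<phi> x *\<^sub>R F n x \<partial>lborel) \<longlonglongrightarrow> - (\<integral>x. \<phi> x *\<^sub>R g x \<partial>lborel)"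
  proof -
    have "(\<lambda>n. - (\<integral>x. \<phi> x *\<^sub>R G n x \<partial>lborel)) \<longlonglongrightarrow> - (\<integral>x. \<phi> x *\<^sub>R g x \<partial>lborel)"
      by (intro tendsto_minus lim of_real_L2[OF \<phi>'(2) r(1)] F g)
    then show ?thesis using F(3) \<phi> by (simp add: has_weak_deriv_def)
  qed
  ultimately show "(\<integral>x. deriv \<phi> x *\<^sub>R f x \<partial>lborel) = - (\<integral>x. \<phi> x *\<^sub>R g x \<partial>lborel)"
    by (rule LIMSEQ_unique)
qed

instance h1 :: banach
proof
  fix X :: "nat \<Rightarrow> h1" assume X: "Cauchy X"
  have C: "\<exists>N. \<forall>m\<ge>N. \<forall>n\<ge>N. norm (X m - X n) < e" if "e > 0" for e
    using metric_CauchyD[OF X that] by (auto simp: dist_norm)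
  have "\<exists>f\<in>L2. (\<lambda>n. L2_norm (\<lambda>x. fn (X n) x - f x)) \<longlonglongrightarrow> 0"
    by (rule L2_complete[OF fn_L2], unfold L2_norm_fn_minus) (meson C L2_norm_fn_le le_less_trans)
  then obtain f where f: "f \<in> L2" "(\<lambda>n. L2_norm (\<lambda>x. fn (X n) x - f x)) \<longlonglongrightarrow> 0" by blast
  have "\<exists>f\<in>L2. (\<lambda>n. L2_norm (\<lambda>x. dr (X n) x - f x)) \<longlonglongrightarrow> 0"
    by (rule L2_complete[OF dr_L2], unfold L2_norm_dr_minus) (meson C L2_norm_dr_le le_less_trans)
  then obtain g where g: "g \<in> L2" "(\<lambda>n. L2_norm (\<lambda>x. dr (X n) x - g x)) \<longlonglongrightarrow> 0" by blast
  have "has_weak_deriv f g"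
    by (rule has_weak_deriv_L2_limit[OF fn_L2 dr_L2 ac_primitive_has_weak_deriv[OF ac_fn] f g])
  then obtain F where F: "ac_primitive F g" "AE x in lborel. f x = F x"
    using has_weak_deriv_ac_primitive L2_loc_int f(1) g(1) by blast
  have FL2: "F \<in> L2"
    using L2_norm_cong_AE(1)[OF f(1) _ F(2)] borel_measurable_continuous_onI[OF ac_primitive_continuous[OF F(1)]] by simp
  define Y where "Y = Abs_h1 F"
  have Y: "fn Y = F" "AE x in lborel. dr Y x = g x" unfolding Y_def by (rule Abs_h1[OF FL2 g(1) F(1)])+
  have 1: "L2_norm (fn (X n - Y)) = L2_norm (\<lambda>x. fn (X n) x - f x)" for n
    unfolding L2_norm_fn_minus[symmetric]
    by (rule L2_norm_cong_AE(2)[OF L2_diff[OF fn_L2 fn_L2] L2_D(1)[OF L2_diff[OF fn_L2 f(1)]]])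
      (use F(2) in \<open>auto simp: Y(1)\<close>)
  have 2: "L2_norm (dr (X n - Y)) = L2_norm (\<lambda>x. dr (X n) x - g x)" for n
    unfolding L2_norm_dr_minus[symmetric]
    by (rule L2_norm_cong_AE(2)[OF L2_diff[OF dr_L2 dr_L2] L2_D(1)[OF L2_diff[OF dr_L2 g(1)]]])
      (use Y(2) in auto)
  have "(\<lambda>n. sqrt ((L2_norm (\<lambda>x. fn (X n) x - f x))\<^sup>2 + (L2_norm (\<lambda>x. dr (X n) x - g x))\<^sup>2)) \<longlonglongrightarrow> sqrt (0\<^sup>2 + 0\<^sup>2)"
    by (intro tendsto_intros f g)
  then have "(\<lambda>n. norm (X n - Y)) \<longlonglongrightarrow> 0"
    by (simp add: norm_h1_def inner_h1_self 1 2)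
  then have "X \<longlonglongrightarrow> Y" by (simp add: LIM_zero_iff tendsto_norm_zero_iff)
  then show "convergent X" by (auto simp: convergent_def)
qed

text \<open>The Gagliardo-Nirenberg inequality for the supremum; that only one factor is an \<open>H\<^sup>1\<close> norm is what
  makes the quartic energy subordinate to the quadratic one.\<close>
lemma fn_bound_sq: "(cmod (fn F x))\<^sup>2 \<le> 3 * (L2_norm (fn F) * norm F)"
proof -
  have "(cmod (fn F x))\<^sup>2 \<le> L2_norm (fn F) * (L2_norm (fn F) + 2 * L2_norm (dr F))"
    by (rule sup_bound[OF ac_fn fn_L2 dr_L2])
  also have "\<dots> \<le> L2_norm (fn F) * (norm F + 2 * norm F)"
    using L2_norm_fn_le[of F] L2_norm_dr_le[of F] by (intro mult_left_mono add_mono) (auto simp: L2_norm_nonneg)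
  finally show ?thesis by simp
qed

lemma fn_bound: "cmod (fn F x) \<le> 2 * norm F"
proof (rule power2_le_imp_le)
  have "(cmod (fn F x))\<^sup>2 \<le> 3 * (norm F * norm F)"
    using fn_bound_sq[of F x] mult_right_mono[OF L2_norm_fn_le[of F] norm_ge_zero[of F]] by linarith
  also have "\<dots> \<le> (2 * norm F)\<^sup>2" by (simp add: power2_eq_square)
  finally show "(cmod (fn F x))\<^sup>2 \<le> (2 * norm F)\<^sup>2" .
qed simp

definition mul :: "h1 \<Rightarrow> h1 \<Rightarrow> h1" where
  "mul F G = Abs_h1 (\<lambda>x. fn F x * fn G x)"

lemma fn_measurable: "fn F \<in> borel_measurable borel"
  by (rule L2_D(1)[OF fn_L2])

lemma mul_deriv_L2: "(\<lambda>x. dr F x * fn G x + fn F x * dr G x) \<in> L2"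
  using L2_bounded_mult(1)[OF dr_L2 fn_measurable fn_bound, of F G]
    L2_bounded_mult(1)[OF dr_L2 fn_measurable fn_bound, of G F]
  by (intro L2_add) (simp_all add: mult.commute)

lemma fn_mul [simp]: "fn (mul F G) x = fn F x * fn G x"
  and dr_mul: "AE x in lborel. dr (mul F G) x = dr F x * fn G x + fn F x * dr G x"
  unfolding mul_def
  using Abs_h1[OF L2_bounded_mult(1)[OF fn_L2 fn_measurable fn_bound] mul_deriv_L2 ac_primitive_mult[OF ac_fn ac_fn], of F G]
  by simp_all

text \<open>\<open>H\<^sup>1\<close> is an algebra.\<close>
lemma norm_mul_le: "norm (mul F G) \<le> norm F * norm G * 6"
proof -
  have b: "L2_norm (\<lambda>x. fn F x * f x) \<le> 2 * norm F * L2_norm f" if "f \<in> L2" for F f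
    using L2_bounded_mult(2)[OF that fn_measurable fn_bound, of F] by simp
  have b2: "(\<lambda>x. fn F x * f x) \<in> L2" if "f \<in> L2" for F f
    by (rule L2_bounded_mult(1)[OF that fn_measurable fn_bound])
  have "L2_norm (fn (mul F G)) \<le> 2 * norm F * L2_norm (fn G)"
    using b[OF fn_L2[of G], of F] by (simp add: fn_mul[abs_def])
  also have "\<dots> \<le> 2 * norm F * norm G" by (intro mult_left_mono L2_norm_fn_le) simp
  finally have 1: "L2_norm (fn (mul F G)) \<le> 2 * norm F * norm G" .
  have "L2_norm (dr (mul F G)) = L2_norm (\<lambda>x. dr F x * fn G x + fn F x * dr G x)"
    by (rule L2_norm_cong_AE(2)[OF dr_L2 L2_D(1)[OF mul_deriv_L2] dr_mul])
  also have "\<dots> = L2_norm (\<lambda>x. fn G x * dr F x + fn F x * dr G x)" by (simp add: mult.commute)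
  also have "\<dots> \<le> L2_norm (\<lambda>x. fn G x * dr F x) + L2_norm (\<lambda>x. fn F x * dr G x)"
    by (intro L2_norm_triangle b2 dr_L2)
  also have "\<dots> \<le> 2 * norm G * L2_norm (dr F) + 2 * norm F * L2_norm (dr G)" by (intro add_mono b dr_L2)
  also have "\<dots> \<le> 2 * norm G * norm F + 2 * norm F * norm G" by (intro add_mono mult_left_mono L2_norm_dr_le) auto
  finally have 2: "L2_norm (dr (mul F G)) \<le> 4 * norm F * norm G" by (simp add: mult_ac)
  have "norm (mul F G) \<le> L2_norm (fn (mul F G)) + L2_norm (dr (mul F G))"
    unfolding norm_h1_def inner_h1_self by (rule sqrt_sum_squares_le_sum) (auto simp: L2_norm_nonneg)
  then show ?thesis using 1 2 by linarith
qed

lemma mul_bilinear: "bounded_bilinear mul"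
proof
  show "\<exists>K. \<forall>F G. norm (mul F G) \<le> norm F * norm G * K" using norm_mul_le by blast
qed (rule h1_eqI; simp add: algebra_simps)+

lemma norm_cscale: "norm (cscale c F) = cmod c * norm F"
proof -
  have "(L2_norm (fn (cscale c F)))\<^sup>2 = (cmod c * L2_norm (fn F))\<^sup>2"
    by (simp add: L2_norm_sq norm_mult power_mult_distrib)
  moreover have "(L2_norm (dr (cscale c F)))\<^sup>2 = (cmod c * L2_norm (dr F))\<^sup>2"
    unfolding L2_norm_cong_AE(2)[OF dr_L2 L2_D(1)[OF L2_cmult[OF dr_L2]] dr_cscale]
    by (simp add: L2_norm_sq norm_mult power_mult_distrib)
  ultimately have "(norm (cscale c F))\<^sup>2 = (cmod c * norm F)\<^sup>2"
    by (simp add: norm_h1_sq power_mult_distrib distrib_left)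
  then show ?thesis by (simp add: power2_eq_iff_nonneg)
qed

lemma cscale_linear: "bounded_linear (cscale c)"
proof (rule bounded_linear_intro)
  show "norm (cscale c F) \<le> norm F * cmod c" for F by (simp add: norm_cscale mult.commute)
qed (rule h1_eqI; simp add: algebra_simps)+

lemma norm_hcnj [simp]: "norm (hcnj F) = norm F"
proof -
  have "L2_norm (dr (hcnj F)) = L2_norm (dr F)"
    using L2_norm_cong_AE(2)[OF dr_L2 L2_D(1)[OF L2_cnj[OF dr_L2]] dr_hcnj, of F] by simp
  moreover have "L2_norm (fn (hcnj F)) = L2_norm (fn F)" by (simp add: fn_hcnj[abs_def])
  ultimately show ?thesis by (simp add: norm_h1_def inner_h1_self)
qed

lemma hcnj_linear: "bounded_linear hcnj"
proof (rule bounded_linear_intro)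
  show "norm (hcnj F) \<le> norm F * 1" for F by simp
qed (rule h1_eqI; simp)+

section \<open>Operators on \<open>H\<^sup>1 \<times> H\<^sup>1\<close>\<close>

definition l2ip :: "h1 \<Rightarrow> h1 \<Rightarrow> real" where "l2ip F G = L2_inner (fn F) (fn G)"

definition l2n :: "h1 \<Rightarrow> real" where "l2n F = L2_norm (fn F)"

lemma l2n_nonneg [simp]: "0 \<le> l2n F" by (simp add: l2n_def L2_norm_nonneg)

lemma l2n_le_norm: "l2n F \<le> norm F" by (simp add: l2n_def L2_norm_fn_le)

lemma l2ip_self: "l2ip F F = (l2n F)\<^sup>2" by (simp add: l2ip_def l2n_def L2_inner_self fn_L2)

lemma l2ip_commute: "l2ip F G = l2ip G F" by (simp add: l2ip_def L2_inner_commute)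

lemma l2ip_bound: "\<bar>l2ip F G\<bar> \<le> l2n F * l2n G" by (simp add: l2ip_def l2n_def L2_inner_bound fn_L2)

lemma l2ip_add_left: "l2ip (F + G) H = l2ip F H + l2ip G H"
  using L2_inner_add_left[OF fn_L2 fn_L2 fn_L2, of F G H] by (simp add: l2ip_def fn_plus[abs_def])

lemma l2ip_scaleR_left: "l2ip (r *\<^sub>R F) H = r * l2ip F H"
  using L2_inner_scaleR_left[of r "fn F" "fn H"] by (simp add: l2ip_def fn_scaleR[abs_def] scaleR_conv_of_real)

lemma l2ip_bilinear: "bounded_bilinear l2ip"
proof
  show "\<exists>K. \<forall>F G. norm (l2ip F G) \<le> norm F * norm G * K"
  proof (intro exI allI)
    fix F G
    have "\<bar>l2ip F G\<bar> \<le> l2n F * l2n G" by (rule l2ip_bound)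
    also have "\<dots> \<le> norm F * norm G" by (intro mult_mono l2n_le_norm) auto
    finally show "norm (l2ip F G) \<le> norm F * norm G * 1" by simp
  qed
  show "l2ip F (G + H) = l2ip F G + l2ip F H" for F G H by (simp add: l2ip_commute[of F] l2ip_add_left)
  show "l2ip F (r *\<^sub>R G) = r *\<^sub>R l2ip F G" for F G r by (simp add: l2ip_commute[of F] l2ip_scaleR_left)
qed (simp_all add: l2ip_add_left l2ip_scaleR_left)

interpretation l2ip: bounded_bilinear l2ip by (rule l2ip_bilinear)
interpretation mul: bounded_bilinear mul by (rule mul_bilinear)
lemmas hcnj_diff = linear_diff[OF bounded_linear.linear[OF hcnj_linear]]
lemmas cscale_diff = linear_diff[OF bounded_linear.linear[OF cscale_linear]]

lemma l2n_triangle: "l2n (F + G) \<le> l2n F + l2n G"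
  using L2_norm_triangle[OF fn_L2 fn_L2, of F G] by (simp add: l2n_def fn_plus[abs_def])

lemma l2n_cscale [simp]: "l2n (cscale c F) = cmod c * l2n F"
proof -
  have "(l2n (cscale c F))\<^sup>2 = (cmod c * l2n F)\<^sup>2"
    by (simp add: l2n_def L2_norm_sq norm_mult power_mult_distrib)
  then show ?thesis by (simp add: power2_eq_iff_nonneg)
qed

lemma l2n_scaleR [simp]: "l2n (r *\<^sub>R F) = \<bar>r\<bar> * l2n F"
  by (simp add: scaleR_h1_def)

lemma l2n_minus: "l2n (F - G) \<le> l2n F + l2n G"
  unfolding minus_h1_def using l2n_triangle[of F "cscale (-1) G"] by simp

lemma l2n_hcnj [simp]: "l2n (hcnj F) = l2n F"
  by (simp add: l2n_def fn_hcnj[abs_def])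

lemma l2n_mul_bound:
  assumes "\<And>x. cmod (fn F x) \<le> B"
  shows "l2n (mul F G) \<le> B * l2n G"
  using L2_bounded_mult(2)[OF fn_L2 fn_measurable assms, of G] by (simp add: l2n_def fn_mul[abs_def])

lemma l2n_mul_left: "l2n (mul F G) \<le> 2 * norm F * l2n G"
  by (rule l2n_mul_bound[OF fn_bound])

lemma mul_commute: "mul F G = mul G F"
  by (rule h1_eqI) simp

lemma l2ip_cscale: "l2ip (cscale c F) G = Re (c * (\<integral>x. fn F x * cnj (fn G x) \<partial>lborel))"
  by (simp add: l2ip_def L2_inner_def mult.assoc)

lemma l2ip_rotate: "l2ip (cscale (-\<i>) F) G = - l2ip F (cscale (-\<i>) G)"
proof -
  have "(\<integral>x. fn F x * cnj (fn (cscale (-\<i>) G) x) \<partial>lborel) = (\<integral>x. \<i> * (fn F x * cnj (fn G x)) \<partial>lborel)"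
    by (rule arg_cong[where f = "integral\<^sup>L lborel"]) (simp add: fun_eq_iff)
  then have "l2ip F (cscale (-\<i>) G) = Re (\<i> * (\<integral>x. fn F x * cnj (fn G x) \<partial>lborel))"
    by (simp add: l2ip_def L2_inner_def)
  then show ?thesis by (simp add: l2ip_cscale)
qed

lemma dr_inner_rotate: "L2_inner (dr (cscale (-\<i>) F)) (dr G) = - L2_inner (dr F) (dr (cscale (-\<i>) G))"
proof -
  have "L2_inner (dr (cscale (-\<i>) F)) (dr G) = L2_inner (\<lambda>x. -\<i> * dr F x) (dr G)"
    by (intro L2_inner_cong_AE dr_L2 L2_cmult dr_cscale) simp
  also have "\<dots> = - L2_inner (dr F) (\<lambda>x. -\<i> * dr G x)"
  proof -
    have "(\<integral>x. dr F x * cnj (-\<i> * dr G x) \<partial>lborel) = (\<integral>x. \<i> * (dr F x * cnj (dr G x)) \<partial>lborel)"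
      by (rule arg_cong[where f = "integral\<^sup>L lborel"]) (simp add: fun_eq_iff)
    moreover have "(\<integral>x. -\<i> * dr F x * cnj (dr G x) \<partial>lborel) = (\<integral>x. -\<i> * (dr F x * cnj (dr G x)) \<partial>lborel)"
      by (simp add: mult.assoc)
    ultimately show ?thesis unfolding L2_inner_def by (simp only: integral_mult_right_zero) simp
  qed
  also have "L2_inner (dr F) (\<lambda>x. -\<i> * dr G x) = L2_inner (dr F) (dr (cscale (-\<i>) G))"
  proof -
    have "AE x in lborel. -\<i> * dr G x = dr (cscale (-\<i>) G) x"
      using dr_cscale[of "-\<i>" G] by eventually_elim simp
    then show ?thesis by (intro L2_inner_cong_AE dr_L2 L2_cmult) simp
  qed
  finally show ?thesis .
qed

lemma inner_rotate: "cscale (-\<i>) F \<bullet> G = - (F \<bullet> cscale (-\<i>) G)"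
  using l2ip_rotate[of F G] dr_inner_rotate[of F G] by (simp add: inner_h1_def l2ip_def)

text \<open>Satisfied by the densities \<open>\<bar>u\<bar>\<^sup>2\<close> that multiply \<open>u\<close> in the cubic terms.\<close>
definition real_valued :: "h1 \<Rightarrow> bool" where
  "real_valued s \<longleftrightarrow> (\<forall>x. cnj (fn s x) = fn s x)"

text \<open>The first identity yields the gradient of the quartic energy, the second the conservation of mass by
  the cubic terms: \<open>\<i> s \<bar>u\<bar>\<^sup>2\<close> is imaginary for real \<open>s\<close>.\<close>
lemma l2ip_real_valued:
  assumes s: "real_valued s"
  shows "l2ip (mul p (hcnj u) + mul u (hcnj p)) s = 2 * l2ip p (mul s u)"
    and "l2ip (cscale (-\<i>) (mul s u)) u = 0"
proof -
  define A where "A = (\<integral>x. fn p x * cnj (fn (mul s u) x) \<partial>lborel)"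
  have "l2ip (mul p (hcnj u)) s = Re A"
    unfolding l2ip_def L2_inner_def A_def
    by (intro arg_cong[where f = Re] arg_cong[where f = "integral\<^sup>L lborel"])
      (use s in \<open>simp add: real_valued_def fun_eq_iff mult_ac\<close>)
  moreover have "l2ip (mul u (hcnj p)) s = Re (\<integral>x. cnj (fn p x * cnj (fn (mul s u) x)) \<partial>lborel)"
    unfolding l2ip_def L2_inner_def
    by (intro arg_cong[where f = Re] arg_cong[where f = "integral\<^sup>L lborel"])
      (use s in \<open>simp add: real_valued_def fun_eq_iff mult_ac\<close>)
  moreover have "(\<integral>x. cnj (fn p x * cnj (fn (mul s u) x)) \<partial>lborel) = cnj A"
    unfolding A_def by (rule Bochner_Integration.integral_cnj)
  ultimately show "l2ip (mul p (hcnj u) + mul u (hcnj p)) s = 2 * l2ip p (mul s u)"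
    by (simp add: l2ip.add_left l2ip_def[of p] L2_inner_def A_def)
  define B where "B = (\<integral>x. fn (mul s u) x * cnj (fn u x) \<partial>lborel)"
  have "cnj B = (\<integral>x. cnj (fn (mul s u) x * cnj (fn u x)) \<partial>lborel)"
    unfolding B_def by (rule Bochner_Integration.integral_cnj[symmetric])
  also have "\<dots> = B" unfolding B_def
    by (rule arg_cong[where f = "integral\<^sup>L lborel"]) (use s in \<open>simp add: real_valued_def fun_eq_iff mult_ac\<close>)
  finally have "Im B = 0" by (metis cnj.simps(2) neg_equal_zero)
  then show "l2ip (cscale (-\<i>) (mul s u)) u = 0"
    unfolding l2ip_cscale B_def by simp
qed

definition sq :: "h1 \<Rightarrow> h1" where "sq u = mul u (hcnj u)"

lemma fn_sq [simp]: "fn (sq u) x = of_real ((cmod (fn u x))\<^sup>2)"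
  by (simp add: sq_def complex_norm_square del: of_real_power)

lemma real_valued_sq: "real_valued (a *\<^sub>R sq u + b *\<^sub>R sq v)" "real_valued (sq u)"
  by (simp_all add: real_valued_def)

type_synonym V = "h1 \<times> h1"

definition V_l2ip :: "V \<Rightarrow> V \<Rightarrow> real" where
  "V_l2ip U W = l2ip (fst U) (fst W) + l2ip (snd U) (snd W)"

text \<open>The norm of \<open>L\<^sup>2 \<times> L\<^sup>2\<close>; its square is the mass.\<close>
definition mass_norm :: "V \<Rightarrow> real" where
  "mass_norm U = sqrt ((l2n (fst U))\<^sup>2 + (l2n (snd U))\<^sup>2)"

lemma mass_norm_nonneg [simp]: "0 \<le> mass_norm U" by (simp add: mass_norm_def)

lemma mass_norm_sq: "(mass_norm U)\<^sup>2 = V_l2ip U U" by (simp add: mass_norm_def V_l2ip_def l2ip_self)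

lemma l2n_le_mass_norm: "l2n (fst U) \<le> mass_norm U" "l2n (snd U) \<le> mass_norm U"
  by (simp_all add: mass_norm_def)

lemma norm_fst_snd_le: "norm (fst (U :: V)) \<le> norm U" "norm (snd U) \<le> norm U"
  by (simp_all add: norm_prod_def)

lemma V_l2ip_bilinear: "bounded_bilinear V_l2ip"
proof -
  have ab: "bounded_bilinear (\<lambda>(U::V) (W::V). l2ip (fst U) (fst W))" "bounded_bilinear (\<lambda>(U::V) (W::V). l2ip (snd U) (snd W))"
    by (rule bounded_bilinear.comp[OF l2ip_bilinear bounded_linear_fst bounded_linear_fst]
        bounded_bilinear.comp[OF l2ip_bilinear bounded_linear_snd bounded_linear_snd])+
  interpret a: bounded_bilinear "\<lambda>(U::V) (W::V). l2ip (fst U) (fst W)" by (rule ab(1))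
  interpret b: bounded_bilinear "\<lambda>(U::V) (W::V). l2ip (snd U) (snd W)" by (rule ab(2))
  from a.bounded obtain K where K: "\<forall>(U::V) (W::V). norm (l2ip (fst U) (fst W)) \<le> norm U * norm W * K" ..
  from b.bounded obtain L where L: "\<forall>(U::V) (W::V). norm (l2ip (snd U) (snd W)) \<le> norm U * norm W * L" ..
  have "norm (V_l2ip U W) \<le> norm U * norm W * (K + L)" for U W
    unfolding V_l2ip_def distrib_left
    using norm_triangle_ineq[of "l2ip (fst U) (fst W)" "l2ip (snd U) (snd W)"] K[rule_format, of U W] L[rule_format, of U W] by linarith
  then have "\<exists>C. \<forall>U W. norm (V_l2ip U W) \<le> norm U * norm W * C" by blast
  then show ?thesis
    by (rule bounded_bilinear.intro[rotated 4])
      (simp_all add: V_l2ip_def l2ip.add_left l2ip.add_right l2ip.scaleR_left l2ip.scaleR_right distrib_left)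
qed

interpretation V_l2ip: bounded_bilinear V_l2ip by (rule V_l2ip_bilinear)

lemma V_l2ip_commute: "V_l2ip U W = V_l2ip W U" by (simp add: V_l2ip_def l2ip_commute)

lemma V_l2ip_bound: "\<bar>V_l2ip U W\<bar> \<le> l2n (fst U) * l2n (fst W) + l2n (snd U) * l2n (snd W)"
  unfolding V_l2ip_def using l2ip_bound[of "fst U" "fst W"] l2ip_bound[of "snd U" "snd W"] by linarith

lemma inner_eqI: "(\<And>W. A \<bullet> W = B \<bullet> W) \<Longrightarrow> A = B" for A B :: "'a::real_inner"
  by (metis eq_iff_diff_eq_0 inner_diff_left inner_eq_zero_iff)

text \<open>The operator \<open>(1 - \<partial>\<^sub>x\<^sub>x)\<^sup>-\<^sup>1\<close>, characterized by \<open>massop_inner\<close>.\<close>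
definition massop :: "V \<Rightarrow> V" where
  "massop U = (SOME r. \<forall>W. V_l2ip U W = r \<bullet> W)"

lemma massop_inner: "massop U \<bullet> W = V_l2ip U W"
proof -
  have "\<exists>r. \<forall>W. V_l2ip U W = r \<bullet> W"
    by (rule Riesz_representation[OF V_l2ip.bounded_linear_right])
  then have "\<forall>W. V_l2ip U W = massop U \<bullet> W" unfolding massop_def by (rule someI_ex)
  then show ?thesis by (cases W) simp
qed

lemma massop_bounded_linear: "bounded_linear massop"
proof -
  obtain K where K: "\<And>U W. norm (V_l2ip U W) \<le> norm U * norm W * K" and "K \<ge> 0"
    using V_l2ip.nonneg_bounded by blast
  show ?thesis
  proof (rule bounded_linear_intro)
    show "massop (U + W) = massop U + massop W" for U W
      by (rule inner_eqI) (simp add: massop_inner inner_add_left V_l2ip.add_left)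
    show "massop (r *\<^sub>R U) = r *\<^sub>R massop U" for r U
      by (rule inner_eqI) (simp add: massop_inner V_l2ip.scaleR_left)
    show "norm (massop U) \<le> norm U * K" for U
    proof -
      have "norm (massop U) * norm (massop U) = V_l2ip U (massop U)"
        by (simp flip: massop_inner power2_eq_square add: power2_norm_eq_inner)
      also have "\<dots> \<le> norm U * norm (massop U) * K" using K[of U "massop U"] by simp
      finally have "norm (massop U) * norm (massop U) \<le> norm (massop U) * (norm U * K)" by (simp add: mult_ac)
      then show ?thesis using \<open>K \<ge> 0\<close> by (cases "massop U = 0") auto
    qed
  qed
qed

lemma massop_pos: "U \<noteq> 0 \<Longrightarrow> 0 < massop U \<bullet> U"
proof -
  assume "U \<noteq> 0"
  have "F = 0" if "l2n F = 0" for F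
  proof -
    have "(\<integral>x. (cmod (fn F x))\<^sup>2 \<partial>lborel) = 0" using that by (simp add: l2n_def flip: L2_norm_sq)
    then have "AE x in lborel. (cmod (fn F x))\<^sup>2 = 0"
      by (subst (asm) integral_nonneg_eq_0_iff_AE) (use L2_D(2)[OF fn_L2] in auto)
    then have "fn F = (\<lambda>_. 0)" by (intro continuous_AE_eq fn_continuous) auto
    then show ?thesis by (intro h1_eqI) simp
  qed
  then have "(l2n (fst U))\<^sup>2 + (l2n (snd U))\<^sup>2 \<noteq> 0"
    using \<open>U \<noteq> 0\<close> by (auto simp: sum_power2_eq_zero_iff prod_eq_iff)
  then show ?thesis by (simp add: massop_inner V_l2ip_def l2ip_self sum_power2_gt_zero_iff)
qed

text \<open>Multiplication by \<open>-\<i>\<close>.\<close>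
definition rot :: "V \<Rightarrow> V" where
  "rot U = (cscale (-\<i>) (fst U), cscale (-\<i>) (snd U))"

lemma rot_bounded_linear: "bounded_linear rot"
  unfolding rot_def[abs_def]
  by (intro bounded_linear_Pair bounded_linear_compose[OF cscale_linear] bounded_linear_fst bounded_linear_snd)

lemma rot_skew: "rot U \<bullet> W = - (U \<bullet> rot W)"
  by (simp add: rot_def inner_prod_def inner_rotate)

lemma rot_norm: "norm (rot U) = norm U"
  by (simp add: rot_def norm_prod_def norm_cscale)

lemma V_l2ip_rot: "V_l2ip (rot U) W = - V_l2ip U (rot W)"
  by (simp add: V_l2ip_def rot_def l2ip_rotate)

lemma rot_massop: "rot (massop U) = massop (rot U)"
proof -
  have "rot (massop U) \<bullet> W = massop (rot U) \<bullet> W" for W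
    by (simp add: rot_skew massop_inner V_l2ip_rot)
  then show ?thesis by (rule inner_eqI)
qed

text \<open>Maps that are bounded and Lipschitz on bounded sets for the norm of \<open>H\<^sup>1\<close> and, with the same constant,
  Lipschitz for the norm of \<open>L\<^sup>2\<close>. The first property gives existence, the second uniqueness; asking
  for them together lets one induction over the structure of the nonlinearity prove both.\<close>
definition tame :: "(V \<Rightarrow> h1) \<Rightarrow> bool" where
  "tame f \<longleftrightarrow> (\<forall>r. \<exists>L\<ge>0. \<forall>U W. norm U \<le> r \<longrightarrow> norm W \<le> r \<longrightarrow>
     norm (f U) \<le> L \<and> norm (f U - f W) \<le> L * norm (U - W) \<and> l2n (f U - f W) \<le> L * mass_norm (U - W))"

lemma tameE:
  assumes "tame f"
  obtains L where "L \<ge> 0" "\<And>U. norm U \<le> r \<Longrightarrow> norm (f U) \<le> L"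
    "\<And>U W. norm U \<le> r \<Longrightarrow> norm W \<le> r \<Longrightarrow> norm (f U - f W) \<le> L * norm (U - W)"
    "\<And>U W. norm U \<le> r \<Longrightarrow> norm W \<le> r \<Longrightarrow> l2n (f U - f W) \<le> L * mass_norm (U - W)"
proof -
  obtain L where L0: "L \<ge> 0" and L: "\<forall>U W. norm U \<le> r \<longrightarrow> norm W \<le> r \<longrightarrow>
     norm (f U) \<le> L \<and> norm (f U - f W) \<le> L * norm (U - W) \<and> l2n (f U - f W) \<le> L * mass_norm (U - W)"
    using assms unfolding tame_def by blast
  show thesis by (rule that[OF L0]) (use L in blast)+
qed

lemma tameI:
  assumes "\<And>r. \<exists>L\<ge>0. \<forall>U W. norm U \<le> r \<longrightarrow> norm W \<le> r \<longrightarrow>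
     norm (f U) \<le> L \<and> norm (f U - f W) \<le> L * norm (U - W) \<and> l2n (f U - f W) \<le> L * mass_norm (U - W)"
  shows "tame f"
  using assms unfolding tame_def by blast

lemma tame_projection:
  assumes A: "\<And>U W. A (U - W) = A U - A W" "\<And>U. norm (A U) \<le> norm U" "\<And>U. l2n (A U) \<le> mass_norm U"
  shows "tame A"
proof (rule tameI, intro exI conjI allI impI)
  fix r :: real and U W :: V assume U: "norm U \<le> r"
  have m: "a \<le> max 1 r * b" if "a \<le> b" "0 \<le> b" for a b
    using mult_right_mono[of 1 "max 1 r" b] that by linarith
  show "norm (A U) \<le> max 1 r" using A(2)[of U] U by linarith
  show "norm (A U - A W) \<le> max 1 r * norm (U - W)" using A(2)[of "U - W"] by (intro m) (simp_all add: A(1))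
  show "l2n (A U - A W) \<le> max 1 r * mass_norm (U - W)" using A(3)[of "U - W"] by (intro m) (simp_all add: A(1))
qed simp

lemma tame_fst: "tame fst" and tame_snd: "tame snd"
  by (intro tame_projection fst_diff snd_diff norm_fst_snd_le l2n_le_mass_norm)+

lemma tame_add:
  assumes "tame f" "tame g" shows "tame (\<lambda>U. f U + g U)"
proof (rule tameI)
  fix r
  obtain K where K: "K \<ge> 0" "\<And>U. norm U \<le> r \<Longrightarrow> norm (f U) \<le> K"
    "\<And>U W. norm U \<le> r \<Longrightarrow> norm W \<le> r \<Longrightarrow> norm (f U - f W) \<le> K * norm (U - W)"
    "\<And>U W. norm U \<le> r \<Longrightarrow> norm W \<le> r \<Longrightarrow> l2n (f U - f W) \<le> K * mass_norm (U - W)"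
    by (rule tameE[OF assms(1), of r]) blast
  obtain L where L: "L \<ge> 0" "\<And>U. norm U \<le> r \<Longrightarrow> norm (g U) \<le> L"
    "\<And>U W. norm U \<le> r \<Longrightarrow> norm W \<le> r \<Longrightarrow> norm (g U - g W) \<le> L * norm (U - W)"
    "\<And>U W. norm U \<le> r \<Longrightarrow> norm W \<le> r \<Longrightarrow> l2n (g U - g W) \<le> L * mass_norm (U - W)"
    by (rule tameE[OF assms(2), of r]) blast
  show "\<exists>M\<ge>0. \<forall>U W. norm U \<le> r \<longrightarrow> norm W \<le> r \<longrightarrow>
     norm (f U + g U) \<le> M \<and> norm (f U + g U - (f W + g W)) \<le> M * norm (U - W)
     \<and> l2n (f U + g U - (f W + g W)) \<le> M * mass_norm (U - W)"
  proof (intro exI[of _ "K + L"] conjI allI impI)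
    fix U W :: V assume UW: "norm U \<le> r" "norm W \<le> r"
    have e: "f U + g U - (f W + g W) = (f U - f W) + (g U - g W)" by simp
    show "norm (f U + g U) \<le> K + L" using K(2)[OF UW(1)] L(2)[OF UW(1)] norm_triangle_ineq[of "f U" "g U"] by linarith
    show "norm (f U + g U - (f W + g W)) \<le> (K + L) * norm (U - W)"
      unfolding e distrib_right using K(3)[OF UW] L(3)[OF UW] norm_triangle_ineq[of "f U - f W" "g U - g W"] by linarith
    show "l2n (f U + g U - (f W + g W)) \<le> (K + L) * mass_norm (U - W)"
      unfolding e distrib_right using K(4)[OF UW] L(4)[OF UW] l2n_triangle[of "f U - f W" "g U - g W"] by linarith
  qed (use K L in auto)
qed

lemma tame_linear:
  assumes "tame f" and A: "\<And>F G. A (F - G) = A F - A G" "\<And>F. norm (A F) \<le> c * norm F" "\<And>F. l2n (A F) \<le> c * l2n F"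
    and c: "c \<ge> 0"
  shows "tame (\<lambda>U. A (f U))"
proof (rule tameI)
  fix r
  obtain K where K: "K \<ge> 0" "\<And>U. norm U \<le> r \<Longrightarrow> norm (f U) \<le> K"
    "\<And>U W. norm U \<le> r \<Longrightarrow> norm W \<le> r \<Longrightarrow> norm (f U - f W) \<le> K * norm (U - W)"
    "\<And>U W. norm U \<le> r \<Longrightarrow> norm W \<le> r \<Longrightarrow> l2n (f U - f W) \<le> K * mass_norm (U - W)"
    by (rule tameE[OF assms(1), of r]) blast
  show "\<exists>M\<ge>0. \<forall>U W. norm U \<le> r \<longrightarrow> norm W \<le> r \<longrightarrow>
     norm (A (f U)) \<le> M \<and> norm (A (f U) - A (f W)) \<le> M * norm (U - W) \<and> l2n (A (f U) - A (f W)) \<le> M * mass_norm (U - W)"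
  proof (intro exI[of _ "c * K"] conjI allI impI)
    fix U W :: V assume UW: "norm U \<le> r" "norm W \<le> r"
    show "norm (A (f U)) \<le> c * K" using order_trans[OF A(2) mult_left_mono[OF K(2)[OF UW(1)] c]] .
    show "norm (A (f U) - A (f W)) \<le> c * K * norm (U - W)"
      using order_trans[OF A(2) mult_left_mono[OF K(3)[OF UW] c]] by (simp add: A(1) mult.assoc)
    show "l2n (A (f U) - A (f W)) \<le> c * K * mass_norm (U - W)"
      using order_trans[OF A(3) mult_left_mono[OF K(4)[OF UW] c]] by (simp add: A(1) mult.assoc)
  qed (use K c in auto)
qed

lemma tame_cscale: "tame f \<Longrightarrow> tame (\<lambda>U. cscale c (f U))"
  by (rule tame_linear[where c = "cmod c"]) (auto simp: cscale_diff norm_cscale)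

lemma tame_scaleR: "tame f \<Longrightarrow> tame (\<lambda>U. c *\<^sub>R f U)"
  unfolding scaleR_h1_def by (rule tame_cscale)

lemma tame_hcnj: "tame f \<Longrightarrow> tame (\<lambda>U. hcnj (f U))"
  by (rule tame_linear[where c = 1]) (auto simp: hcnj_diff)

lemma tame_diff: "tame f \<Longrightarrow> tame g \<Longrightarrow> tame (\<lambda>U. f U - g U)"
  unfolding minus_h1_def by (intro tame_add tame_cscale)

text \<open>In \<open>f U g U - f W g W = (f U - f W) g U + f W (g U - g W)\<close>, estimate the difference in \<open>L\<^sup>2\<close> and the other
  factor in the supremum norm.\<close>
lemma tame_mul:
  assumes "tame f" "tame g" shows "tame (\<lambda>U. mul (f U) (g U))"
proof (rule tameI)
  fix r
  obtain K where K: "K \<ge> 0" "\<And>U. norm U \<le> r \<Longrightarrow> norm (f U) \<le> K"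
    "\<And>U W. norm U \<le> r \<Longrightarrow> norm W \<le> r \<Longrightarrow> norm (f U - f W) \<le> K * norm (U - W)"
    "\<And>U W. norm U \<le> r \<Longrightarrow> norm W \<le> r \<Longrightarrow> l2n (f U - f W) \<le> K * mass_norm (U - W)"
    by (rule tameE[OF assms(1), of r]) blast
  obtain L where L: "L \<ge> 0" "\<And>U. norm U \<le> r \<Longrightarrow> norm (g U) \<le> L"
    "\<And>U W. norm U \<le> r \<Longrightarrow> norm W \<le> r \<Longrightarrow> norm (g U - g W) \<le> L * norm (U - W)"
    "\<And>U W. norm U \<le> r \<Longrightarrow> norm W \<le> r \<Longrightarrow> l2n (g U - g W) \<le> L * mass_norm (U - W)"
    by (rule tameE[OF assms(2), of r]) blast
  show "\<exists>M\<ge>0. \<forall>U W. norm U \<le> r \<longrightarrow> norm W \<le> r \<longrightarrow>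
     norm (mul (f U) (g U)) \<le> M \<and> norm (mul (f U) (g U) - mul (f W) (g W)) \<le> M * norm (U - W)
     \<and> l2n (mul (f U) (g U) - mul (f W) (g W)) \<le> M * mass_norm (U - W)"
  proof (intro exI[of _ "12 * (K * L)"] conjI allI impI)
    fix U W :: V assume UW: "norm U \<le> r" "norm W \<le> r"
    have e: "mul (f U) (g U) - mul (f W) (g W) = mul (f U - f W) (g U) + mul (f W) (g U - g W)"
      by (simp add: mul.diff_left mul.diff_right)
    have "norm (mul (f U) (g U)) \<le> norm (f U) * norm (g U) * 6" by (rule norm_mul_le)
    also have "\<dots> \<le> K * L * 6" using K L UW by (intro mult_mono) auto
    also have "\<dots> \<le> 12 * (K * L)" using K L by simp
    finally show "norm (mul (f U) (g U)) \<le> 12 * (K * L)" .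
    have "norm (mul (f U - f W) (g U)) \<le> norm (f U - f W) * norm (g U) * 6" by (rule norm_mul_le)
    also have "\<dots> \<le> (K * norm (U - W)) * L * 6" using K L UW by (intro mult_mono) auto
    finally have 1: "norm (mul (f U - f W) (g U)) \<le> 6 * (K * L) * norm (U - W)" by (simp add: mult_ac)
    have "norm (mul (f W) (g U - g W)) \<le> norm (f W) * norm (g U - g W) * 6" by (rule norm_mul_le)
    also have "\<dots> \<le> K * (L * norm (U - W)) * 6" using K L UW by (intro mult_mono) auto
    finally have 2: "norm (mul (f W) (g U - g W)) \<le> 6 * (K * L) * norm (U - W)" by (simp add: mult_ac)
    show "norm (mul (f U) (g U) - mul (f W) (g W)) \<le> 12 * (K * L) * norm (U - W)"
      unfolding e using 1 2 norm_triangle_ineq[of "mul (f U - f W) (g U)" "mul (f W) (g U - g W)"] by linarith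
    have "l2n (mul (g U) (f U - f W)) \<le> 2 * norm (g U) * l2n (f U - f W)" by (rule l2n_mul_left)
    also have "\<dots> \<le> 2 * L * (K * mass_norm (U - W))" using K L UW by (intro mult_mono) auto
    finally have 3: "l2n (mul (f U - f W) (g U)) \<le> 2 * (K * L) * mass_norm (U - W)" by (simp add: mult_ac mul_commute)
    have "l2n (mul (f W) (g U - g W)) \<le> 2 * norm (f W) * l2n (g U - g W)" by (rule l2n_mul_left)
    also have "\<dots> \<le> 2 * K * (L * mass_norm (U - W))" using K L UW by (intro mult_mono) auto
    finally have 4: "l2n (mul (f W) (g U - g W)) \<le> 2 * (K * L) * mass_norm (U - W)" by (simp add: mult_ac)
    have "0 \<le> (K * L) * mass_norm (U - W)" using K L by simp
    then show "l2n (mul (f U) (g U) - mul (f W) (g W)) \<le> 12 * (K * L) * mass_norm (U - W)"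
      unfolding e using 3 4 l2n_triangle[of "mul (f U - f W) (g U)" "mul (f W) (g U - g W)"] by linarith
  qed (use K L in auto)
qed

lemma tame_sq: "tame f \<Longrightarrow> tame (\<lambda>U. sq (f U))"
  unfolding sq_def by (intro tame_mul tame_hcnj)

lemmas tame_intros = tame_fst tame_snd tame_add tame_diff tame_scaleR tame_cscale tame_mul tame_sq

lemma tame_continuous: "tame f \<Longrightarrow> continuous_on UNIV f"
proof (rule continuous_at_imp_continuous_on, rule ballI)
  fix U :: V assume f: "tame f"
  obtain L where L: "L \<ge> 0" "\<And>W X. norm W \<le> norm U + 1 \<Longrightarrow> norm X \<le> norm U + 1 \<Longrightarrow> norm (f W - f X) \<le> L * norm (W - X)"
    by (rule tameE[OF f, of "norm U + 1"]) blast
  have "((\<lambda>W. f W - f U) \<longlongrightarrow> 0) (at U)"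
  proof (rule Lim_null_comparison)
    have "\<forall>\<^sub>F W in at U. dist W U < 1" by (auto simp: eventually_at intro: exI[of _ 1])
    then show "\<forall>\<^sub>F W in at U. norm (f W - f U) \<le> L * norm (W - U)"
    proof eventually_elim
      case (elim W)
      then have "norm W \<le> norm U + 1" using norm_triangle_sub[of W U] by (simp add: dist_norm)
      then show ?case by (intro L(2)) auto
    qed
    have "((\<lambda>W. L * norm (W - U)) \<longlongrightarrow> L * norm (U - U)) (at U)" by (intro tendsto_intros)
    then show "((\<lambda>W. L * norm (W - U)) \<longlongrightarrow> 0) (at U)" by simp
  qed
  then show "isCont f U" by (simp add: isCont_def LIM_zero_iff)
qed

section \<open>The system as an evolution equation\<close>

text \<open>The radial retraction onto the ball of radius \<open>r\<close>.\<close>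
definition retract :: "real \<Rightarrow> 'a::real_normed_vector \<Rightarrow> 'a" where
  "retract r x = (if norm x \<le> r then x else (r / norm x) *\<^sub>R x)"

lemma norm_retract: "0 \<le> r \<Longrightarrow> norm (retract r x) \<le> r"
  by (auto simp: retract_def)

lemma retract_lipschitz:
  assumes r: "0 \<le> r"
  shows "norm (retract r x - retract r y) \<le> 2 * norm (x - y)"
proof -
  have out: "norm (retract r x - y) \<le> 2 * norm (x - y)" if "norm x > r" "norm y \<le> r" for x y :: 'a
  proof -
    have x0: "norm x > 0" using that r by linarith
    have "retract r x - x = (r / norm x - 1) *\<^sub>R x" using that by (simp add: retract_def algebra_simps)
    then have "norm (retract r x - x) = \<bar>r / norm x - 1\<bar> * norm x" by simp
    also have "\<bar>r / norm x - 1\<bar> = 1 - r / norm x" using that x0 by (simp add: field_simps abs_if)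
    also have "(1 - r / norm x) * norm x = norm x - r" using x0 by (simp add: field_simps)
    also have "\<dots> \<le> norm x - norm y" using that by simp
    also have "\<dots> \<le> norm (x - y)" by (rule norm_triangle_ineq2)
    finally have "norm (retract r x - x) \<le> norm (x - y)" .
    moreover have "norm (retract r x - y) \<le> norm (retract r x - x) + norm (x - y)" by norm
    ultimately show ?thesis by simp
  qed
  consider "norm x \<le> r" "norm y \<le> r" | "norm x > r" "norm y \<le> r" | "norm x \<le> r" "norm y > r"
    | "norm x > r" "norm y > r" by linarith
  then show ?thesis
  proof cases
    case 1 then show ?thesis by (simp add: retract_def)
  next
    case 2 then show ?thesis using out[OF 2] by (simp add: retract_def)
  next
    case 3 then show ?thesis using out[of y x] by (simp add: retract_def norm_minus_commute)
  next
    case 4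
    have x0: "norm x > 0" "norm y > 0" using 4 r by linarith+
    have "retract r x - retract r y = (r / norm x) *\<^sub>R (x - y) + (r / norm x - r / norm y) *\<^sub>R y"
      using 4 by (simp add: retract_def algebra_simps)
    then have "norm (retract r x - retract r y) \<le> norm ((r / norm x) *\<^sub>R (x - y)) + norm ((r / norm x - r / norm y) *\<^sub>R y)"
      by (metis norm_triangle_ineq)
    also have "norm ((r / norm x) *\<^sub>R (x - y)) \<le> 1 * norm (x - y)"
      unfolding norm_scaleR using 4 r x0 by (intro mult_right_mono) auto
    also have "norm ((r / norm x - r / norm y) *\<^sub>R y) = (r / norm x) * \<bar>norm y - norm x\<bar>"
    proof -
      have "(r / norm x - r / norm y) * norm y = (r / norm x) * (norm y - norm x)"
        using x0 by (simp add: field_simps)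
      then have "\<bar>r / norm x - r / norm y\<bar> * norm y = \<bar>(r / norm x) * (norm y - norm x)\<bar>"
        by (metis abs_mult abs_norm_cancel)
      then show ?thesis using r x0 by (simp add: abs_mult)
    qed
    also have "\<dots> \<le> 1 * norm (x - y)"
      using 4 r x0 norm_triangle_ineq3[of y x] by (intro mult_mono) (auto simp: norm_minus_commute)
    finally show ?thesis by simp
  qed
qed

text \<open>The difference quotient of \<open>\<langle>T U, U\<rangle>\<close> is \<open>\<langle>T U(t + h) - T U(t), U(t + h) + U(t)\<rangle> / h\<close> by symmetry, so
  differentiability of \<open>T U\<close> and continuity of \<open>U\<close> suffice.\<close>
lemma massop_inner_derivative:
  assumes U: "continuous (at t) U" and d: "((\<lambda>t. massop (U t)) has_vector_derivative D) (at t)"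
  shows "((\<lambda>t. V_l2ip (U t) (U t)) has_real_derivative 2 * (D \<bullet> U t)) (at t)"
proof -
  have l: "((\<lambda>h. (1 / h) *\<^sub>R (massop (U (t + h)) - massop (U t))) \<longlongrightarrow> D) (at 0)"
    by (rule has_vector_derivative_quotient[OF d])
  have "((\<lambda>h. U (t + h) + U t) \<longlongrightarrow> U t + U t) (at 0)"
    using U by (intro tendsto_intros) (simp add: isCont_def LIM_offset_zero_iff)
  from tendsto_inner[OF l this]
  have "((\<lambda>h. (1 / h) *\<^sub>R (massop (U (t + h)) - massop (U t)) \<bullet> (U (t + h) + U t)) \<longlongrightarrow> 2 * (D \<bullet> U t)) (at 0)"
    by (simp add: inner_add_right)
  moreover have "(1 / h) *\<^sub>R (massop (U (t + h)) - massop (U t)) \<bullet> (U (t + h) + U t)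
      = (V_l2ip (U (t + h)) (U (t + h)) - V_l2ip (U t) (U t)) / h" for h
    by (simp add: inner_diff_left inner_add_right massop_inner V_l2ip_commute[of "U t" "U (t + h)"] flip: add_divide_distrib)
  ultimately show ?thesis unfolding DERIV_def by (simp only:)
qed

locale manakov =
  fixes \<gamma> \<kappa> g11 g22 g12 :: real
  assumes \<gamma>: "\<gamma> > 0" and \<kappa>: "\<kappa> > 0"
begin

text \<open>The real factors in front of \<open>u\<close> and \<open>v\<close> in the cubic terms.\<close>
definition S1 :: "V \<Rightarrow> h1" where "S1 U = g11 *\<^sub>R sq (fst U) + g12 *\<^sub>R sq (snd U)"
definition S2 :: "V \<Rightarrow> h1" where "S2 U = g12 *\<^sub>R sq (fst U) + g22 *\<^sub>R sq (snd U)"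

text \<open>The gradient, for the inner product of \<open>L\<^sup>2\<close>, of the part of the energy without spatial derivatives.\<close>
definition nonlin :: "V \<Rightarrow> V" where
  "nonlin U = (\<kappa> *\<^sub>R snd U - mul (S1 U) (fst U), \<kappa> *\<^sub>R fst U - mul (S2 U) (snd U))"

definition gainloss :: "V \<Rightarrow> V" where "gainloss U = (\<gamma> *\<^sub>R fst U, (- \<gamma>) *\<^sub>R snd U)"

text \<open>The system is \<open>U\<^sub>t = rot (- U\<^sub>x\<^sub>x + nonlin U) + gainloss U\<close>. As \<open>- U\<^sub>x\<^sub>x\<close> equals \<open>massop\<^sup>-\<^sup>1 U - U\<close>, the term
  \<open>- U\<close> is moved into the perturbation.\<close>
definition forcing :: "V \<Rightarrow> V" where "forcing U = rot (nonlin U - U) + gainloss U"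

text \<open>The energy without \<open>\<parallel>U\<parallel>\<^bsub>H\<^sup>1\<^esub>\<^sup>2 / 2\<close>; the last term turns the full \<open>H\<^sup>1\<close> norm into the norm of the derivative.\<close>
definition \<Psi> :: "V \<Rightarrow> real" where
  "\<Psi> U = \<kappa> * l2ip (fst U) (snd U)
     - (g11 * l2ip (sq (fst U)) (sq (fst U)) + 2 * g12 * l2ip (sq (fst U)) (sq (snd U)) + g22 * l2ip (sq (snd U)) (sq (snd U))) / 4
     - V_l2ip U U / 2"

lemma tame_nonlin: "tame (\<lambda>U. fst (nonlin U))" "tame (\<lambda>U. snd (nonlin U))"
  unfolding nonlin_def S1_def S2_def fst_conv snd_conv by (intro tame_intros)+

lemma tame_forcing: "tame (\<lambda>U. fst (forcing U))" "tame (\<lambda>U. snd (forcing U))"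
proof -
  have "fst (forcing U) = cscale (-\<i>) (fst (nonlin U) - fst U) + \<gamma> *\<^sub>R fst U"
    "snd (forcing U) = cscale (-\<i>) (snd (nonlin U) - snd U) + (- \<gamma>) *\<^sub>R snd U" for U
    by (simp_all add: forcing_def rot_def gainloss_def)
  then show "tame (\<lambda>U. fst (forcing U))" "tame (\<lambda>U. snd (forcing U))"
    by (simp_all only:) (intro tame_intros tame_nonlin)+
qed

lemma m_continuous: "continuous_on UNIV (\<lambda>U. nonlin U - U)"
proof -
  have "continuous_on UNIV (\<lambda>U. (fst (nonlin U), snd (nonlin U)) - U)"
    by (intro continuous_intros tame_continuous tame_nonlin)
  then show ?thesis by simp
qed

lemma forcing_Lipschitz:
  "\<exists>L>0. \<forall>U W. norm U \<le> r \<longrightarrow> norm W \<le> r \<longrightarrow>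
     norm (forcing U - forcing W) \<le> L * norm (U - W) \<and> \<bar>V_l2ip (forcing U - forcing W) (U - W)\<bar> \<le> L * V_l2ip (U - W) (U - W)"
proof -
  obtain K where K: "K \<ge> 0" "\<And>U W. norm U \<le> r \<Longrightarrow> norm W \<le> r \<Longrightarrow> norm (fst (forcing U) - fst (forcing W)) \<le> K * norm (U - W)"
    "\<And>U W. norm U \<le> r \<Longrightarrow> norm W \<le> r \<Longrightarrow> l2n (fst (forcing U) - fst (forcing W)) \<le> K * mass_norm (U - W)"
    by (rule tameE[OF tame_forcing(1), of r]) blast
  obtain L where L: "L \<ge> 0" "\<And>U W. norm U \<le> r \<Longrightarrow> norm W \<le> r \<Longrightarrow> norm (snd (forcing U) - snd (forcing W)) \<le> L * norm (U - W)"
    "\<And>U W. norm U \<le> r \<Longrightarrow> norm W \<le> r \<Longrightarrow> l2n (snd (forcing U) - snd (forcing W)) \<le> L * mass_norm (U - W)"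
    by (rule tameE[OF tame_forcing(2), of r]) blast
  show ?thesis
  proof (intro exI[of _ "K + L + 1"] conjI allI impI)
    fix U W :: V assume UW: "norm U \<le> r" "norm W \<le> r"
    have "norm (forcing U - forcing W) \<le> norm (fst (forcing U) - fst (forcing W)) + norm (snd (forcing U) - snd (forcing W))"
      using norm_Pair_le[of "fst (forcing U - forcing W)" "snd (forcing U - forcing W)"]
      unfolding prod.collapse by simp
    also have "\<dots> \<le> K * norm (U - W) + L * norm (U - W)" by (intro add_mono K L UW)
    also have "\<dots> \<le> (K + L + 1) * norm (U - W)" by (simp add: distrib_right)
    finally show "norm (forcing U - forcing W) \<le> (K + L + 1) * norm (U - W)" .
    have "\<bar>V_l2ip (forcing U - forcing W) (U - W)\<bar> \<le> l2n (fst (forcing U - forcing W)) * l2n (fst (U - W)) + l2n (snd (forcing U - forcing W)) * l2n (snd (U - W))"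
      by (rule V_l2ip_bound)
    also have "\<dots> \<le> (K * mass_norm (U - W)) * mass_norm (U - W) + (L * mass_norm (U - W)) * mass_norm (U - W)"
      using K(3)[OF UW] L(3)[OF UW] K(1) L(1) by (intro add_mono mult_mono l2n_le_mass_norm) auto
    also have "\<dots> = (K + L) * V_l2ip (U - W) (U - W)"
      by (simp add: power2_eq_square algebra_simps flip: mass_norm_sq)
    also have "\<dots> \<le> (K + L + 1) * V_l2ip (U - W) (U - W)"
      by (intro mult_right_mono) (simp_all flip: mass_norm_sq)
    finally show "\<bar>V_l2ip (forcing U - forcing W) (U - W)\<bar> \<le> (K + L + 1) * V_l2ip (U - W) (U - W)" .
  qed (use K(1) L(1) in simp)
qed

lemma \<Psi>_derivative: "(\<Psi> has_derivative (\<lambda>h. massop (nonlin U - U) \<bullet> h)) (at U)"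
proof -
  define D where "D u p = mul p (hcnj u) + mul u (hcnj p)" for u p
  have c: "((\<lambda>U. hcnj (f U)) has_derivative (\<lambda>h. hcnj (f' h))) (at U)" if "(f has_derivative f') (at U)" for f :: "V \<Rightarrow> h1" and f'
    by (rule bounded_linear.has_derivative[OF hcnj_linear that])
  have s: "((\<lambda>U. sq (f U)) has_derivative (\<lambda>h. D (f U) (f' h))) (at U)" if "(f has_derivative f') (at U)" for f :: "V \<Rightarrow> h1" and f'
    using mul.FDERIV[OF that c[OF that]] unfolding sq_def D_def by (simp add: add.commute)
  have f: "(fst has_derivative fst) (at U)" and g: "(snd has_derivative snd) (at U)" for U :: V
    by (intro bounded_linear_imp_has_derivative bounded_linear_fst bounded_linear_snd)+
  let ?u = "fst U" and ?v = "snd U"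
  have d: "(\<Psi> has_derivative (\<lambda>h. \<kappa> * (l2ip ?u (snd h) + l2ip (fst h) ?v)
     - (g11 * (l2ip (sq ?u) (D ?u (fst h)) + l2ip (D ?u (fst h)) (sq ?u))
        + 2 * g12 * (l2ip (sq ?u) (D ?v (snd h)) + l2ip (D ?u (fst h)) (sq ?v))
        + g22 * (l2ip (sq ?v) (D ?v (snd h)) + l2ip (D ?v (snd h)) (sq ?v))) / 4
     - (V_l2ip U h + V_l2ip h U) / 2)) (at U)"
    unfolding \<Psi>_def[abs_def]
    by (intro has_derivative_diff has_derivative_add has_derivative_mult_right bounded_linear.has_derivative[OF bounded_linear_divide]
        l2ip.FDERIV V_l2ip.FDERIV s f g has_derivative_ident)
  have D: "l2ip (D u p) (sq w) = 2 * l2ip (mul (sq w) u) p" for u p w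
    unfolding D_def using l2ip_real_valued(1)[OF real_valued_sq(2), of p u w] by (simp add: l2ip_commute)
  have e: "\<kappa> * (l2ip ?u (snd h) + l2ip (fst h) ?v)
     - (g11 * (l2ip (sq ?u) (D ?u (fst h)) + l2ip (D ?u (fst h)) (sq ?u))
        + 2 * g12 * (l2ip (sq ?u) (D ?v (snd h)) + l2ip (D ?u (fst h)) (sq ?v))
        + g22 * (l2ip (sq ?v) (D ?v (snd h)) + l2ip (D ?v (snd h)) (sq ?v))) / 4
     - (V_l2ip U h + V_l2ip h U) / 2 = massop (nonlin U - U) \<bullet> h" for h
  proof -
    have "massop (nonlin U - U) \<bullet> h = V_l2ip (nonlin U) h - V_l2ip U h" by (simp add: massop_inner V_l2ip.diff_left)
    moreover have "V_l2ip (nonlin U) h = \<kappa> * (l2ip ?u (snd h) + l2ip (fst h) ?v)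
       - (g11 * l2ip (mul (sq ?u) ?u) (fst h) + g12 * l2ip (mul (sq ?v) ?u) (fst h))
       - (g12 * l2ip (mul (sq ?u) ?v) (snd h) + g22 * l2ip (mul (sq ?v) ?v) (snd h))"
      by (simp add: V_l2ip_def nonlin_def S1_def S2_def l2ip.diff_left l2ip.scaleR_left mul.add_left mul.scaleR_left l2ip.add_left
          l2ip_commute[of "fst h" ?v] algebra_simps)
    ultimately show ?thesis
      by (simp add: D l2ip_commute[of "sq _" "D _ _"] V_l2ip_commute[of h U] field_simps)
  qed
  show ?thesis using d by (simp only: e)
qed

text \<open>Solutions for \<open>\<bar>t\<bar> < \<tau>\<close> of the equation after \<open>massop\<close> has been applied.\<close>
definition Vsol :: "real \<Rightarrow> (real \<Rightarrow> V) \<Rightarrow> bool" where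
  "Vsol \<tau> U \<longleftrightarrow> continuous_on UNIV U \<and>
     (\<forall>t. \<bar>t\<bar> < \<tau> \<longrightarrow> ((\<lambda>t. massop (U t)) has_vector_derivative rot (U t) + massop (forcing (U t))) (at t))"

lemma VsolD:
  assumes "Vsol \<tau> U"
  shows "continuous (at t) U" "\<bar>t\<bar> < \<tau> \<Longrightarrow> ((\<lambda>t. massop (U t)) has_vector_derivative rot (U t) + massop (forcing (U t))) (at t)"
  using assms by (auto simp: Vsol_def continuous_on_eq_continuous_at)

lemma rot_self: "rot X \<bullet> X = 0" for X :: V
  using rot_skew[of X X] by (simp add: inner_commute)

lemma V_l2ip_rot_self: "V_l2ip (rot X) X = 0"
  using V_l2ip_rot[of X X] by (simp add: V_l2ip_commute)

lemma V_l2ip_rot_nonlin: "V_l2ip (rot (nonlin U)) U = 0"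
proof -
  let ?u = "fst U" and ?v = "snd U"
  have "V_l2ip (rot (nonlin U)) U = \<kappa> * (l2ip (cscale (-\<i>) ?v) ?u + l2ip (cscale (-\<i>) ?u) ?v)
      - l2ip (cscale (-\<i>) (mul (S1 U) ?u)) ?u - l2ip (cscale (-\<i>) (mul (S2 U) ?v)) ?v"
  proof -
    have L: "cscale (-\<i>) (\<kappa> *\<^sub>R a - b) = \<kappa> *\<^sub>R cscale (-\<i>) a - cscale (-\<i>) b" for a b
      by (rule h1_eqI) (simp add: algebra_simps)
    show ?thesis by (simp add: V_l2ip_def rot_def nonlin_def L l2ip.diff_left l2ip.scaleR_left distrib_left)
  qed
  moreover have "l2ip (cscale (-\<i>) ?v) ?u + l2ip (cscale (-\<i>) ?u) ?v = 0"
    using l2ip_rotate[of ?v ?u] l2ip_commute[of ?v] by simp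
  ultimately show ?thesis
    using l2ip_real_valued(2)[OF real_valued_sq(1)] by (simp add: S1_def S2_def)
qed

lemma V_l2ip_gainloss: "\<bar>V_l2ip (gainloss U) U\<bar> \<le> \<gamma> * V_l2ip U U"
proof -
  have "V_l2ip (gainloss U) U = \<gamma> * (l2n (fst U))\<^sup>2 - \<gamma> * (l2n (snd U))\<^sup>2"
    by (simp add: V_l2ip_def gainloss_def l2ip.scaleR_left l2ip.minus_left l2ip_self)
  moreover have "V_l2ip U U = (l2n (fst U))\<^sup>2 + (l2n (snd U))\<^sup>2" by (simp add: V_l2ip_def l2ip_self)
  moreover have "0 \<le> \<gamma> * (l2n (fst U))\<^sup>2" "0 \<le> \<gamma> * (l2n (snd U))\<^sup>2" using \<gamma> by simp_all
  ultimately show ?thesis by (simp add: distrib_left)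
qed

text \<open>Only gain and loss contribute to the derivative of the mass, because \<open>rot\<close> is skew and the coupling
  and the cubic terms are pointwise Hamiltonian.\<close>
lemma mass_growth:
  assumes U: "Vsol \<tau> U" and t: "\<bar>t\<bar> < \<tau>"
  shows "V_l2ip (U t) (U t) \<le> V_l2ip (U 0) (U 0) * exp (2 * \<gamma> * \<bar>t\<bar>)"
proof -
  have "V_l2ip (U t) (U t) \<le> (V_l2ip (U 0) (U 0) + 0 / (2 * \<gamma>)) * exp (2 * \<gamma> * \<bar>t\<bar>) - 0 / (2 * \<gamma>)"
  proof (rule gronwall[OF _ _ _ t])
    fix s assume s: "\<bar>s\<bar> < \<tau>"
    have "(rot (U s) + massop (forcing (U s))) \<bullet> U s = V_l2ip (gainloss (U s)) (U s)"
    proof -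
      have "forcing (U s) = rot (nonlin (U s)) - rot (U s) + gainloss (U s)"
        unfolding forcing_def using linear_diff[OF bounded_linear.linear[OF rot_bounded_linear]] by simp
      then show ?thesis
        by (simp add: inner_add_left massop_inner rot_self V_l2ip.add_left V_l2ip.diff_left V_l2ip_rot_nonlin V_l2ip_rot_self)
    qed
    then show "((\<lambda>t. V_l2ip (U t) (U t)) has_real_derivative 2 * V_l2ip (gainloss (U s)) (U s)) (at s)"
      using massop_inner_derivative[OF VsolD(1)[OF U] VsolD(2)[OF U s]] by simp
    show "\<bar>2 * V_l2ip (gainloss (U s)) (U s)\<bar> \<le> 2 * \<gamma> * V_l2ip (U s) (U s) + 0"
      using V_l2ip_gainloss[of "U s"] by simp
  qed (use \<gamma> in simp)
  then show ?thesis by simp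
qed

text \<open>Gronwall's inequality for the mass of the difference. On a compact time interval both solutions stay in
  a ball of \<open>H\<^sup>1\<close>, where the perturbation is Lipschitz for the norm of \<open>L\<^sup>2\<close>.\<close>
lemma Vsol_unique:
  assumes U: "Vsol \<tau> U" and W: "Vsol \<tau> W" and 0: "U 0 = W 0" and t: "\<bar>t\<bar> < \<tau>"
  shows "U t = W t"
proof -
  define \<sigma> where "\<sigma> = (\<bar>t\<bar> + \<tau>) / 2"
  have \<sigma>: "\<bar>t\<bar> < \<sigma>" "\<sigma> < \<tau>" using t by (auto simp: \<sigma>_def)
  have "bounded (U ` {-\<sigma>..\<sigma>})" "bounded (W ` {-\<sigma>..\<sigma>})"
    using U W by (auto simp: Vsol_def intro!: compact_imp_bounded compact_continuous_image intro: continuous_on_subset)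
  then obtain a b where ab: "\<And>s. s \<in> {-\<sigma>..\<sigma>} \<Longrightarrow> norm (U s) \<le> a" "\<And>s. s \<in> {-\<sigma>..\<sigma>} \<Longrightarrow> norm (W s) \<le> b"
    unfolding bounded_iff ball_simps by blast
  obtain L where L: "L > 0" "\<And>X Y. norm X \<le> max a b \<Longrightarrow> norm Y \<le> max a b \<Longrightarrow> \<bar>V_l2ip (forcing X - forcing Y) (X - Y)\<bar> \<le> L * V_l2ip (X - Y) (X - Y)"
    using forcing_Lipschitz[of "max a b"] by blast
  define Z where "Z s = U s - W s" for s
  \<comment> \<open>Gronwall's inequality with vanishing inhomogeneity and vanishing initial value.\<close>
  have "V_l2ip (Z t) (Z t) \<le> (V_l2ip (Z 0) (Z 0) + 0 / (2 * L)) * exp (2 * L * \<bar>t\<bar>) - 0 / (2 * L)"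
  proof (rule gronwall[OF _ _ _ \<sigma>(1)])
    fix s assume s: "\<bar>s\<bar> < \<sigma>"
    then have s': "\<bar>s\<bar> < \<tau>" "s \<in> {-\<sigma>..\<sigma>}" using \<sigma> by auto
    have "((\<lambda>t. massop (Z t)) has_vector_derivative (rot (U s) + massop (forcing (U s))) - (rot (W s) + massop (forcing (W s)))) (at s)"
      unfolding Z_def linear_diff[OF bounded_linear.linear[OF massop_bounded_linear]]
      by (intro has_vector_derivative_diff VsolD(2)[OF U s'(1)] VsolD(2)[OF W s'(1)])
    moreover have "continuous (at s) Z" unfolding Z_def[abs_def] by (intro continuous_intros VsolD(1)[OF U] VsolD(1)[OF W])
    ultimately have "((\<lambda>t. V_l2ip (Z t) (Z t)) has_real_derivative
        2 * (((rot (U s) + massop (forcing (U s))) - (rot (W s) + massop (forcing (W s)))) \<bullet> Z s)) (at s)"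
      by (rule massop_inner_derivative[rotated])
    moreover have "((rot (U s) + massop (forcing (U s))) - (rot (W s) + massop (forcing (W s)))) \<bullet> Z s = V_l2ip (forcing (U s) - forcing (W s)) (Z s)"
    proof -
      have "(rot (U s) + massop (forcing (U s))) - (rot (W s) + massop (forcing (W s))) = rot (Z s) + massop (forcing (U s) - forcing (W s))"
        by (simp add: Z_def linear_diff[OF bounded_linear.linear[OF massop_bounded_linear]]
            linear_diff[OF bounded_linear.linear[OF rot_bounded_linear]])
      then show ?thesis by (simp add: inner_add_left rot_self massop_inner)
    qed
    ultimately show "((\<lambda>t. V_l2ip (Z t) (Z t)) has_real_derivative 2 * V_l2ip (forcing (U s) - forcing (W s)) (Z s)) (at s)" by simp
    show "\<bar>2 * V_l2ip (forcing (U s) - forcing (W s)) (Z s)\<bar> \<le> 2 * L * V_l2ip (Z s) (Z s) + 0"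
      using L(2)[of "U s" "W s"] ab[OF s'(2)] by (simp add: Z_def le_max_iff_disj)
  qed (use L in simp)
  then have "V_l2ip (Z t) (Z t) \<le> 0" by (simp add: Z_def 0 V_l2ip.zero_left)
  then show ?thesis using massop_pos[of "Z t"] by (cases "Z t = 0") (auto simp: massop_inner Z_def)
qed

end

section \<open>A priori bounds and global solutions\<close>

context manakov
begin

definition energy :: "V \<Rightarrow> real" where "energy X = (X \<bullet> X) / 2 + \<Psi> X"

definition gsum :: real where "gsum = \<bar>g11\<bar> + \<bar>g12\<bar> + \<bar>g22\<bar>"

lemma gsum_nonneg [simp]: "0 \<le> gsum" by (simp add: gsum_def)

lemma fn_sq_bound: "(cmod (fn (fst X) x))\<^sup>2 \<le> 3 * (mass_norm X * norm X)" "(cmod (fn (snd X) x))\<^sup>2 \<le> 3 * (mass_norm X * norm X)"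
proof -
  have "(cmod (fn F x))\<^sup>2 \<le> 3 * (mass_norm X * norm X)" if "l2n F \<le> mass_norm X" "norm F \<le> norm X" for F
  proof -
    have "l2n F * norm F \<le> mass_norm X * norm X" using that by (intro mult_mono) auto
    then show ?thesis using fn_bound_sq[of F x] by (simp add: l2n_def)
  qed
  then show "(cmod (fn (fst X) x))\<^sup>2 \<le> 3 * (mass_norm X * norm X)" "(cmod (fn (snd X) x))\<^sup>2 \<le> 3 * (mass_norm X * norm X)"
    using l2n_le_mass_norm norm_fst_snd_le by blast+
qed

lemma l2n_nonlin:
  "l2n (fst (nonlin X)) \<le> \<kappa> * mass_norm X + gsum * (3 * (mass_norm X * norm X)) * mass_norm X"
  "l2n (snd (nonlin X)) \<le> \<kappa> * mass_norm X + gsum * (3 * (mass_norm X * norm X)) * mass_norm X"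
proof -
  define B where "B = 3 * (mass_norm X * norm X)"
  have B: "B \<ge> 0" by (simp add: B_def)
  have b: "cmod (fn (a *\<^sub>R sq (fst X) + b *\<^sub>R sq (snd X)) x) \<le> gsum * B" if "\<bar>a\<bar> + \<bar>b\<bar> \<le> gsum" for a b x
  proof -
    have "cmod (fn (a *\<^sub>R sq (fst X) + b *\<^sub>R sq (snd X)) x)
        = \<bar>a * (cmod (fn (fst X) x))\<^sup>2 + b * (cmod (fn (snd X) x))\<^sup>2\<bar>"
      by (simp del: of_real_power of_real_mult of_real_add add: of_real_mult[symmetric] of_real_add[symmetric])
    also have "\<dots> \<le> \<bar>a\<bar> * (cmod (fn (fst X) x))\<^sup>2 + \<bar>b\<bar> * (cmod (fn (snd X) x))\<^sup>2"
      by (rule order_trans[OF abs_triangle_ineq]) (simp add: abs_mult)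
    also have "\<dots> \<le> \<bar>a\<bar> * B + \<bar>b\<bar> * B"
      unfolding B_def by (intro add_mono mult_left_mono fn_sq_bound) auto
    also have "\<dots> \<le> gsum * B" using that B by (simp add: mult_right_mono flip: distrib_right)
    finally show ?thesis .
  qed
  have "l2n (mul (S1 X) (fst X)) \<le> gsum * B * l2n (fst X)" "l2n (mul (S2 X) (snd X)) \<le> gsum * B * l2n (snd X)"
    unfolding S1_def S2_def by (intro l2n_mul_bound b; simp add: gsum_def)+
  moreover have "gsum * B * l2n (fst X) \<le> gsum * B * mass_norm X" "gsum * B * l2n (snd X) \<le> gsum * B * mass_norm X"
    using B by (intro mult_left_mono l2n_le_mass_norm; simp)+
  moreover have "\<kappa> * l2n (fst X) \<le> \<kappa> * mass_norm X" "\<kappa> * l2n (snd X) \<le> \<kappa> * mass_norm X"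
    using \<kappa> by (intro mult_left_mono l2n_le_mass_norm; simp)+
  moreover have "l2n (\<kappa> *\<^sub>R fst X) = \<kappa> * l2n (fst X)" "l2n (\<kappa> *\<^sub>R snd X) = \<kappa> * l2n (snd X)" using \<kappa> by simp_all
  moreover note l2n_minus[of "\<kappa> *\<^sub>R snd X" "mul (S1 X) (fst X)"] l2n_minus[of "\<kappa> *\<^sub>R fst X" "mul (S2 X) (snd X)"]
  ultimately have "l2n (fst (nonlin X)) \<le> \<kappa> * mass_norm X + gsum * B * mass_norm X \<and> l2n (snd (nonlin X)) \<le> \<kappa> * mass_norm X + gsum * B * mass_norm X"
    unfolding nonlin_def fst_conv snd_conv by linarith
  then show "l2n (fst (nonlin X)) \<le> \<kappa> * mass_norm X + gsum * (3 * (mass_norm X * norm X)) * mass_norm X"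
    "l2n (snd (nonlin X)) \<le> \<kappa> * mass_norm X + gsum * (3 * (mass_norm X * norm X)) * mass_norm X"
    by (simp_all add: B_def)
qed

lemma V_l2ip_N_gainloss: "\<bar>V_l2ip (nonlin X) (gainloss X)\<bar> \<le> 2 * \<gamma> * (\<kappa> * (mass_norm X)\<^sup>2 + 3 * gsum * (mass_norm X) ^ 3 * norm X)"
proof -
  define b where "b = \<kappa> * mass_norm X + gsum * (3 * (mass_norm X * norm X)) * mass_norm X"
  have b0: "0 \<le> b" using \<kappa> by (simp add: b_def)
  have G: "l2n (fst (gainloss X)) \<le> \<gamma> * mass_norm X" "l2n (snd (gainloss X)) \<le> \<gamma> * mass_norm X"
  proof -
    have "l2n (c *\<^sub>R F) \<le> \<gamma> * mass_norm X" if "\<bar>c\<bar> = \<gamma>" "l2n F \<le> mass_norm X" for c F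
      unfolding l2n_scaleR using that \<gamma> by simp
    then show "l2n (fst (gainloss X)) \<le> \<gamma> * mass_norm X" "l2n (snd (gainloss X)) \<le> \<gamma> * mass_norm X"
      unfolding gainloss_def fst_conv snd_conv using \<gamma> l2n_le_mass_norm[of X] by (simp_all del: scaleR_minus_left)
  qed
  have "\<bar>V_l2ip (nonlin X) (gainloss X)\<bar> \<le> l2n (fst (nonlin X)) * l2n (fst (gainloss X)) + l2n (snd (nonlin X)) * l2n (snd (gainloss X))"
    by (rule V_l2ip_bound)
  also have "\<dots> \<le> b * (\<gamma> * mass_norm X) + b * (\<gamma> * mass_norm X)"
    unfolding b_def by (intro add_mono mult_mono l2n_nonlin G) (use \<kappa> in auto)
  also have "\<dots> = 2 * \<gamma> * (\<kappa> * (mass_norm X)\<^sup>2 + 3 * gsum * (mass_norm X) ^ 3 * norm X)"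
    by (simp add: b_def algebra_simps power2_eq_square power3_eq_cube)
  finally show ?thesis .
qed

lemma \<Psi>_bound: "\<bar>\<Psi> X\<bar> \<le> (\<kappa> + 1) * (mass_norm X)\<^sup>2 + 3 * gsum * (mass_norm X) ^ 3 * norm X"
proof -
  define A where "A = 3 * (mass_norm X) ^ 3 * norm X"
  define B where "B = 3 * (mass_norm X * norm X)"
  have B: "B \<ge> 0" by (simp add: B_def)
  have n: "l2n (sq F) \<le> sqrt B * mass_norm X" if "l2n F \<le> mass_norm X" "\<And>x. (cmod (fn F x))\<^sup>2 \<le> B" for F
  proof -
    have "l2n (sq F) \<le> sqrt B * l2n (hcnj F)"
      unfolding sq_def by (rule l2n_mul_bound) (use that(2) in \<open>simp add: real_le_rsqrt\<close>)
    also have "\<dots> \<le> sqrt B * mass_norm X" using that(1) B by (simp add: mult_left_mono)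
    finally show ?thesis .
  qed
  have uv: "l2n (sq (fst X)) \<le> sqrt B * mass_norm X" "l2n (sq (snd X)) \<le> sqrt B * mass_norm X"
    unfolding B_def by (intro n[unfolded B_def] l2n_le_mass_norm fn_sq_bound)+
  have AB: "(sqrt B * mass_norm X) * (sqrt B * mass_norm X) = A"
  proof -
    have "(sqrt B * mass_norm X) * (sqrt B * mass_norm X) = (sqrt B * sqrt B) * (mass_norm X * mass_norm X)" by (simp only: mult_ac)
    also have "sqrt B * sqrt B = B" using B by simp
    finally show ?thesis by (simp add: A_def B_def power3_eq_cube)
  qed
  have i: "\<bar>l2ip F G\<bar> \<le> A" if "l2n F \<le> sqrt B * mass_norm X" "l2n G \<le> sqrt B * mass_norm X" for F G
  proof -
    have "\<bar>l2ip F G\<bar> \<le> l2n F * l2n G" by (rule l2ip_bound)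
    also have "\<dots> \<le> (sqrt B * mass_norm X) * (sqrt B * mass_norm X)" using that B by (intro mult_mono) auto
    finally show ?thesis unfolding AB .
  qed
  let ?uu = "l2ip (sq (fst X)) (sq (fst X))" and ?uv = "l2ip (sq (fst X)) (sq (snd X))" and ?vv = "l2ip (sq (snd X)) (sq (snd X))"
  have A0: "A \<ge> 0" by (simp add: A_def)
  have m: "\<bar>c * z\<bar> \<le> \<bar>c\<bar> * A" if "\<bar>z\<bar> \<le> A" for c z :: real
    unfolding abs_mult using that by (intro mult_left_mono) auto
  have "\<bar>g11 * ?uu\<bar> \<le> \<bar>g11\<bar> * A" "\<bar>g12 * ?uv\<bar> \<le> \<bar>g12\<bar> * A" "\<bar>g22 * ?vv\<bar> \<le> \<bar>g22\<bar> * A"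
    by (intro m i uv)+
  moreover have "0 \<le> \<bar>g11\<bar> * A" "0 \<le> \<bar>g12\<bar> * A" "0 \<le> \<bar>g22\<bar> * A" using A0 by simp_all
  ultimately have 1: "\<bar>(g11 * ?uu + 2 * g12 * ?uv + g22 * ?vv) / 4\<bar> \<le> gsum * A"
    unfolding gsum_def distrib_right by (simp add: mult.assoc) linarith
  have "\<bar>l2ip (fst X) (snd X)\<bar> \<le> l2n (fst X) * l2n (snd X)" by (rule l2ip_bound)
  also have "\<dots> \<le> mass_norm X * mass_norm X" by (intro mult_mono l2n_le_mass_norm) auto
  finally have 2: "\<bar>\<kappa> * l2ip (fst X) (snd X)\<bar> \<le> \<kappa> * (mass_norm X)\<^sup>2"
    using \<kappa> by (simp add: abs_mult power2_eq_square)
  have 3: "\<bar>V_l2ip X X / 2\<bar> \<le> (mass_norm X)\<^sup>2" by (simp flip: mass_norm_sq)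
  have "\<bar>\<Psi> X\<bar> \<le> \<kappa> * (mass_norm X)\<^sup>2 + gsum * A + (mass_norm X)\<^sup>2"
    unfolding \<Psi>_def using 1 2 3 by linarith
  then show ?thesis by (simp add: A_def algebra_simps)
qed

text \<open>All Hamiltonian contributions to the energy balance cancel by skewness; gain and loss remain.\<close>
lemma energy_rate:
  "(X + massop (nonlin X - X)) \<bullet> forcing X + (nonlin X - X) \<bullet> rot X = X \<bullet> gainloss X + V_l2ip (nonlin X) (gainloss X) - V_l2ip X (gainloss X)"
proof -
  define m where "m = nonlin X - X"
  have "massop m \<bullet> rot m = 0" using V_l2ip_rot_self[of m] by (simp add: massop_inner V_l2ip_commute)
  moreover have "X \<bullet> rot m + m \<bullet> rot X = 0" using rot_skew[of X m] by (simp add: inner_commute)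
  moreover have "massop m \<bullet> gainloss X = V_l2ip (nonlin X) (gainloss X) - V_l2ip X (gainloss X)" by (simp add: massop_inner m_def V_l2ip.diff_left)
  ultimately show ?thesis unfolding forcing_def m_def[symmetric] by (simp add: inner_add_left inner_add_right)
qed

text \<open>The constant that makes \<open>energy X + energy_shift Q\<close> dominate \<open>\<parallel>X\<parallel>\<^sup>2 / 4\<close> when the \<open>L\<^sup>2\<close> norm of \<open>X\<close> is at
  most \<open>Q\<close>. The term \<open>9 gsum\<^sup>2 Q\<^sup>6\<close> comes from absorbing \<open>3 gsum Q\<^sup>3 y\<close> into \<open>y\<^sup>2 / 4\<close>, where \<open>y = \<parallel>X\<parallel>\<close>.\<close>
definition energy_shift :: "real \<Rightarrow> real" where "energy_shift Q = (\<kappa> + 1) * Q\<^sup>2 + 9 * gsum\<^sup>2 * Q ^ 6"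

text \<open>The quartic energy is bounded by \<open>3 gsum Q\<^sup>3 \<parallel>X\<parallel>\<close>, linear in the \<open>H\<^sup>1\<close> norm, and linear in it is also the contribution of
  the cubic terms to the energy balance. Both are absorbed by \<open>\<parallel>X\<parallel>\<^sup>2\<close>.\<close>
lemma energy_bounds:
  assumes Q: "mass_norm X \<le> Q"
  shows "(norm X)\<^sup>2 / 4 \<le> energy X + energy_shift Q"
    and "\<bar>X \<bullet> gainloss X + V_l2ip (nonlin X) (gainloss X) - V_l2ip X (gainloss X)\<bar> \<le> 8 * \<gamma> * (energy X + energy_shift Q) + 2 * \<gamma> * energy_shift Q"
proof -
  define y where "y = norm X"
  define p where "p = 3 * gsum * Q ^ 3"
  have y0: "y \<ge> 0" and Q0: "Q \<ge> 0" using Q mass_norm_nonneg[of X] by (auto simp: y_def simp del: mass_norm_nonneg)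
  have q2: "(mass_norm X)\<^sup>2 \<le> Q\<^sup>2" "(mass_norm X) ^ 3 \<le> Q ^ 3" using Q by (auto intro: power_mono)
  have cub: "3 * gsum * (mass_norm X) ^ 3 * y \<le> p * y"
    unfolding p_def using q2 y0 by (intro mult_right_mono mult_left_mono) auto
  have p2: "p\<^sup>2 = 9 * gsum\<^sup>2 * Q ^ 6" by (simp add: p_def power_mult_distrib flip: power_mult)
  have kq: "(\<kappa> + 1) * (mass_norm X)\<^sup>2 \<le> (\<kappa> + 1) * Q\<^sup>2" using q2 \<kappa> by (intro mult_left_mono) auto
  have "0 \<le> (y / 2 - p)\<^sup>2" by simp
  then have s1: "p * y \<le> y\<^sup>2 / 4 + p\<^sup>2" by (simp add: power2_diff power_divide algebra_simps)
  have "0 \<le> (y - p)\<^sup>2" by simp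
  then have s2: "2 * (p * y) \<le> y\<^sup>2 + p\<^sup>2" by (simp add: power2_diff algebra_simps)
  have E: "energy X = y\<^sup>2 / 2 + \<Psi> X" by (simp add: energy_def y_def power2_norm_eq_inner)
  have P: "\<bar>\<Psi> X\<bar> \<le> (\<kappa> + 1) * Q\<^sup>2 + p * y"
    using \<Psi>_bound[of X] cub kq unfolding y_def[symmetric] by linarith
  show 1: "(norm X)\<^sup>2 / 4 \<le> energy X + energy_shift Q"
    unfolding y_def[symmetric] E energy_shift_def p2[symmetric] using P s1 by linarith
  have "X \<bullet> gainloss X = \<gamma> * (norm (fst X))\<^sup>2 - \<gamma> * (norm (snd X))\<^sup>2"
    by (simp add: gainloss_def inner_prod_def power2_norm_eq_inner)
  moreover have "y\<^sup>2 = (norm (fst X))\<^sup>2 + (norm (snd X))\<^sup>2"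
    unfolding y_def by (simp add: norm_prod_def)
  moreover have "0 \<le> \<gamma> * (norm (fst X))\<^sup>2" "0 \<le> \<gamma> * (norm (snd X))\<^sup>2" using \<gamma> by simp_all
  ultimately have a: "\<bar>X \<bullet> gainloss X\<bar> \<le> \<gamma> * y\<^sup>2" by (simp add: distrib_left)
  have "\<kappa> * (mass_norm X)\<^sup>2 \<le> \<kappa> * Q\<^sup>2" using q2 \<kappa> by simp
  then have "\<kappa> * (mass_norm X)\<^sup>2 + 3 * gsum * (mass_norm X) ^ 3 * y \<le> \<kappa> * Q\<^sup>2 + p * y" using cub by linarith
  then have "2 * \<gamma> * (\<kappa> * (mass_norm X)\<^sup>2 + 3 * gsum * (mass_norm X) ^ 3 * y) \<le> 2 * \<gamma> * (\<kappa> * Q\<^sup>2 + p * y)"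
    using \<gamma> by (intro mult_left_mono) auto
  then have b: "\<bar>V_l2ip (nonlin X) (gainloss X)\<bar> \<le> 2 * \<gamma> * (\<kappa> * Q\<^sup>2 + p * y)"
    using V_l2ip_N_gainloss[of X] unfolding y_def[symmetric] by linarith
  have "\<gamma> * (mass_norm X)\<^sup>2 \<le> \<gamma> * Q\<^sup>2" using q2 \<gamma> by simp
  then have c: "\<bar>V_l2ip X (gainloss X)\<bar> \<le> \<gamma> * Q\<^sup>2"
    using V_l2ip_gainloss[of X] by (simp add: V_l2ip_commute mass_norm_sq)
  have "\<gamma> * y\<^sup>2 + 2 * \<gamma> * (\<kappa> * Q\<^sup>2 + p * y) + \<gamma> * Q\<^sup>2 = \<gamma> * (y\<^sup>2 + 2 * \<kappa> * Q\<^sup>2 + 2 * (p * y) + Q\<^sup>2)"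
    by (simp add: algebra_simps)
  also have "\<dots> \<le> \<gamma> * (8 * (energy X + energy_shift Q) + 2 * energy_shift Q)"
  proof (intro mult_left_mono)
    have lin: "a + 2 * k + 2 * b + d \<le> 8 * (a / 4) + 2 * (k + d + e)"
      if "2 * b \<le> a + e" "0 \<le> d" "0 \<le> e" for a b d e k :: real
      using that by simp
    have "y\<^sup>2 + 2 * \<kappa> * Q\<^sup>2 + 2 * (p * y) + Q\<^sup>2 \<le> 8 * (y\<^sup>2 / 4) + 2 * ((\<kappa> + 1) * Q\<^sup>2 + p\<^sup>2)"
      unfolding distrib_right mult_1 mult.assoc[of 2 \<kappa>] by (rule lin[OF s2]) simp_all
    also have "\<dots> \<le> 8 * (energy X + energy_shift Q) + 2 * energy_shift Q"
      using 1 unfolding energy_shift_def p2[symmetric] y_def[symmetric]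
      by (intro add_mono[OF mult_left_mono order_refl]) simp_all
    finally show "y\<^sup>2 + 2 * \<kappa> * Q\<^sup>2 + 2 * (p * y) + Q\<^sup>2 \<le> 8 * (energy X + energy_shift Q) + 2 * energy_shift Q" .
  qed (use \<gamma> in simp)
  finally show "\<bar>X \<bullet> gainloss X + V_l2ip (nonlin X) (gainloss X) - V_l2ip X (gainloss X)\<bar> \<le> 8 * \<gamma> * (energy X + energy_shift Q) + 2 * \<gamma> * energy_shift Q"
    using a b c by (simp add: algebra_simps)
qed

text \<open>The mass bounds \<open>Q\<close> on the time interval, and Gronwall's inequality bounds the shifted energy. The
  bound \<open>M\<close> depends on the initial value and on \<open>\<tau>0\<close> but on neither the solution nor its lifespan
  \<open>\<tau>\<close>; this is what the continuation argument needs.\<close>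
lemma a_priori_bound:
  "\<exists>M\<ge>0. \<forall>U \<tau>. \<tau> \<le> \<tau>0 \<longrightarrow> Vsol \<tau> U \<longrightarrow> U 0 = U0 \<longrightarrow>
     (\<forall>t. \<bar>t\<bar> < \<tau> \<longrightarrow> ((\<lambda>t. energy (U t)) has_real_derivative
        (U t + massop (nonlin (U t) - U t)) \<bullet> forcing (U t) + (nonlin (U t) - U t) \<bullet> rot (U t)) (at t)) \<longrightarrow>
     (\<forall>t. \<bar>t\<bar> < \<tau> \<longrightarrow> norm (U t) \<le> M)"
proof -
  define Q where "Q = sqrt (V_l2ip U0 U0 * exp (2 * \<gamma> * \<tau>0))"
  define c where "c = energy_shift Q"
  define K where "K = (energy U0 + c + c / 4) * exp (8 * \<gamma> * \<tau>0)"
  have nn: "V_l2ip X X \<ge> 0" for X by (simp flip: mass_norm_sq)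
  have c0: "c \<ge> 0" using \<kappa> by (simp add: c_def energy_shift_def)
  show ?thesis
  \<comment> \<open>The modulus makes the bound meaningful also when no solution exists and \<open>K\<close> could be negative.\<close>
  proof (intro exI[of _ "sqrt (4 * \<bar>K\<bar>)"] conjI allI impI)
    fix U \<tau> t
    assume \<tau>: "\<tau> \<le> \<tau>0" and U: "Vsol \<tau> U" and 0: "U 0 = U0"
      and E: "\<forall>t. \<bar>t\<bar> < \<tau> \<longrightarrow> ((\<lambda>t. energy (U t)) has_real_derivative
        (U t + massop (nonlin (U t) - U t)) \<bullet> forcing (U t) + (nonlin (U t) - U t) \<bullet> rot (U t)) (at t)"
      and t: "\<bar>t\<bar> < \<tau>"
    have qQ: "mass_norm (U s) \<le> Q" if s: "\<bar>s\<bar> < \<tau>" for s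
    proof -
      have "V_l2ip (U s) (U s) \<le> V_l2ip U0 U0 * exp (2 * \<gamma> * \<bar>s\<bar>)" using mass_growth[OF U s] by (simp add: 0)
      also have "\<dots> \<le> V_l2ip U0 U0 * exp (2 * \<gamma> * \<tau>0)" using s \<tau> \<gamma> nn by (intro mult_left_mono) auto
      finally show ?thesis unfolding Q_def by (intro real_le_rsqrt) (simp add: mass_norm_sq)
    qed
    have "energy (U t) + c \<le> ((energy (U 0) + c) + 2 * \<gamma> * c / (8 * \<gamma>)) * exp (8 * \<gamma> * \<bar>t\<bar>) - 2 * \<gamma> * c / (8 * \<gamma>)"
    proof (rule gronwall[OF _ _ _ t])
      fix s assume s: "\<bar>s\<bar> < \<tau>"
      show "((\<lambda>t. energy (U t) + c) has_real_derivative
          U s \<bullet> gainloss (U s) + V_l2ip (nonlin (U s)) (gainloss (U s)) - V_l2ip (U s) (gainloss (U s))) (at s)"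
        using DERIV_add[OF E[rule_format, OF s] DERIV_const[of c]] unfolding energy_rate by simp
      show "\<bar>U s \<bullet> gainloss (U s) + V_l2ip (nonlin (U s)) (gainloss (U s)) - V_l2ip (U s) (gainloss (U s))\<bar>
          \<le> 8 * \<gamma> * (energy (U s) + c) + 2 * \<gamma> * c"
        unfolding c_def by (rule energy_bounds(2)[OF qQ[OF s]])
    qed (use \<gamma> in simp)
    also have "2 * \<gamma> * c / (8 * \<gamma>) = c / 4" using \<gamma> by simp
    also have "((energy (U 0) + c) + c / 4) * exp (8 * \<gamma> * \<bar>t\<bar>) - c / 4 \<le> K"
    proof -
      have "0 \<le> energy (U 0) + c" using energy_bounds(1)[OF qQ[of 0]] t by (simp add: c_def) (smt (verit) zero_le_power2)
      moreover have "exp (8 * \<gamma> * \<bar>t\<bar>) \<le> exp (8 * \<gamma> * \<tau>0)" using t \<tau> \<gamma> by simp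
      ultimately have "((energy (U 0) + c) + c / 4) * exp (8 * \<gamma> * \<bar>t\<bar>) \<le> K"
        unfolding K_def 0 using c0 by (intro mult_left_mono) auto
      then show ?thesis using c0 by linarith
    qed
    finally have "energy (U t) + c \<le> K" .
    then have "(norm (U t))\<^sup>2 \<le> 4 * \<bar>K\<bar>" using energy_bounds(1)[OF qQ[OF t]] unfolding c_def by linarith
    then show "norm (U t) \<le> sqrt (4 * \<bar>K\<bar>)" by (rule real_le_rsqrt)
  qed simp
qed

lemma truncated_skew_flow:
  assumes r: "r \<ge> 0"
  shows "\<exists>L. skew_flow massop rot (\<lambda>X. forcing (retract r X)) (\<lambda>X. nonlin X - X) \<Psi> L"
proof -
  obtain L where L: "L > 0" "\<And>U W. norm U \<le> r \<Longrightarrow> norm W \<le> r \<Longrightarrow> norm (forcing U - forcing W) \<le> L * norm (U - W)"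
    using forcing_Lipschitz[of r] by blast
  have "norm (forcing (retract r X) - forcing (retract r Y)) \<le> (L * 2) * norm (X - Y)" for X Y
  proof -
    have "norm (forcing (retract r X) - forcing (retract r Y)) \<le> L * norm (retract r X - retract r Y)"
      by (intro L norm_retract r)
    also have "\<dots> \<le> L * (2 * norm (X - Y))" using L by (intro mult_left_mono retract_lipschitz r) simp
    finally show ?thesis by simp
  qed
  then have "skew_flow massop rot (\<lambda>X. forcing (retract r X)) (\<lambda>X. nonlin X - X) \<Psi> (L * 2)"
  proof (intro skew_flow.intro)
    fix X Y :: V
    show "massop X \<bullet> Y = X \<bullet> massop Y"
      unfolding inner_commute[of X "massop Y"] massop_inner by (rule V_l2ip_commute)
    show "norm (forcing (retract r X) - forcing (retract r Y)) \<le> L * 2 * norm (X - Y)" by fact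
    show "(\<Psi> has_derivative (\<lambda>h. massop (nonlin X - X) \<bullet> h)) (at X)" by (rule \<Psi>_derivative)
    show "0 < L * 2" using L by simp
  qed (rule massop_bounded_linear rot_bounded_linear massop_pos rot_skew rot_norm rot_massop m_continuous; assumption)+
  then show ?thesis by blast
qed

text \<open>Solve the equation retracted to a ball of radius \<open>r > M\<close> that contains the initial value. If the solution left the ball, let \<open>s\<close> be a
  time of smallest modulus with \<open>\<parallel>U s\<parallel> \<ge> r\<close>. For \<open>\<bar>t\<bar> < \<bar>s\<bar>\<close> the retraction is inactive and the a priori
  bound gives \<open>\<parallel>U t\<parallel> \<le> M\<close>, so \<open>\<parallel>U s\<parallel> \<le> M < r\<close> by continuity.\<close>
lemma Vsol_exists:
  assumes \<tau>: "\<tau> > 0"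
  shows "\<exists>U. Vsol \<tau> U \<and> U 0 = U0"
proof -
  obtain M where M: "M \<ge> 0" "\<And>U s t. s \<le> \<tau> \<Longrightarrow> Vsol s U \<Longrightarrow> U 0 = U0 \<Longrightarrow>
     (\<And>t. \<bar>t\<bar> < s \<Longrightarrow> ((\<lambda>t. energy (U t)) has_real_derivative
        (U t + massop (nonlin (U t) - U t)) \<bullet> forcing (U t) + (nonlin (U t) - U t) \<bullet> rot (U t)) (at t)) \<Longrightarrow>
     \<bar>t\<bar> < s \<Longrightarrow> norm (U t) \<le> M"
    using a_priori_bound[of \<tau> U0] by blast
  define r where "r = max (M + 1) (norm U0 + 1)"
  have r: "r \<ge> 0" "M < r" "norm U0 < r" using M(1) by (auto simp: r_def)
  obtain L where "skew_flow massop rot (\<lambda>X. forcing (retract r X)) (\<lambda>X. nonlin X - X) \<Psi> L"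
    using truncated_skew_flow[OF r(1)] by blast
  then interpret skew_flow massop rot "\<lambda>X. forcing (retract r X)" "\<lambda>X. nonlin X - X" \<Psi> L .
  obtain U where sol: "solves U" and 0: "U 0 = U0" using solution_exists by blast
  have Uc: "continuous_on UNIV U" using sol by (simp add: solves_def)
  have F: "forcing (retract r (U t)) = forcing (U t)" if "norm (U t) \<le> r" for t
    using that by (simp add: retract_def)
  have V: "Vsol s U" if "\<And>t. \<bar>t\<bar> < s \<Longrightarrow> norm (U t) \<le> r" for s
    unfolding Vsol_def
  proof (intro conjI allI impI)
    fix t assume t: "\<bar>t\<bar> < s"
    have "((\<lambda>t. massop (U t)) has_vector_derivative rot (U t) + massop (forcing (retract r (U t)))) (at t)"
      using sol by (simp add: solves_def)
    then show "((\<lambda>t. massop (U t)) has_vector_derivative rot (U t) + massop (forcing (U t))) (at t)"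
      unfolding F[OF that[OF t]] .
  qed (rule Uc)
  have E: "((\<lambda>t. energy (U t)) has_real_derivative
        (U t + massop (nonlin (U t) - U t)) \<bullet> forcing (U t) + (nonlin (U t) - U t) \<bullet> rot (U t)) (at t)" if "norm (U t) \<le> r" for t
  proof -
    have "((\<lambda>t. energy (U t)) has_real_derivative
        (U t + massop (nonlin (U t) - U t)) \<bullet> forcing (retract r (U t)) + (nonlin (U t) - U t) \<bullet> rot (U t)) (at t)"
      using sol unfolding solves_def energy_def by blast
    then show ?thesis unfolding F[OF that] .
  qed
  have "norm (U t) \<le> r" if t: "\<bar>t\<bar> < \<tau>" for t
  proof (rule ccontr)
    assume "\<not> norm (U t) \<le> r"
    define S where "S = {-\<bar>t\<bar>..\<bar>t\<bar>} \<inter> {s. r \<le> norm (U s)}"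
    have "closed {s. r \<le> norm (U s)}" by (intro closed_Collect_le continuous_intros Uc)
    then have "compact S" unfolding S_def by (intro compact_Int_closed) auto
    moreover have "t \<in> S" using \<open>\<not> norm (U t) \<le> r\<close> by (auto simp: S_def)
    then have "S \<noteq> {}" by blast
    ultimately have "\<exists>s\<in>S. \<forall>y\<in>S. \<bar>s\<bar> \<le> \<bar>y\<bar>"
      by (intro continuous_attains_inf continuous_intros)
    then obtain s where s: "s \<in> S" "\<And>y. y \<in> S \<Longrightarrow> \<bar>s\<bar> \<le> \<bar>y\<bar>" by blast
    have st: "\<bar>s\<bar> \<le> \<bar>t\<bar>" "norm (U s) \<ge> r" using s(1) by (auto simp: S_def)
    have lt: "norm (U y) \<le> r" if "\<bar>y\<bar> < \<bar>s\<bar>" for y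
    proof (rule ccontr)
      assume "\<not> norm (U y) \<le> r"
      then have "y \<in> S" using that st by (auto simp: S_def)
      then show False using s(2)[of y] that by simp
    qed
    have s0: "s \<noteq> 0" using st(2) r(3) by (auto simp: 0)
    have le: "norm (U y) \<le> M" if y: "\<bar>y\<bar> < \<bar>s\<bar>" for y
      by (rule M(2)[of "\<bar>s\<bar>" U y]) (use st t V lt E 0 y in auto)
    have "(\<lambda>n. s * (1 - inverse (real (Suc n)))) \<longlonglongrightarrow> s * (1 - 0)"
      by (intro tendsto_intros LIMSEQ_inverse_real_of_nat)
    then have "(\<lambda>n. U (s * (1 - inverse (real (Suc n))))) \<longlonglongrightarrow> U (s * (1 - 0))"
      by (rule continuous_on_tendsto_compose[OF Uc]) simp_all
    then have "(\<lambda>n. norm (U (s * (1 - inverse (real (Suc n)))))) \<longlonglongrightarrow> norm (U s)"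
      using tendsto_norm by fastforce
    moreover have "norm (U (s * (1 - inverse (real (Suc n))))) \<le> M" for n
    proof (rule le)
      have "0 < inverse (real (Suc n))" "inverse (real (Suc n)) \<le> 1" by (auto simp: field_simps)
      then have "\<bar>1 - inverse (real (Suc n))\<bar> < 1" by linarith
      then show "\<bar>s * (1 - inverse (real (Suc n)))\<bar> < \<bar>s\<bar>" using s0 unfolding abs_mult by simp
    qed
    ultimately have "norm (U s) \<le> M" by (intro LIMSEQ_le_const2) auto
    then show False using st r by linarith
  qed
  then show ?thesis using V 0 by blast
qed

theorem global_solution: "\<exists>U. U 0 = U0 \<and> (\<forall>\<tau>. Vsol \<tau> U)"
proof -
  have "\<forall>n. \<exists>U. Vsol (real (Suc n)) U \<and> U 0 = U0" using Vsol_exists by simp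
  from choice[OF this] obtain U where U: "\<And>n. Vsol (real (Suc n)) (U n)" "\<And>n. U n 0 = U0" by blast
  have Vmono: "Vsol a X" if "Vsol b X" "a \<le> b" for a b X using that by (auto simp: Vsol_def)
  have eq: "U n t = U k t" if "\<bar>t\<bar> < real (Suc n)" "n \<le> k" for n k t
    by (rule Vsol_unique[OF U(1) Vmono[OF U(1)] _ that(1)]) (use that U in auto)
  define W where "W t = U (nat \<lceil>\<bar>t\<bar>\<rceil>) t" for t
  have W: "W t = U n t" if "\<bar>t\<bar> < real (Suc n)" for t n
  proof -
    have "\<bar>t\<bar> < real (Suc (nat \<lceil>\<bar>t\<bar>\<rceil>))" by linarith
    then show ?thesis unfolding W_def using eq[of t] that by (metis nle_le)
  qed
  have loc: "\<exists>n e. e > 0 \<and> \<bar>t\<bar> < real (Suc n) \<and> (\<forall>s. dist s t < e \<longrightarrow> W s = U n s)" for t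
  proof -
    obtain n where "\<bar>t\<bar> + 1 < real n" using reals_Archimedean2 by blast
    then have "\<bar>t\<bar> < real (Suc n)" "\<forall>s. dist s t < 1 \<longrightarrow> W s = U n s"
      by (auto intro!: W simp: dist_real_def)
    then show ?thesis by (intro exI[of _ n] exI[of _ "1::real"]) auto
  qed
  have Wsol: "continuous (at t) W \<and> ((\<lambda>t. massop (W t)) has_vector_derivative rot (W t) + massop (forcing (W t))) (at t)" for t
  proof -
    obtain n e where ne: "e > 0" "\<bar>t\<bar> < real (Suc n)" "\<And>s. dist s t < e \<Longrightarrow> W s = U n s" using loc[of t] by blast
    have "continuous (at t) (U n)" by (rule VsolD(1)[OF U(1)])
    moreover have "\<forall>\<^sub>F s in nhds t. U n s = W s"
      using ne(1,3) unfolding eventually_nhds_metric by metis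
    ultimately have 1: "continuous (at t) W"
      by (simp add: isCont_cong)
    have "((\<lambda>t. massop (U n t)) has_vector_derivative rot (W t) + massop (forcing (W t))) (at t)"
      using VsolD(2)[OF U(1) ne(2)] ne(3)[of t] ne(1) by simp
    then have "((\<lambda>t. massop (W t)) has_vector_derivative rot (W t) + massop (forcing (W t))) (at t)"
      by (rule has_vector_derivative_transform_within[OF _ ne(1)]) (auto simp: ne(3))
    then show ?thesis using 1 by blast
  qed
  then have "Vsol \<tau> W" for \<tau> by (auto simp: Vsol_def intro: continuous_at_imp_continuous_on)
  moreover have "W 0 = U0" by (simp add: W_def U)
  ultimately show ?thesis by blast
qed

end

section \<open>Solutions in the sense of \<open>H\<^sup>-\<^sup>1\<close>\<close>

text \<open>The mean value theorem for \<open>s \<mapsto> f s \<bullet> w - s (g t \<bullet> w)\<close>, where \<open>w\<close> is the remainder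
  \<open>f y - f t - (y - t) g t\<close> itself.\<close>
lemma weak_imp_strong_derivative:
  fixes f g :: "real \<Rightarrow> 'a::real_inner"
  assumes d: "\<And>t w. ((\<lambda>t. f t \<bullet> w) has_real_derivative g t \<bullet> w) (at t)"
    and g: "continuous (at t) g"
  shows "(f has_vector_derivative g t) (at t)"
  unfolding has_vector_derivative_def has_derivative_at_alt
proof (intro conjI allI impI)
  fix e :: real assume e: "e > 0"
  obtain \<delta> where \<delta>: "\<delta> > 0" "\<And>s. dist s t < \<delta> \<Longrightarrow> dist (g s) (g t) < e"
    using g e unfolding continuous_at_eps_delta by blast
  have "norm (f y - f t - (y - t) *\<^sub>R g t) \<le> e * norm (y - t)" if y: "norm (y - t) < \<delta>" for y
  proof -
    define w where "w = f y - f t - (y - t) *\<^sub>R g t"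
    define h where "h s = f s \<bullet> w - s * (g t \<bullet> w)" for s
    have "norm (h y - h t) \<le> (e * norm w) * norm (y - t)"
    proof (rule field_differentiable_bound[of "ball t \<delta>" h "\<lambda>s. g s \<bullet> w - g t \<bullet> w"])
      show "(h has_field_derivative g s \<bullet> w - g t \<bullet> w) (at s within ball t \<delta>)" for s
        unfolding h_def by (auto intro!: derivative_eq_intros has_field_derivative_at_within[OF d])
      show "norm (g s \<bullet> w - g t \<bullet> w) \<le> e * norm w" if "s \<in> ball t \<delta>" for s
      proof -
        have "norm (g s - g t) \<le> e" using \<delta>(2)[of s] that by (simp add: dist_norm abs_minus_commute)
        then have "norm (g s - g t) * norm w \<le> e * norm w" by (intro mult_right_mono) auto
        then show ?thesis
          using Cauchy_Schwarz_ineq2[of "g s - g t" w] by (simp add: inner_diff_left)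
      qed
    qed (use y \<delta> in \<open>auto simp: dist_norm norm_minus_commute\<close>)
    moreover have "h y - h t = w \<bullet> w"
      by (simp add: h_def w_def inner_diff_left algebra_simps)
    ultimately have "norm w * norm w \<le> norm w * (e * norm (y - t))"
      by (simp add: mult_ac power2_eq_square flip: power2_norm_eq_inner)
    then show ?thesis unfolding w_def[symmetric] using e by (cases "w = 0") auto
  qed
  then show "\<exists>d>0. \<forall>y. norm (y - t) < d \<longrightarrow> norm (f y - f t - (y - t) *\<^sub>R g t) \<le> e * norm (y - t)"
    using \<delta>(1) by blast
qed (rule bounded_linear_scaleR_left)

text \<open>The continuous representative of a member of \<open>H\<^sup>1\<close>.\<close>
definition rep :: "(real \<Rightarrow> complex) \<Rightarrow> h1" where
  "rep f = (SOME P. AE x in lborel. f x = fn P x)"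

lemma H1_measurable: "f \<in> H1 \<Longrightarrow> f \<in> borel_measurable borel"
  by (simp add: H1_def L2_def)

lemma rep_AE:
  assumes "f \<in> H1" shows "AE x in lborel. f x = fn (rep f) x"
proof -
  obtain F where F: "ac_primitive F (weak_deriv f)" "AE x in lborel. f x = F x"
    using H1_continuous_representative(2)[OF assms] by blast
  have fL2: "f \<in> L2" using assms by (simp add: H1_def)
  have "F \<in> L2"
    using L2_norm_cong_AE(1)[OF fL2 _ F(2)] borel_measurable_continuous_onI[OF ac_primitive_continuous[OF F(1)]] by simp
  from Abs_h1(1)[OF this H1_continuous_representative(1)[OF assms] F(1)]
  have "AE x in lborel. f x = fn (Abs_h1 F) x" using F(2) by simp
  then show ?thesis unfolding rep_def by (rule someI)
qed

lemma rep_unique: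
  assumes "f \<in> H1" "AE x in lborel. f x = fn P x" shows "rep f = P"
proof -
  have "AE x in lborel. fn (rep f) x = fn P x" using rep_AE[OF assms(1)] assms(2) by eventually_elim simp
  then have "fn (rep f) = fn P" by (intro continuous_AE_eq fn_continuous)
  then show ?thesis by (simp add: fn_inject)
qed

lemma rep_fn [simp]: "rep (fn P) = P"
  by (rule rep_unique[OF fn_H1]) simp

lemma weak_deriv_rep:
  assumes "f \<in> H1" shows "AE x in lborel. weak_deriv f x = dr (rep f) x"
proof -
  obtain F where F: "ac_primitive F (weak_deriv f)" "AE x in lborel. f x = F x"
    using H1_continuous_representative(2)[OF assms] by blast
  have "AE x in lborel. F x = fn (rep f) x" using rep_AE[OF assms] F(2) by eventually_elim simp
  then have "F = fn (rep f)" by (intro continuous_AE_eq fn_continuous ac_primitive_continuous[OF F(1)])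
  then show ?thesis using ac_primitive_unique[OF F(1), of "dr (rep f)"] ac_fn by simp
qed

lemma H1_norm_rep:
  assumes "f \<in> H1" shows "H1_norm f = norm (rep f)"
proof -
  have "L2_norm f = L2_norm (fn (rep f))"
    using assms by (intro L2_norm_cong_AE(2) rep_AE fn_measurable) (simp add: H1_def)
  moreover have "L2_norm (weak_deriv f) = L2_norm (dr (rep f))"
    by (intro L2_norm_cong_AE(2) weak_deriv_rep assms L2_D(1)[OF dr_L2] H1_continuous_representative(1))
  ultimately show ?thesis by (simp add: H1_norm_def norm_h1_def inner_h1_self)
qed

lemma H1_cong_AE:
  assumes f: "f \<in> borel_measurable borel" and ae: "AE x in lborel. f x = fn P x"
  shows "f \<in> H1"
proof -
  have ae': "AE x in lborel. fn P x = f x" using ae by eventually_elim simp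
  have "has_weak_deriv f (dr P)"
    unfolding has_weak_deriv_def
  proof (intro allI impI)
    fix \<phi> assume \<phi>: "test_function \<phi>"
    have [measurable]: "deriv \<phi> \<in> borel_measurable borel"
      by (rule borel_measurable_continuous_onI[OF test_function_props(3)[OF \<phi>]])
    note [measurable] = f fn_measurable
    have "(\<integral>x. deriv \<phi> x *\<^sub>R f x \<partial>lborel) = (\<integral>x. deriv \<phi> x *\<^sub>R fn P x \<partial>lborel)"
      by (rule integral_cong_AE) (use ae in auto)
    then show "(\<integral>x. deriv \<phi> x *\<^sub>R f x \<partial>lborel) = - (\<integral>x. \<phi> x *\<^sub>R dr P x \<partial>lborel)"
      using ac_primitive_has_weak_deriv[OF ac_fn, of P] \<phi> by (simp add: has_weak_deriv_def)
  qed
  then show ?thesis using L2_norm_cong_AE(1)[OF fn_L2 f ae'] dr_L2 by (auto simp: H1_def)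
qed

lemma rep_combination:
  assumes "\<phi> \<in> H1" "\<psi> \<in> H1"
  shows "(\<lambda>x. a * \<phi> x + b * \<psi> x) \<in> H1"
    and "rep (\<lambda>x. a * \<phi> x + b * \<psi> x) = cscale a (rep \<phi>) + cscale b (rep \<psi>)"
proof -
  have ae: "AE x in lborel. a * \<phi> x + b * \<psi> x = fn (cscale a (rep \<phi>) + cscale b (rep \<psi>)) x"
    using rep_AE[OF assms(1)] rep_AE[OF assms(2)] by eventually_elim simp
  note [measurable] = H1_measurable[OF assms(1)] H1_measurable[OF assms(2)]
  show m: "(\<lambda>x. a * \<phi> x + b * \<psi> x) \<in> H1" by (rule H1_cong_AE[OF _ ae]) measurable
  show "rep (\<lambda>x. a * \<phi> x + b * \<psi> x) = cscale a (rep \<phi>) + cscale b (rep \<psi>)" by (rule rep_unique[OF m ae])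
qed

lemma rep_difference:
  assumes "f \<in> H1" "h \<in> H1"
  shows "H1_norm (\<lambda>x. f x - h x) = norm (rep f - rep h)"
proof -
  have "(\<lambda>x. 1 * f x + (-1) * h x) \<in> H1" "rep (\<lambda>x. 1 * f x + (-1) * h x) = cscale 1 (rep f) + cscale (-1) (rep h)"
    by (rule rep_combination[OF assms])+
  moreover have "cscale 1 (rep f) + cscale (-1) (rep h) = rep f - rep h" by (rule h1_eqI) simp
  ultimately show ?thesis using H1_norm_rep[of "\<lambda>x. f x - h x"] by simp
qed

text \<open>The complex bilinear version of the inner product of \<open>H\<^sup>1\<close>; it has the bilinear form of the pairing of
  \<open>H\<^sup>-\<^sup>1\<close> with \<open>H\<^sup>1\<close> and represents functionals.\<close>
definition h1_pairing :: "h1 \<Rightarrow> h1 \<Rightarrow> complex" where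
  "h1_pairing A P = (\<integral>x. fn A x * fn P x \<partial>lborel) + (\<integral>x. dr A x * dr P x \<partial>lborel)"

lemma integral_mult_cong_AE:
  assumes "f \<in> L2" "f' \<in> L2" "g \<in> L2" "g' \<in> L2"
    and "AE x in lborel. f x = f' x" "AE x in lborel. g x = g' x"
  shows "(\<integral>x. f x * g x \<partial>lborel) = (\<integral>x. f' x * g' x \<partial>lborel)"
proof (rule integral_cong_AE)
  show "AE x in lborel. f x * g x = f' x * g' x" using assms(5,6) by eventually_elim simp
qed (intro borel_measurable_integrable L2_mult_integrable(1) assms)+

lemma h1_pairing_commute: "h1_pairing A P = h1_pairing P A"
  by (simp add: h1_pairing_def mult.commute)

lemma h1_pairing_add_left: "h1_pairing (A + B) P = h1_pairing A P + h1_pairing B P"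
proof -
  have "(\<integral>x. dr (A + B) x * dr P x \<partial>lborel) = (\<integral>x. (dr A x + dr B x) * dr P x \<partial>lborel)"
    by (intro integral_mult_cong_AE dr_L2 L2_add dr_plus) simp
  then show ?thesis
    by (simp add: h1_pairing_def distrib_right Bochner_Integration.integral_add L2_mult_integrable(1) fn_L2 dr_L2)
qed

lemma h1_pairing_cscale_left: "h1_pairing (cscale c A) P = c * h1_pairing A P"
proof -
  have "(\<integral>x. dr (cscale c A) x * dr P x \<partial>lborel) = (\<integral>x. (c * dr A x) * dr P x \<partial>lborel)"
    by (intro integral_mult_cong_AE dr_L2 L2_cmult dr_cscale) simp
  then show ?thesis by (simp add: h1_pairing_def mult.assoc distrib_left)
qed

lemma h1_pairing_scaleR_left: "h1_pairing (r *\<^sub>R A) P = r *\<^sub>R h1_pairing A P"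
  by (simp add: scaleR_h1_def h1_pairing_cscale_left scaleR_conv_of_real)

lemma h1_pairing_diff_left: "h1_pairing (A - B) P = h1_pairing A P - h1_pairing B P"
  by (simp add: minus_h1_def h1_pairing_add_left h1_pairing_cscale_left)

lemma Re_h1_pairing: "Re (h1_pairing A P) = A \<bullet> hcnj P"
proof -
  have "L2_inner (dr A) (dr (hcnj P)) = L2_inner (dr A) (\<lambda>x. cnj (dr P x))"
    by (intro L2_inner_cong_AE dr_L2 L2_cnj dr_hcnj) simp
  then show ?thesis by (simp add: h1_pairing_def inner_h1_def L2_inner_def)
qed

lemma h1_pairing_bound: "cmod (h1_pairing A P) \<le> 2 * norm A * norm P"
proof -
  have "cmod (h1_pairing A P) \<le> L2_norm (fn A) * L2_norm (fn P) + L2_norm (dr A) * L2_norm (dr P)"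
    unfolding h1_pairing_def
    by (rule order_trans[OF norm_triangle_ineq]) (intro add_mono L2_mult_integrable(3) fn_L2 dr_L2)
  also have "\<dots> \<le> norm A * norm P + norm A * norm P"
    by (intro add_mono mult_mono L2_norm_fn_le L2_norm_dr_le) (auto simp: L2_norm_nonneg)
  finally show ?thesis by simp
qed

text \<open>Real parts determine a complex-linear functional.\<close>
lemma complex_linear_eqI:
  fixes f h :: "h1 \<Rightarrow> complex"
  assumes "\<And>P. f (cscale (-\<i>) P) = -\<i> * f P" "\<And>P. h (cscale (-\<i>) P) = -\<i> * h P" "\<And>P. Re (f P) = Re (h P)"
  shows "f P = h P"
proof (rule complex_eqI)
  show "Im (f P) = Im (h P)" using assms(3)[of "cscale (-\<i>) P"] by (simp add: assms(1,2))
qed (rule assms(3))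

text \<open>The element \<open>massop X\<close> represents the functional given by \<open>X\<close> through the inclusion of \<open>L\<^sup>2\<close> in
  \<open>H\<^sup>-\<^sup>1\<close>, so differentiation of \<open>massop U\<close> in \<open>H\<^sup>1\<close> is differentiation of \<open>U\<close> in \<open>H\<^sup>-\<^sup>1\<close>.\<close>
lemma h1_pairing_massop:
  "h1_pairing (fst (massop X)) P = (\<integral>x. fn (fst X) x * fn P x \<partial>lborel)"
  "h1_pairing (snd (massop X)) P = (\<integral>x. fn (snd X) x * fn P x \<partial>lborel)"
proof -
  have l: "(\<integral>x. fn A x * fn (cscale c Q) x \<partial>lborel) = c * (\<integral>x. fn A x * fn Q x \<partial>lborel)" for A c Q
    by (simp add: mult.left_commute)
  have r: "l2ip A (hcnj Q) = Re (\<integral>x. fn A x * fn Q x \<partial>lborel)" for A Q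
    by (simp add: l2ip_def L2_inner_def)
  show "h1_pairing (fst (massop X)) P = (\<integral>x. fn (fst X) x * fn P x \<partial>lborel)"
  proof (rule complex_linear_eqI[where f = "h1_pairing (fst (massop X))"])
    show "Re (h1_pairing (fst (massop X)) Q) = Re (\<integral>x. fn (fst X) x * fn Q x \<partial>lborel)" for Q
      using massop_inner[of X "(hcnj Q, 0)"] by (simp add: Re_h1_pairing r inner_prod_def V_l2ip_def l2ip.zero_right)
  qed (simp_all only: l h1_pairing_commute[of "fst (massop X)"] h1_pairing_cscale_left)
  show "h1_pairing (snd (massop X)) P = (\<integral>x. fn (snd X) x * fn P x \<partial>lborel)"
  proof (rule complex_linear_eqI[where f = "h1_pairing (snd (massop X))"])
    show "Re (h1_pairing (snd (massop X)) Q) = Re (\<integral>x. fn (snd X) x * fn Q x \<partial>lborel)" for Q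
      using massop_inner[of X "(0, hcnj Q)"] by (simp add: Re_h1_pairing r inner_prod_def V_l2ip_def l2ip.zero_right)
  qed (simp_all only: l h1_pairing_commute[of "snd (massop X)"] h1_pairing_cscale_left)
qed

lemma L2_to_Hm1_rep:
  assumes "f \<in> H1" "\<phi> \<in> H1"
  shows "L2_to_Hm1 f \<phi> = (\<integral>x. fn (rep f) x * fn (rep \<phi>) x \<partial>lborel)"
  unfolding L2_to_Hm1_def
  using assms by (intro integral_mult_cong_AE fn_L2 rep_AE) (auto simp: H1_def)

lemma dxx_rep:
  assumes "f \<in> H1" "\<phi> \<in> H1"
  shows "dxx f \<phi> = - (\<integral>x. dr (rep f) x * dr (rep \<phi>) x \<partial>lborel)"
  unfolding dxx_def
  using assms by (intro arg_cong[where f = uminus] integral_mult_cong_AE dr_L2 weak_deriv_rep H1_continuous_representative(1))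

lemma Hm1_h1_pairing: "(\<lambda>\<phi>. h1_pairing A (rep \<phi>)) \<in> Hm1"
  unfolding Hm1_def
proof (intro CollectI conjI ballI allI exI[of _ "2 * norm A"])
  show "h1_pairing A (rep (\<lambda>x. a * \<phi> x + b * \<psi> x)) = a * h1_pairing A (rep \<phi>) + b * h1_pairing A (rep \<psi>)"
    if "\<phi> \<in> H1" "\<psi> \<in> H1" for \<phi> \<psi> a b
    by (simp add: rep_combination(2)[OF that] h1_pairing_commute[of A] h1_pairing_add_left h1_pairing_cscale_left)
  show "cmod (h1_pairing A (rep \<phi>)) \<le> 2 * norm A * H1_norm \<phi>" if "\<phi> \<in> H1" for \<phi>
    using h1_pairing_bound[of A "rep \<phi>"] by (simp add: H1_norm_rep[OF that])
qed

lemma zero_unit_ball: "(\<lambda>_. 0) \<in> {\<phi> \<in> H1. H1_norm \<phi> \<le> 1}"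
proof -
  have "fn 0 = (\<lambda>_. 0)" by (simp add: fun_eq_iff)
  then show ?thesis using fn_H1[of 0] norm_h1_H1_norm[of 0] by simp
qed

lemma Hm1_norm_le:
  assumes "\<And>\<phi>. \<phi> \<in> H1 \<Longrightarrow> cmod (F \<phi>) \<le> C * H1_norm \<phi>" and C: "C \<ge> 0"
  shows "0 \<le> Hm1_norm F" "Hm1_norm F \<le> C"
proof -
  have le: "cmod (F \<phi>) \<le> C" if "\<phi> \<in> {\<phi> \<in> H1. H1_norm \<phi> \<le> 1}" for \<phi>
    using assms(1)[of \<phi>] that mult_left_mono[of "H1_norm \<phi>" 1 C] C by auto
  show "Hm1_norm F \<le> C"
    unfolding Hm1_norm_def using zero_unit_ball le by (intro cSUP_least) blast+
  show "0 \<le> Hm1_norm F"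
    unfolding Hm1_norm_def using le
    by (intro cSUP_upper2[OF _ zero_unit_ball]) (auto intro!: bdd_aboveI[of _ C])
qed

lemma Hm1_bounded: "F \<in> Hm1 \<Longrightarrow> \<exists>C. \<forall>\<phi>\<in>H1. cmod (F \<phi>) \<le> C * H1_norm \<phi>"
  unfolding Hm1_def by blast

text \<open>The factor \<open>H1_norm \<phi> + 1\<close>, in place of \<open>H1_norm \<phi>\<close>, spares the case of a vanishing norm.\<close>
lemma Hm1_norm_bound:
  assumes F: "F \<in> Hm1" and \<phi>: "\<phi> \<in> H1"
  shows "cmod (F \<phi>) \<le> Hm1_norm F * (H1_norm \<phi> + 1)"
proof -
  obtain C where C: "\<And>\<psi>. \<psi> \<in> H1 \<Longrightarrow> cmod (F \<psi>) \<le> C * H1_norm \<psi>" using Hm1_bounded[OF F] by blast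
  define k where "k = H1_norm \<phi> + 1"
  have k: "k > 0" "H1_norm \<phi> \<le> k" using H1_norm_rep[OF \<phi>] by (auto simp: k_def add_nonneg_pos)
  \<comment> \<open>Linearity of members of \<open>Hm1\<close> is stated for combinations of two functions, whence the summand with factor zero.\<close>
  define \<psi> where "\<psi> = (\<lambda>x. complex_of_real (1 / k) * \<phi> x + 0 * \<phi> x)"
  have \<psi>: "\<psi> \<in> H1" "rep \<psi> = cscale (of_real (1 / k)) (rep \<phi>) + cscale 0 (rep \<phi>)"
    unfolding \<psi>_def by (rule rep_combination[OF \<phi> \<phi>])+
  moreover have "cscale (of_real (1 / k)) (rep \<phi>) + cscale 0 (rep \<phi>) = cscale (of_real (1 / k)) (rep \<phi>)"
    by (rule h1_eqI) simp
  ultimately have "H1_norm \<psi> = H1_norm \<phi> / k"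
    using k by (simp add: H1_norm_rep[OF \<psi>(1)] H1_norm_rep[OF \<phi>] norm_cscale norm_divide)
  then have mem: "\<psi> \<in> {\<phi> \<in> H1. H1_norm \<phi> \<le> 1}" using k \<psi>(1) by simp
  have "cmod (F \<psi>) \<le> Hm1_norm F"
    unfolding Hm1_norm_def
  proof (rule cSUP_upper[OF mem])
    show "bdd_above ((\<lambda>\<phi>. cmod (F \<phi>)) ` {\<phi> \<in> H1. H1_norm \<phi> \<le> 1})"
    proof (rule bdd_aboveI2)
      fix \<psi> assume \<psi>: "\<psi> \<in> {\<phi> \<in> H1. H1_norm \<phi> \<le> 1}"
      then have "0 \<le> H1_norm \<psi>" using H1_norm_rep by simp
      then have "C * H1_norm \<psi> \<le> \<bar>C\<bar> * 1" using \<psi> by (intro mult_mono) auto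
      then show "cmod (F \<psi>) \<le> \<bar>C\<bar>" using C[of \<psi>] \<psi> by simp
    qed
  qed
  moreover have "F \<psi> = of_real (1 / k) * F \<phi>"
  proof -
    have "F \<psi> = of_real (1 / k) * F \<phi> + 0 * F \<phi>"
      using F \<phi> unfolding Hm1_def \<psi>_def by blast
    then show ?thesis by simp
  qed
  ultimately show ?thesis using k unfolding k_def[symmetric] by (simp add: norm_mult norm_divide field_simps)
qed

lemma has_vector_derivative_difference_quotient:
  assumes "(f has_vector_derivative D) (at t)"
  shows "((\<lambda>s. (1 / (s - t)) *\<^sub>R (f s - f t)) \<longlongrightarrow> D) (at t)"
  using has_vector_derivative_quotient[OF assms] by (subst LIM_offset_zero_iff) auto

lemma has_Hm1_time_deriv_of_strong:
  assumes A: "((\<lambda>t. A t) has_vector_derivative D) (at t)"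
    and u: "\<And>s. u s \<in> H1" "\<And>s \<phi>. \<phi> \<in> H1 \<Longrightarrow> L2_to_Hm1 (u s) \<phi> = h1_pairing (A s) (rep \<phi>)"
  shows "has_Hm1_time_deriv u (\<lambda>\<phi>. h1_pairing D (rep \<phi>)) t"
  unfolding has_Hm1_time_deriv_def
proof (intro conjI Hm1_h1_pairing)
  define X where "X s = (1 / (s - t)) *\<^sub>R (A s - A t) - D" for s
  have X: "(X \<longlongrightarrow> 0) (at t)"
    unfolding X_def by (rule LIM_zero[OF has_vector_derivative_difference_quotient[OF A]])
  define Q where "Q s = Hm1_norm (\<lambda>\<phi>. (L2_to_Hm1 (u s) \<phi> - L2_to_Hm1 (u t) \<phi>) / of_real (s - t) - h1_pairing D (rep \<phi>))" for s
  have b: "cmod ((L2_to_Hm1 (u s) \<phi> - L2_to_Hm1 (u t) \<phi>) / of_real (s - t) - h1_pairing D (rep \<phi>)) \<le> 2 * norm (X s) * H1_norm \<phi>"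
    if "\<phi> \<in> H1" for s \<phi>
  proof -
    have "(L2_to_Hm1 (u s) \<phi> - L2_to_Hm1 (u t) \<phi>) / of_real (s - t) - h1_pairing D (rep \<phi>) = h1_pairing (X s) (rep \<phi>)"
      unfolding X_def by (simp add: u(2)[OF that] h1_pairing_diff_left h1_pairing_scaleR_left scaleR_conv_of_real)
    then show ?thesis using h1_pairing_bound[of "X s" "rep \<phi>"] H1_norm_rep[OF that] by simp
  qed
  have Q: "0 \<le> Q s" "Q s \<le> 2 * norm (X s)" for s
    unfolding Q_def by (rule Hm1_norm_le[OF b]; simp)+
  have "(Q \<longlongrightarrow> 0) (at t)"
  proof (rule tendsto_sandwich[where f = "\<lambda>_. 0" and h = "\<lambda>s. 2 * norm (X s)"])
    show "((\<lambda>s. 2 * norm (X s)) \<longlongrightarrow> 0) (at t)"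
      using tendsto_mult_right_zero[OF tendsto_norm_zero[OF X], of 2] .
  qed (auto simp: Q)
  then show "((\<lambda>s. Hm1_norm (\<lambda>\<phi>. (L2_to_Hm1 (u s) \<phi> - L2_to_Hm1 (u t) \<phi>) / of_real (s - t) - h1_pairing D (rep \<phi>))) \<longlongrightarrow> 0) (at t)"
    by (simp add: Q_def[abs_def])
qed

lemma L2_to_Hm1_Hm1:
  assumes "f \<in> H1" shows "L2_to_Hm1 f \<in> Hm1"
  unfolding Hm1_def
proof (intro CollectI conjI ballI allI exI[of _ "L2_norm f"])
  have f: "f \<in> L2" using assms by (simp add: H1_def)
  show "L2_to_Hm1 f (\<lambda>x. a * \<phi> x + b * \<psi> x) = a * L2_to_Hm1 f \<phi> + b * L2_to_Hm1 f \<psi>"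
    if "\<phi> \<in> H1" "\<psi> \<in> H1" for \<phi> \<psi> a b
  proof -
    have "integrable lborel (\<lambda>x. f x * \<phi> x)" "integrable lborel (\<lambda>x. f x * \<psi> x)"
      using that f by (auto intro!: L2_mult_integrable(1) simp: H1_def)
    moreover have "L2_to_Hm1 f (\<lambda>x. a * \<phi> x + b * \<psi> x) = (\<integral>x. a * (f x * \<phi> x) + b * (f x * \<psi> x) \<partial>lborel)"
      by (simp add: L2_to_Hm1_def algebra_simps)
    ultimately show ?thesis by (simp add: L2_to_Hm1_def)
  qed
  show "cmod (L2_to_Hm1 f \<phi>) \<le> L2_norm f * H1_norm \<phi>" if "\<phi> \<in> H1" for \<phi>
  proof -
    have p: "\<phi> \<in> L2" using that by (simp add: H1_def)
    have "cmod (L2_to_Hm1 f \<phi>) \<le> L2_norm f * L2_norm \<phi>"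
      unfolding L2_to_Hm1_def by (rule L2_mult_integrable(3)[OF f p])
    also have "L2_norm \<phi> \<le> H1_norm \<phi>" by (simp add: H1_norm_def)
    finally show ?thesis by (simp add: mult_left_mono L2_norm_nonneg)
  qed
qed

lemma Hm1_quotient_diff:
  assumes "F \<in> Hm1" "G \<in> Hm1" "H \<in> Hm1"
  shows "(\<lambda>\<phi>. (F \<phi> - G \<phi>) / c - H \<phi>) \<in> Hm1"
proof -
  obtain a b d where abd: "\<And>\<phi>. \<phi> \<in> H1 \<Longrightarrow> cmod (F \<phi>) \<le> a * H1_norm \<phi>" "\<And>\<phi>. \<phi> \<in> H1 \<Longrightarrow> cmod (G \<phi>) \<le> b * H1_norm \<phi>"
    "\<And>\<phi>. \<phi> \<in> H1 \<Longrightarrow> cmod (H \<phi>) \<le> d * H1_norm \<phi>" using assms[THEN Hm1_bounded] by blast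
  show ?thesis
    unfolding Hm1_def
  proof (intro CollectI conjI ballI allI exI[of _ "(a + b) / cmod c + d"])
    show "(F (\<lambda>x. s * \<phi> x + r * \<psi> x) - G (\<lambda>x. s * \<phi> x + r * \<psi> x)) / c - H (\<lambda>x. s * \<phi> x + r * \<psi> x)
      = s * ((F \<phi> - G \<phi>) / c - H \<phi>) + r * ((F \<psi> - G \<psi>) / c - H \<psi>)" if "\<phi> \<in> H1" "\<psi> \<in> H1" for \<phi> \<psi> s r
    proof -
      have "F (\<lambda>x. s * \<phi> x + r * \<psi> x) = s * F \<phi> + r * F \<psi>" "G (\<lambda>x. s * \<phi> x + r * \<psi> x) = s * G \<phi> + r * G \<psi>"
        "H (\<lambda>x. s * \<phi> x + r * \<psi> x) = s * H \<phi> + r * H \<psi>" using assms that unfolding Hm1_def by blast+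
      then show ?thesis by (simp only: diff_divide_distrib add_divide_distrib distrib_left right_diff_distrib) (simp add: algebra_simps)
    qed
    show "cmod ((F \<phi> - G \<phi>) / c - H \<phi>) \<le> ((a + b) / cmod c + d) * H1_norm \<phi>" if "\<phi> \<in> H1" for \<phi>
    proof -
      have "cmod ((F \<phi> - G \<phi>) / c - H \<phi>) \<le> cmod (F \<phi> - G \<phi>) / cmod c + cmod (H \<phi>)"
        by (metis norm_divide norm_triangle_ineq4)
      also have "\<dots> \<le> (a * H1_norm \<phi> + b * H1_norm \<phi>) / cmod c + d * H1_norm \<phi>"
        using abd[OF that] norm_triangle_ineq4[of "F \<phi>" "G \<phi>"]
        by (intro add_mono divide_right_mono) auto
      finally show ?thesis by (simp add: algebra_simps add_divide_distrib)
    qed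
  qed
qed

lemma has_Hm1_time_derivD:
  assumes d: "has_Hm1_time_deriv u D t" and u: "\<And>s. u s \<in> H1" and \<phi>: "\<phi> \<in> H1"
  shows "((\<lambda>s. Re (L2_to_Hm1 (u s) \<phi>)) has_real_derivative Re (D \<phi>)) (at t)"
proof -
  define F where "F s = (\<lambda>\<phi>. (L2_to_Hm1 (u s) \<phi> - L2_to_Hm1 (u t) \<phi>) / of_real (s - t) - D \<phi>)" for s
  have D: "D \<in> Hm1" and lim: "((\<lambda>s. Hm1_norm (F s)) \<longlongrightarrow> 0) (at t)"
    using d by (simp_all add: has_Hm1_time_deriv_def F_def)
  have FH: "F s \<in> Hm1" for s
    unfolding F_def by (intro Hm1_quotient_diff L2_to_Hm1_Hm1 u D)
  have "((\<lambda>s. F s \<phi>) \<longlongrightarrow> 0) (at t)"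
  proof (rule Lim_null_comparison)
    show "\<forall>\<^sub>F s in at t. norm (F s \<phi>) \<le> Hm1_norm (F s) * (H1_norm \<phi> + 1)"
      by (intro always_eventually allI Hm1_norm_bound FH \<phi>)
    show "((\<lambda>s. Hm1_norm (F s) * (H1_norm \<phi> + 1)) \<longlongrightarrow> 0) (at t)" by (rule tendsto_mult_left_zero[OF lim])
  qed
  then have "((\<lambda>s. (L2_to_Hm1 (u s) \<phi> - L2_to_Hm1 (u t) \<phi>) / of_real (s - t)) \<longlongrightarrow> D \<phi>) (at t)"
    unfolding F_def by (rule LIM_zero_cancel)
  from tendsto_Re[OF this] show ?thesis
    by (simp add: has_field_derivative_iff)
qed

lemma i_mult_rotated: "\<i> * (-\<i> * c + b) = c + \<i> * b"
  by (simp add: complex_eq_iff)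

context manakov
begin

text \<open>The term \<open>\<i> \<integral>u \<phi>\<close> that the \<open>H\<^sup>1\<close> pairing of \<open>rot X\<close> has in excess of \<open>- dxx\<close> cancels against the term
  \<open>- X\<close> in the perturbation.\<close>
lemma right_hand_side:
  assumes f: "f \<in> H1" and h: "h \<in> H1" and \<phi>: "\<phi> \<in> H1"
  defines "X \<equiv> (rep f, rep h)"
  shows "- dxx f \<phi> + L2_to_Hm1 (\<lambda>x. of_real \<kappa> * h x + \<i> * of_real \<gamma> * f x
            - of_real (g11 * (cmod (f x))\<^sup>2 + g12 * (cmod (h x))\<^sup>2) * f x) \<phi>
         = \<i> * h1_pairing (fst (rot X + massop (forcing X))) (rep \<phi>)"
    and "- dxx h \<phi> + L2_to_Hm1 (\<lambda>x. of_real \<kappa> * f x - \<i> * of_real \<gamma> * h x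
            - of_real (g12 * (cmod (f x))\<^sup>2 + g22 * (cmod (h x))\<^sup>2) * h x) \<phi>
         = \<i> * h1_pairing (snd (rot X + massop (forcing X))) (rep \<phi>)"
proof -
  note [measurable] = H1_measurable[OF f] H1_measurable[OF h] H1_measurable[OF \<phi>] fn_measurable
  have main: "- dxx a \<phi> + L2_to_Hm1 e \<phi> = \<i> * (h1_pairing (cscale (-\<i>) (rep a)) (rep \<phi>) + (\<integral>x. fn B x * fn (rep \<phi>) x \<partial>lborel))"
    if a: "a \<in> H1" and em[measurable]: "e \<in> borel_measurable borel" and e: "AE x in lborel. e x = \<i> * fn B x + a x" for a e B
  proof -
    have i: "integrable lborel (\<lambda>x. fn A x * fn (rep \<phi>) x)" for A by (intro L2_mult_integrable(1) fn_L2)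
    have "L2_to_Hm1 e \<phi> = (\<integral>x. \<i> * (fn B x * fn (rep \<phi>) x) + fn (rep a) x * fn (rep \<phi>) x \<partial>lborel)"
      unfolding L2_to_Hm1_def
    proof (rule integral_cong_AE)
      show "AE x in lborel. e x * \<phi> x = \<i> * (fn B x * fn (rep \<phi>) x) + fn (rep a) x * fn (rep \<phi>) x"
        using e rep_AE[OF \<phi>] rep_AE[OF a] by eventually_elim (simp add: algebra_simps)
    qed measurable
    also have "\<dots> = \<i> * (\<integral>x. fn B x * fn (rep \<phi>) x \<partial>lborel) + (\<integral>x. fn (rep a) x * fn (rep \<phi>) x \<partial>lborel)"
      using i by simp
    finally have "L2_to_Hm1 e \<phi> = \<i> * (\<integral>x. fn B x * fn (rep \<phi>) x \<partial>lborel) + (\<integral>x. fn (rep a) x * fn (rep \<phi>) x \<partial>lborel)" .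
    then show ?thesis
      by (simp only: dxx_rep[OF a \<phi>] h1_pairing_cscale_left i_mult_rotated) (simp add: h1_pairing_def)
  qed
  have F: "fst (forcing X) = cscale (-\<i>) (fst (nonlin X) - rep f) + \<gamma> *\<^sub>R rep f"
    "snd (forcing X) = cscale (-\<i>) (snd (nonlin X) - rep h) + (- \<gamma>) *\<^sub>R rep h"
    by (simp_all add: forcing_def rot_def gainloss_def X_def)
  have c: "h1_pairing (fst (rot X + massop (forcing X))) (rep \<phi>) = h1_pairing (cscale (-\<i>) (rep f)) (rep \<phi>) + (\<integral>x. fn (fst (forcing X)) x * fn (rep \<phi>) x \<partial>lborel)"
    "h1_pairing (snd (rot X + massop (forcing X))) (rep \<phi>) = h1_pairing (cscale (-\<i>) (rep h)) (rep \<phi>) + (\<integral>x. fn (snd (forcing X)) x * fn (rep \<phi>) x \<partial>lborel)"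
    by (simp_all add: h1_pairing_add_left h1_pairing_massop) (simp_all add: rot_def X_def)
  show "- dxx f \<phi> + L2_to_Hm1 (\<lambda>x. of_real \<kappa> * h x + \<i> * of_real \<gamma> * f x
            - of_real (g11 * (cmod (f x))\<^sup>2 + g12 * (cmod (h x))\<^sup>2) * f x) \<phi>
         = \<i> * h1_pairing (fst (rot X + massop (forcing X))) (rep \<phi>)"
    unfolding c
  proof (rule main[OF f])
    have p: "fn (fst (forcing X)) x = -\<i> * (of_real \<kappa> * fn (rep h) x
          - of_real (g11 * (cmod (fn (rep f) x))\<^sup>2 + g12 * (cmod (fn (rep h) x))\<^sup>2) * fn (rep f) x - fn (rep f) x)
        + of_real \<gamma> * fn (rep f) x" for x
      unfolding F by (simp add: nonlin_def S1_def X_def del: scaleR_minus_left)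
    show "AE x in lborel. of_real \<kappa> * h x + \<i> * of_real \<gamma> * f x - of_real (g11 * (cmod (f x))\<^sup>2 + g12 * (cmod (h x))\<^sup>2) * f x
        = \<i> * fn (fst (forcing X)) x + f x"
      using rep_AE[OF f] rep_AE[OF h]
      by eventually_elim (simp only: p i_mult_rotated, simp add: algebra_simps)
  qed measurable
  show "- dxx h \<phi> + L2_to_Hm1 (\<lambda>x. of_real \<kappa> * f x - \<i> * of_real \<gamma> * h x
            - of_real (g12 * (cmod (f x))\<^sup>2 + g22 * (cmod (h x))\<^sup>2) * h x) \<phi>
         = \<i> * h1_pairing (snd (rot X + massop (forcing X))) (rep \<phi>)"
    unfolding c
  proof (rule main[OF h])
    have p: "fn (snd (forcing X)) x = -\<i> * (of_real \<kappa> * fn (rep f) x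
          - of_real (g12 * (cmod (fn (rep f) x))\<^sup>2 + g22 * (cmod (fn (rep h) x))\<^sup>2) * fn (rep h) x - fn (rep h) x)
        + of_real (- \<gamma>) * fn (rep h) x" for x
      unfolding F by (simp add: nonlin_def S2_def X_def del: scaleR_minus_left)
    show "AE x in lborel. of_real \<kappa> * f x - \<i> * of_real \<gamma> * h x - of_real (g12 * (cmod (f x))\<^sup>2 + g22 * (cmod (h x))\<^sup>2) * h x
        = \<i> * fn (snd (forcing X)) x + h x"
      using rep_AE[OF f] rep_AE[OF h]
      by eventually_elim (simp only: p i_mult_rotated, simp add: algebra_simps)
  qed measurable
qed

lemma manakov_solution_of_Vsol:
  assumes U: "\<And>\<tau>. Vsol \<tau> U"
  shows "manakov_solution \<gamma> \<kappa> g11 g22 g12 (\<lambda>t. fn (fst (U t))) (\<lambda>t. fn (snd (U t)))"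
proof -
  have Uc: "continuous (at t) U" for t by (rule VsolD(1)[OF U])
  have T: "((\<lambda>t. massop (U t)) has_vector_derivative rot (U t) + massop (forcing (U t))) (at t)" for t
    by (rule VsolD(2)[OF U[of "\<bar>t\<bar> + 1"]]) simp
  have cont: "continuous_in_H1 (\<lambda>t. fn (A t))" if "\<And>t. continuous (at t) A" for A
    unfolding continuous_in_H1_def
  proof (intro conjI allI fn_H1)
    fix t
    have "((\<lambda>s. norm (A s - A t)) \<longlongrightarrow> 0) (at t)"
      using that[of t] by (simp add: isCont_def tendsto_norm_zero_iff LIM_zero_iff)
    then show "((\<lambda>s. H1_norm (\<lambda>x. fn (A s) x - fn (A t) x)) \<longlongrightarrow> 0) (at t)"
      by (simp add: rep_difference[OF fn_H1 fn_H1])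
  qed
  have "continuous (at t) (\<lambda>t. fst (U t))" "continuous (at t) (\<lambda>t. snd (U t))" for t
    by (intro continuous_fst continuous_snd Uc)+
  then have c: "continuous_in_H1 (\<lambda>t. fn (fst (U t)))" "continuous_in_H1 (\<lambda>t. fn (snd (U t)))"
    by (intro cont; simp)+
  have d: "has_Hm1_time_deriv (\<lambda>t. fn (fst (U t))) (\<lambda>\<phi>. h1_pairing (fst (rot (U t) + massop (forcing (U t)))) (rep \<phi>)) t"
    "has_Hm1_time_deriv (\<lambda>t. fn (snd (U t))) (\<lambda>\<phi>. h1_pairing (snd (rot (U t) + massop (forcing (U t)))) (rep \<phi>)) t" for t
  proof -
    show "has_Hm1_time_deriv (\<lambda>t. fn (fst (U t))) (\<lambda>\<phi>. h1_pairing (fst (rot (U t) + massop (forcing (U t)))) (rep \<phi>)) t"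
      by (rule has_Hm1_time_deriv_of_strong[where A = "\<lambda>t. fst (massop (U t))"])
        (simp_all add: fn_H1 L2_to_Hm1_rep h1_pairing_massop bounded_linear.has_vector_derivative[OF bounded_linear_fst T] del: fst_add)
    show "has_Hm1_time_deriv (\<lambda>t. fn (snd (U t))) (\<lambda>\<phi>. h1_pairing (snd (rot (U t) + massop (forcing (U t)))) (rep \<phi>)) t"
      by (rule has_Hm1_time_deriv_of_strong[where A = "\<lambda>t. snd (massop (U t))"])
        (simp_all add: fn_H1 L2_to_Hm1_rep h1_pairing_massop bounded_linear.has_vector_derivative[OF bounded_linear_snd T] del: snd_add)
  qed
  have e: "\<i> * h1_pairing (fst (rot (U t) + massop (forcing (U t)))) (rep \<phi>) = - dxx (fn (fst (U t))) \<phi>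
      + L2_to_Hm1 (\<lambda>x. of_real \<kappa> * fn (snd (U t)) x + \<i> * of_real \<gamma> * fn (fst (U t)) x
         - of_real (g11 * (cmod (fn (fst (U t)) x))\<^sup>2 + g12 * (cmod (fn (snd (U t)) x))\<^sup>2) * fn (fst (U t)) x) \<phi>"
    "\<i> * h1_pairing (snd (rot (U t) + massop (forcing (U t)))) (rep \<phi>) = - dxx (fn (snd (U t))) \<phi>
      + L2_to_Hm1 (\<lambda>x. of_real \<kappa> * fn (fst (U t)) x - \<i> * of_real \<gamma> * fn (snd (U t)) x
         - of_real (g12 * (cmod (fn (fst (U t)) x))\<^sup>2 + g22 * (cmod (fn (snd (U t)) x))\<^sup>2) * fn (snd (U t)) x) \<phi>"
    if "\<phi> \<in> H1" for t \<phi>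
    using right_hand_side[OF fn_H1[of "fst (U t)"] fn_H1[of "snd (U t)"] that] by simp_all
  show ?thesis
    unfolding manakov_solution_def using c d e by blast
qed

text \<open>Pairing with a fixed element of \<open>V\<close> gives real differentiable functions of time; the derivative is
  continuous in \<open>V\<close>, so \<open>weak_imp_strong_derivative\<close> applies.\<close>
lemma Vsol_of_manakov_solution:
  assumes sol: "manakov_solution \<gamma> \<kappa> g11 g22 g12 u v"
  shows "Vsol \<tau> (\<lambda>t. (rep (u t), rep (v t)))"
proof -
  define U where "U t = (rep (u t), rep (v t))" for t
  have uH: "u t \<in> H1" and vH: "v t \<in> H1" for t
    using sol by (auto simp: manakov_solution_def continuous_in_H1_def)
  have cont: "continuous (at t) (\<lambda>t. rep (w t))" if "continuous_in_H1 w" for w t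
  proof -
    have w: "w s \<in> H1" for s using that by (simp add: continuous_in_H1_def)
    have "((\<lambda>s. H1_norm (\<lambda>x. w s x - w t x)) \<longlongrightarrow> 0) (at t)" using that by (simp add: continuous_in_H1_def)
    then show ?thesis
      by (simp add: rep_difference[OF w w] isCont_def tendsto_norm_zero_iff LIM_zero_iff)
  qed
  have Uc: "continuous (at t) U" for t
    unfolding U_def[abs_def] using sol by (intro continuous_Pair cont) (auto simp: manakov_solution_def)
  have l2ip_Re: "l2ip (rep w) P = Re (L2_to_Hm1 w (fn (hcnj P)))" if "w \<in> H1" for w P
    by (simp add: L2_to_Hm1_rep[OF that fn_H1] l2ip_def L2_inner_def)
  have weak: "((\<lambda>t. massop (U t) \<bullet> W) has_real_derivative (rot (U t) + massop (forcing (U t))) \<bullet> W) (at t)" for W t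
  proof -
    obtain ut vt where d: "has_Hm1_time_deriv u ut t" "has_Hm1_time_deriv v vt t"
      and e: "\<And>\<phi>. \<phi> \<in> H1 \<Longrightarrow> \<i> * ut \<phi> = \<i> * h1_pairing (fst (rot (U t) + massop (forcing (U t)))) (rep \<phi>)"
        "\<And>\<phi>. \<phi> \<in> H1 \<Longrightarrow> \<i> * vt \<phi> = \<i> * h1_pairing (snd (rot (U t) + massop (forcing (U t)))) (rep \<phi>)"
    proof -
      have "\<exists>ut vt. has_Hm1_time_deriv u ut t \<and> has_Hm1_time_deriv v vt t \<and>
        (\<forall>\<phi>\<in>H1.
           \<i> * ut \<phi> = - dxx (u t) \<phi>
             + L2_to_Hm1 (\<lambda>x. of_real \<kappa> * v t x + \<i> * of_real \<gamma> * u t x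
                 - of_real (g11 * (cmod (u t x))\<^sup>2 + g12 * (cmod (v t x))\<^sup>2) * u t x) \<phi> \<and>
           \<i> * vt \<phi> = - dxx (v t) \<phi>
             + L2_to_Hm1 (\<lambda>x. of_real \<kappa> * u t x - \<i> * of_real \<gamma> * v t x
                 - of_real (g12 * (cmod (u t x))\<^sup>2 + g22 * (cmod (v t x))\<^sup>2) * v t x) \<phi>)"
        using sol unfolding manakov_solution_def by blast
      then obtain ut vt where *: "has_Hm1_time_deriv u ut t" "has_Hm1_time_deriv v vt t"
        "\<And>\<phi>. \<phi> \<in> H1 \<Longrightarrow> \<i> * ut \<phi> = - dxx (u t) \<phi>
             + L2_to_Hm1 (\<lambda>x. of_real \<kappa> * v t x + \<i> * of_real \<gamma> * u t x
                 - of_real (g11 * (cmod (u t x))\<^sup>2 + g12 * (cmod (v t x))\<^sup>2) * u t x) \<phi>"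
        "\<And>\<phi>. \<phi> \<in> H1 \<Longrightarrow> \<i> * vt \<phi> = - dxx (v t) \<phi>
             + L2_to_Hm1 (\<lambda>x. of_real \<kappa> * u t x - \<i> * of_real \<gamma> * v t x
                 - of_real (g12 * (cmod (u t x))\<^sup>2 + g22 * (cmod (v t x))\<^sup>2) * v t x) \<phi>" by blast
      show thesis
      proof (rule that[OF *(1,2)])
        fix \<phi> assume \<phi>: "\<phi> \<in> H1"
        show "\<i> * ut \<phi> = \<i> * h1_pairing (fst (rot (U t) + massop (forcing (U t)))) (rep \<phi>)"
          unfolding *(3)[OF \<phi>] U_def by (rule right_hand_side(1)[OF uH vH \<phi>])
        show "\<i> * vt \<phi> = \<i> * h1_pairing (snd (rot (U t) + massop (forcing (U t)))) (rep \<phi>)"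
          unfolding *(4)[OF \<phi>] U_def by (rule right_hand_side(2)[OF uH vH \<phi>])
      qed
    qed
    have "((\<lambda>s. Re (L2_to_Hm1 (u s) (fn (hcnj (fst W)))) + Re (L2_to_Hm1 (v s) (fn (hcnj (snd W)))))
        has_real_derivative Re (ut (fn (hcnj (fst W)))) + Re (vt (fn (hcnj (snd W))))) (at t)"
      by (intro DERIV_add has_Hm1_time_derivD[OF d(1)] has_Hm1_time_derivD[OF d(2)] uH vH fn_H1)
    moreover have "Re (L2_to_Hm1 (u s) (fn (hcnj (fst W)))) + Re (L2_to_Hm1 (v s) (fn (hcnj (snd W)))) = massop (U s) \<bullet> W" for s
      by (simp add: massop_inner V_l2ip_def U_def l2ip_Re uH vH)
    moreover have "Re (ut (fn (hcnj (fst W)))) + Re (vt (fn (hcnj (snd W)))) = (rot (U t) + massop (forcing (U t))) \<bullet> W"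
    proof -
      have hh: "hcnj (hcnj P) = P" for P by (rule h1_eqI) simp
      have "ut (fn (hcnj P)) = h1_pairing (fst (rot (U t) + massop (forcing (U t)))) (hcnj P)"
        "vt (fn (hcnj P)) = h1_pairing (snd (rot (U t) + massop (forcing (U t)))) (hcnj P)" for P
        using e[OF fn_H1[of "hcnj P"]] by simp_all
      then show ?thesis by (simp add: Re_h1_pairing hh inner_prod_def)
    qed
    ultimately show ?thesis by simp
  qed
  have Fc: "continuous_on UNIV forcing"
  proof -
    have "continuous_on UNIV (\<lambda>X. (fst (forcing X), snd (forcing X)))"
      by (intro continuous_intros tame_continuous tame_forcing)
    then show ?thesis by simp
  qed
  have gc: "continuous (at t) (\<lambda>t. rot (U t) + massop (forcing (U t)))" for t
  proof -
    have "continuous_on UNIV U" using Uc by (simp add: continuous_at_imp_continuous_on)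
    then have "continuous_on UNIV (\<lambda>t. rot (U t) + massop (forcing (U t)))"
      by (intro continuous_intros continuous_on_compose2[OF Fc]
          continuous_on_compose2[OF linear_continuous_on[OF rot_bounded_linear]]
          continuous_on_compose2[OF linear_continuous_on[OF massop_bounded_linear]]) auto
    then show ?thesis by (simp add: continuous_on_eq_continuous_at)
  qed
  have "((\<lambda>t. massop (U t)) has_vector_derivative rot (U t) + massop (forcing (U t))) (at t)" for t
    by (rule weak_imp_strong_derivative[OF weak gc])
  then have "Vsol \<tau> U" using Uc by (simp add: Vsol_def continuous_at_imp_continuous_on)
  then show ?thesis by (simp add: U_def[abs_def])
qed

end

theorem theorem2p1:
  fixes \<gamma> \<kappa> g11 g22 g12 :: real and u0 v0 :: "real \<Rightarrow> complex"
  assumes "\<gamma> > 0" and "\<kappa> > 0" and "u0 \<in> H1" and "v0 \<in> H1"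
  shows "\<exists>u v. manakov_solution \<gamma> \<kappa> g11 g22 g12 u v \<and> has_initial_data u v u0 v0 \<and>
           (\<forall>u' v'. manakov_solution \<gamma> \<kappa> g11 g22 g12 u' v' \<and> has_initial_data u' v' u0 v0 \<longrightarrow>
              (\<forall>t. AE x in lborel. u' t x = u t x \<and> v' t x = v t x))"
proof -
  interpret manakov \<gamma> \<kappa> g11 g22 g12 using assms(1,2) by unfold_locales
  obtain U where U0: "U 0 = (rep u0, rep v0)" and U: "\<And>\<tau>. Vsol \<tau> U"
    using global_solution by blast
  define u v where "u t = fn (fst (U t))" and "v t = fn (snd (U t))" for t
  have "manakov_solution \<gamma> \<kappa> g11 g22 g12 u v"
    unfolding u_def[abs_def] v_def[abs_def] by (rule manakov_solution_of_Vsol[OF U])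
  moreover have "has_initial_data u v u0 v0"
    unfolding has_initial_data_def u_def v_def U0
    using rep_AE[OF assms(3)] rep_AE[OF assms(4)] by eventually_elim simp
  moreover have "AE x in lborel. u' t x = u t x \<and> v' t x = v t x"
    if sol: "manakov_solution \<gamma> \<kappa> g11 g22 g12 u' v'" and ini: "has_initial_data u' v' u0 v0" for u' v' t
  proof -
    have H: "u' s \<in> H1" "v' s \<in> H1" for s
      using sol by (auto simp: manakov_solution_def continuous_in_H1_def)
    have "AE x in lborel. u' 0 x = fn (rep u0) x" "AE x in lborel. v' 0 x = fn (rep v0) x"
      using ini rep_AE[OF assms(3)] rep_AE[OF assms(4)] unfolding has_initial_data_def
      by (eventually_elim, simp)+
    then have i: "rep (u' 0) = rep u0" "rep (v' 0) = rep v0"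
      by (intro rep_unique H; simp)+
    have "(rep (u' t), rep (v' t)) = U t"
      by (rule Vsol_unique[OF Vsol_of_manakov_solution[OF sol] U, of t "\<bar>t\<bar> + 1"]) (simp_all add: U0 i)
    then have "fst (U t) = rep (u' t)" "snd (U t) = rep (v' t)" by (metis fst_conv, metis snd_conv)
    then have "u t = fn (rep (u' t))" "v t = fn (rep (v' t))" by (simp_all add: u_def v_def)
    then show ?thesis using rep_AE[OF H(1)[of t]] rep_AE[OF H(2)[of t]] by simp
  qed
  ultimately show ?thesis by blast
qed

end
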